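(* Fix $t_0\in(0,1)$, suppose that there exists $z\in\mathbb{C}$ with $z\notin\operatorname{Spec}(\mathcal{N}_t+V_t)$ for all $t$ near $t_0$, and let $\lambda$ be an isolated, simple eigenvalue of $\mathcal{N}_{t_0}+V_{t_0}$. Assume that the mappings $t\mapsto\mathrm{T}_t$, $t\mapsto V_t$, $t\mapsto P_t$, $t\mapsto Q_t$ are differentiable at $t_0$. Define $$T^{(1)}:=P(t_0)\dot V_{t_0}P(t_0)-\tau\big(\mathrm{T}_{t_0}P(t_0)\big)^*\big(\dot P_{t_0}J\oplus(-\dot Q_{t_0}J)\big)\mathrm{T}_{t_0}P(t_0)-\tau\big(\mathrm{T}_{t_0}P(t_0)\big)^*\mathcal{J}\,\dot{\mathrm{T}}_{t_0}P(t_0),$$ and denote by $\lambda^{(1)}_{t_0}$ and $\mathbf{u}_{t_0}$ the eigenvalue and an eigenvector of this one-dimensional operator (acting on $\operatorname{ran}P(t_0)$), $\mathbf{u}_{t_0}\in\operatorname{ran}P(t_0)=\ker(\mathcal{N}_{t_0}+V_{t_0}-\lambda)$. Suppose further that $\lambda\in\mathbb{R}$. Then, for $t$ near $t_0$, the eigenvalue $\lambda(t)$ of $\mathcal{N}_t+V_t$ satisfies $$\lambda(t)=\lambda+\lambda^{(1)}_{t_0}(t-t_0)+o(t-t_0),\qquad t\to t_0.$$ Moreover, $$\lambda'(t_0)=\frac{\langle\tau\dot V_{t_0}\mathbf{u}_{t_0},\mathbf{u}_{t_0}\rangle_{\mathcal{H}^2}+\Omega\big((\dot P_{t_0}\oplus\dot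 Q_{t_0})\mathrm{T}_{t_0}\mathbf{u}_{t_0},\mathrm{T}_{t_0}\mathbf{u}_{t_0}\big)+\Omega\big(\mathrm{T}_{t_0}\mathbf{u}_{t_0},\dot{\mathrm{T}}_{t_0}\mathbf{u}_{t_0}\big)}{\langle\tau\mathbf{u}_{t_0},\mathbf{u}_{t_0}\rangle_{\mathcal{H}^2}},$$ where $\langle\tau\mathbf{u}_{t_0},\mathbf{u}_{t_0}\rangle_{\mathcal{H}^2}\ne0$.
   Context: $\mathcal{H},\mathfrak{H}$ are separable complex Hilbert spaces. $A$ is a closed, densely defined, symmetric linear operator in $\mathcal{H}$ with $\dim\ker(A^*+i)=\dim\ker(A^*-i)<\infty$. $\mathcal{H}_+:=\operatorname{dom}(A^* )$ carries the graph scalar product of $A^*$. Put $\mathcal{H}^2=\mathcal{H}\times\mathcal{H}$, $\mathcal{H}_+^2=\mathcal{H}_+\times\mathcal{H}_+$, $\mathfrak{H}^2=\mathfrak{H}\times\mathfrak{H}$, $\mathfrak{H}^4=\mathfrak{H}^2\times\mathfrak{H}^2$, and $$\tau=\begin{pmatrix}0&I_{\mathcal{H}}\\ I_{\mathcal{H}}&0\end{pmatrix}\ \text{on }\mathcal{H}^2,\qquad J=\begin{pmatrix}0&I_{\mathfrak{H}}\\ -I_{\mathfrak{H}}&0\end{pmatrix}\ \text{on }\mathfrak{H}^2,\qquad \mathcal{J}=J\oplus(-J)\ \text{on }\mathfrak{H}^4,\qquad \Omega(f,g)=\langle\mathcal{J}f,g\rangle_{\mathfrak{H}^4},$$ where $X\oplus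 Y$ is the block diagonal operator on $\mathfrak{H}^4=\mathfrak{H}^2\times\mathfrak{H}^2$. A subspace of $\mathfrak{H}^2$ is Lagrangian if it equals its annihilator with respect to $\omega(f,g)=\langle Jf,g\rangle_{\mathfrak{H}^2}$. Standing assumptions on one-parameter families, $t\in[0,1]$: (a) $\operatorname{tr}_t=(\Gamma_{0,t},\Gamma_{1,t})^\top\in\mathcal{B}(\mathcal{H}_+,\mathfrak{H}^2)$ is surjective and satisfies $\langle A^*u,v\rangle_{\mathcal{H}}-\langle u,A^*v\rangle_{\mathcal{H}}=\langle\Gamma_{1,t}u,\Gamma_{0,t}v\rangle_{\mathfrak{H}}-\langle\Gamma_{0,t}u,\Gamma_{1,t}v\rangle_{\mathfrak{H}}$ for all $u,v\in\mathcal{H}_+$; $\mathrm{T}_t:=\operatorname{tr}_t\oplus\operatorname{tr}_t\in\mathcal{B}(\mathcal{H}_+^2,\mathfrak{H}^4)$. (b) $P_t,Q_t\in\mathcal{B}(\mathfrak{H}^2)$ are orthogonal projections with Lagrangian ranges. (c) $\mathcal{A}_t,\mathcal{B}_t$ are self-adjoint extensions of $A$ with $\operatorname{tr}_t(\operatorname{dom}\mathcal{A}_t)=\operatorname{ran}P_t$, $\operatorname{tr}_t(\operatorname{dom}\mathcal{B}_t)=\operatorname{ran}Q_t$, and $\mathcal{N}_t=\begin{pmatrix}0&-\mathcal{B}_t\\ \mathcal{A}_t&0\end{pmatrix}$ with $\operatorname{dom}\mathcal{N}_t=\operatorname{dom}\mathcal{A}_t\times\operatorname{dom}\mathcal{B}_t$.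 (d) $F_t,G_t\in\mathcal{B}(\mathcal{H})$ are self-adjoint and $V_t=\begin{pmatrix}0&-G_t\\ F_t&0\end{pmatrix}\in\mathcal{B}(\mathcal{H}^2)$. Differentiability of $V_t,\mathrm{T}_t,P_t,Q_t$ is in the operator norms of $\mathcal{B}(\mathcal{H}^2)$, $\mathcal{B}(\mathcal{H}_+^2,\mathfrak{H}^4)$, $\mathcal{B}(\mathfrak{H}^2)$, $\mathcal{B}(\mathfrak{H}^2)$; the dot denotes $d/dt$. $R_t(\zeta)=(\mathcal{N}_t+V_t-\zeta)^{-1}$. "Simple" means algebraically simple. The contour is $$\gamma=\{z\in\mathbb{C}:2|z-\lambda|=\operatorname{dist}(\lambda,\operatorname{Spec}(\mathcal{N}_{t_0}+V_{t_0})\setminus\{\lambda\})\},$$ oriented anti-clockwise. For $t$ near $t_0$, $\gamma$ encloses exactly one point $\lambda(t)$ of $\operatorname{Spec}(\mathcal{N}_t+V_t)$, a simple eigenvalue, with Riesz projection $P(t)=-\frac1{2\pi i}\int_\gamma R_t(\zeta)\,d\zeta$ (not to be confused with $P_t$). $P(t)$ maps $\mathcal{H}^2$ boundedly into $\mathcal{H}_+^2$, so $\mathrm{T}_tP(t)\in\mathcal{B}(\mathcal{H}^2,\mathfrak{H}^4)$, and $(\cdot)^*$ denotes the adjoint. *)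

theory Defs
  imports "HOL-Analysis.Analysis" "HOL-Complex_Analysis.Contour_Integration"
begin

section \<open>Complex vector spaces and Hilbert spaces\<close>

text \<open>The distribution only has real vector spaces and real inner products. The complex classes
  below extend the real ones, so that topology, norms, completeness, integration and bounded linear
  maps are those of HOL-Analysis.\<close>

class complex_vector = real_vector +
  fixes scaleC :: "complex \<Rightarrow> 'a \<Rightarrow> 'a" (infixr \<open>*\<^sub>C\<close> 75)
  assumes scaleC_add_right: "c *\<^sub>C (x + y) = c *\<^sub>C x + c *\<^sub>C y"
    and scaleC_add_left: "(c + d) *\<^sub>C x = c *\<^sub>C x + d *\<^sub>C x"
    and scaleC_scaleC: "c *\<^sub>C (d *\<^sub>C x) = (c * d) *\<^sub>C x"
    and scaleC_of_real: "complex_of_real r *\<^sub>C x = r *\<^sub>R x"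

class complex_normed_vector = complex_vector + real_normed_vector +
  assumes norm_scaleC: "norm (c *\<^sub>C x) = cmod c * norm x"

text \<open>The inner product is linear in the first and conjugate linear in the second argument.\<close>

class complex_inner = complex_vector + real_normed_vector +
  fixes cinner :: "'a \<Rightarrow> 'a \<Rightarrow> complex"
  assumes cinner_commute: "cinner x y = cnj (cinner y x)"
    and cinner_add_left: "cinner (x + y) z = cinner x z + cinner y z"
    and cinner_scaleC_left: "cinner (c *\<^sub>C x) y = c * cinner x y"
    and cinner_norm: "cinner x x = complex_of_real ((norm x)\<^sup>2)"
begin

lemma cinner_scaleC_right: "cinner x (c *\<^sub>C y) = cnj c * cinner x y"
  by (metis cinner_commute cinner_scaleC_left complex_cnj_mult)

subclass complex_normed_vector
proof
  fix c and x :: 'a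
  have "complex_of_real ((norm (c *\<^sub>C x))\<^sup>2) = cinner (c *\<^sub>C x) (c *\<^sub>C x)"
    by (simp only: cinner_norm)
  also have "\<dots> = (c * cnj c) * cinner x x"
    by (simp add: cinner_scaleC_left cinner_scaleC_right)
  also have "\<dots> = complex_of_real ((cmod c * norm x)\<^sup>2)"
    by (simp add: cinner_norm complex_norm_square[symmetric] power_mult_distrib)
  finally have "(norm (c *\<^sub>C x))\<^sup>2 = (cmod c * norm x)\<^sup>2"
    using of_real_eq_iff by blast
  then show "norm (c *\<^sub>C x) = cmod c * norm x"
    by (simp add: power2_eq_iff_nonneg)
qed

end

class chilbert_space = complex_inner + banach

interpretation complex_vector: vector_space "scaleC :: complex \<Rightarrow> 'a \<Rightarrow> 'a::complex_vector"
proof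
  fix x :: 'a
  show "1 *\<^sub>C x = x"
    using scaleC_of_real[of 1 x] by simp
qed (simp_all add: scaleC_add_right scaleC_add_left scaleC_scaleC)

abbreviation csubspace :: "'a::complex_vector set \<Rightarrow> bool"
  where "csubspace \<equiv> complex_vector.subspace"

abbreviation cspan :: "'a::complex_vector set \<Rightarrow> 'a set"
  where "cspan \<equiv> complex_vector.span"

text \<open>As for every library dimension, the value is 0 on infinite-dimensional subspaces.\<close>

abbreviation cdim :: "'a::complex_vector set \<Rightarrow> nat"
  where "cdim \<equiv> complex_vector.dim"

definition cfinite_dim :: "'a::complex_vector set \<Rightarrow> bool"
  where "cfinite_dim S \<longleftrightarrow> (\<exists>B. finite B \<and> cspan B = S)"

abbreviation clinear :: "('a::complex_vector \<Rightarrow> 'b::complex_vector) \<Rightarrow> bool"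
  where "clinear \<equiv> Vector_Spaces.linear scaleC scaleC"

instantiation prod :: (complex_vector, complex_vector) complex_vector
begin

definition scaleC_prod_def: "c *\<^sub>C p = (c *\<^sub>C fst p, c *\<^sub>C snd p)"

instance
  by standard (simp_all add: scaleC_prod_def scaleC_add_right scaleC_add_left scaleC_scaleC
      scaleC_of_real prod_eq_iff)

end

instantiation prod :: (complex_inner, complex_inner) complex_inner
begin

definition cinner_prod_def: "cinner p q = cinner (fst p) (fst q) + cinner (snd p) (snd q)"

instance
proof
  fix x y z :: "'a \<times> 'b" and c
  show "cinner x y = cnj (cinner y x)"
    unfolding cinner_prod_def complex_cnj_add
    by (intro arg_cong2[where f = "(+)"] cinner_commute)
  show "cinner (x + y) z = cinner x z + cinner y z"
    by (simp add: cinner_prod_def cinner_add_left)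
  show "cinner (c *\<^sub>C x) y = c * cinner x y"
    by (simp add: cinner_prod_def scaleC_prod_def cinner_scaleC_left distrib_left)
  show "cinner x x = complex_of_real ((norm x)\<^sup>2)"
    by (simp add: cinner_prod_def cinner_norm norm_prod_def)
qed

end

instance prod :: (chilbert_space, chilbert_space) chilbert_space ..

text \<open>Real-linear maps into a complex space form a complex space. Bounded operators between complex
  Hilbert spaces are represented as bounded real-linear maps that satisfy the predicate
  \<open>cbounded\<close>; on these the norm of the type is the usual operator norm.\<close>

instantiation blinfun :: (real_normed_vector, complex_normed_vector) complex_vector
begin

lift_definition scaleC_blinfun :: "complex \<Rightarrow> ('a \<Rightarrow>\<^sub>L 'b) \<Rightarrow> ('a \<Rightarrow>\<^sub>L 'b)"
  is "\<lambda>c f x. c *\<^sub>C f x"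
proof -
  fix c and f :: "'a \<Rightarrow> 'b"
  assume f: "bounded_linear f"
  interpret f: bounded_linear f by fact
  have comm: "c *\<^sub>C (r *\<^sub>R y) = r *\<^sub>R (c *\<^sub>C y)" for r and y :: 'b
    by (simp add: scaleC_of_real[symmetric] scaleC_scaleC mult.commute)
  obtain K where K: "\<And>x. norm (f x) \<le> norm x * K"
    using f.bounded by blast
  show "bounded_linear (\<lambda>x. c *\<^sub>C f x)"
  proof (rule bounded_linear_intro[where K = "cmod c * K"])
    fix x
    show "norm (c *\<^sub>C f x) \<le> norm x * (cmod c * K)"
      using mult_left_mono[OF K[of x], of "cmod c"] by (simp add: norm_scaleC ac_simps)
  qed (simp_all add: f.add f.scaleR scaleC_add_right comm)
qed

instance
  by standard (transfer, simp add: scaleC_add_right scaleC_add_left scaleC_scaleC scaleC_of_real)+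

end

definition cbounded :: "('a::complex_normed_vector \<Rightarrow>\<^sub>L 'b::complex_normed_vector) \<Rightarrow> bool"
  where "cbounded T \<longleftrightarrow> clinear (blinfun_apply T)"

definition bounded_self_adjoint :: "('a::complex_inner \<Rightarrow>\<^sub>L 'a) \<Rightarrow> bool"
  where "bounded_self_adjoint F \<longleftrightarrow> cbounded F \<and> (\<forall>x y. cinner (F x) y = cinner x (F y))"

definition orthogonal_projection :: "('a::complex_inner \<Rightarrow>\<^sub>L 'a) \<Rightarrow> bool"
  where "orthogonal_projection P \<longleftrightarrow> bounded_self_adjoint P \<and> P o\<^sub>L P = P"

definition hilbert_adjoint :: "('a::complex_inner \<Rightarrow> 'b::complex_inner) \<Rightarrow> ('b \<Rightarrow> 'a)"
  where "hilbert_adjoint T = (THE S. \<forall>x y. cinner (T x) y = cinner x (S y))"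


section \<open>Unbounded operators\<close>

text \<open>An unbounded operator is identified with its graph, so that \<open>S \<subseteq> T\<close> means that
  \<open>T\<close> extends \<open>S\<close> and \<open>Domain T\<close> is the domain of \<open>T\<close>.\<close>

definition linear_operator :: "('a::complex_vector \<times> 'b::complex_vector) set \<Rightarrow> bool"
  where "linear_operator T \<longleftrightarrow> csubspace T \<and> single_valued T"

definition op_apply :: "('a \<times> 'b) set \<Rightarrow> 'a \<Rightarrow> 'b"
  where "op_apply T x = (THE y. (x, y) \<in> T)"

definition densely_defined :: "('a::topological_space \<times> 'b) set \<Rightarrow> bool"
  where "densely_defined T \<longleftrightarrow> closure (Domain T) = UNIV"

definition op_adjoint :: "('a::complex_inner \<times> 'a) set \<Rightarrow> ('a \<times> 'a) set"
  where "op_adjoint T = {(v, w). \<forall>(u, u') \<in> T. cinner u' v = cinner u w}"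

definition symmetric_operator :: "('a::complex_inner \<times> 'a) set \<Rightarrow> bool"
  where "symmetric_operator T \<longleftrightarrow>
    linear_operator T \<and> (\<forall>(u, u') \<in> T. \<forall>(v, v') \<in> T. cinner u' v = cinner u v')"

definition self_adjoint_operator :: "('a::complex_inner \<times> 'a) set \<Rightarrow> bool"
  where "self_adjoint_operator T \<longleftrightarrow>
    linear_operator T \<and> densely_defined T \<and> op_adjoint T = T"

definition op_kernel :: "('a \<times> 'b::zero) set \<Rightarrow> 'a set"
  where "op_kernel T = {x. (x, 0) \<in> T}"

definition op_shift :: "('a::complex_vector \<times> 'a) set \<Rightarrow> complex \<Rightarrow> ('a \<times> 'a) set"
  where "op_shift T z = {(x, y - z *\<^sub>C x) | x y. (x, y) \<in> T}"

definition op_add_bounded ::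
    "('a::real_normed_vector \<times> 'b::real_normed_vector) set \<Rightarrow> ('a \<Rightarrow>\<^sub>L 'b) \<Rightarrow> ('a \<times> 'b) set"
  where "op_add_bounded T V = {(x, y + V x) | x y. (x, y) \<in> T}"

text \<open>\<open>is_resolvent T z R\<close>: the operator \<open>T - z\<close> maps its domain bijectively onto the whole
  space, and the inverse is the bounded operator \<open>R\<close>.\<close>

definition is_resolvent ::
    "('a::complex_normed_vector \<times> 'a) set \<Rightarrow> complex \<Rightarrow> ('a \<Rightarrow>\<^sub>L 'a) \<Rightarrow> bool"
  where "is_resolvent T z R \<longleftrightarrow> cbounded R \<and> (op_shift T z)\<inverse> = {(x, R x) | x. True}"

definition resolvent :: "('a::complex_normed_vector \<times> 'a) set \<Rightarrow> complex \<Rightarrow> ('a \<Rightarrow>\<^sub>L 'a)"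
  where "resolvent T z = (THE R. is_resolvent T z R)"

definition Spec :: "('a::complex_normed_vector \<times> 'a) set \<Rightarrow> complex set"
  where "Spec T = {z. \<nexists>R. is_resolvent T z R}"

definition operator_contour_integral ::
    "(real \<Rightarrow> complex) \<Rightarrow> (complex \<Rightarrow> 'a::real_normed_vector \<Rightarrow>\<^sub>L 'b::complex_normed_vector) \<Rightarrow> 'a \<Rightarrow>\<^sub>L 'b"
  where "operator_contour_integral g f =
    integral {0..1} (\<lambda>s. vector_derivative g (at s within {0..1}) *\<^sub>C f (g s))"

definition riesz_projection ::
    "('a::complex_normed_vector \<times> 'a) set \<Rightarrow> complex \<Rightarrow> real \<Rightarrow> ('a \<Rightarrow>\<^sub>L 'a)"
  where "riesz_projection T a r =
    (- 1 / (2 * of_real pi * \<i>)) *\<^sub>C operator_contour_integral (circlepath a r) (resolvent T)"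

text \<open>The algebraic multiplicity of an isolated point of the spectrum is the rank of its Riesz
  projection, taken over any sufficiently small circle.\<close>

definition isolated_simple_eigenvalue :: "('a::complex_normed_vector \<times> 'a) set \<Rightarrow> complex \<Rightarrow> bool"
  where "isolated_simple_eigenvalue T z \<longleftrightarrow>
    z isolated_in Spec T \<and> op_kernel (op_shift T z) \<noteq> {0} \<and>
    (\<forall>\<^sub>F r in at_right 0. cdim (range (riesz_projection T z r)) = 1)"


section \<open>The space \<open>dom A\<^sup>*\<close> with the graph scalar product\<close>

text \<open>\<open>S\<close> plays the role of \<open>A\<^sup>*\<close>. The Hilbert space \<open>H\<^sub>+\<close> is the set \<open>Domain S\<close> with
  the norm of \<open>graph_cinner S\<close>; operators on it, and on its square, are functions of which
  only the values on that set matter.\<close>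

definition graph_cinner :: "('a::complex_inner \<times> 'a) set \<Rightarrow> 'a \<Rightarrow> 'a \<Rightarrow> complex"
  where "graph_cinner S u v = cinner u v + cinner (op_apply S u) (op_apply S v)"

definition graph_norm :: "('a::complex_inner \<times> 'a) set \<Rightarrow> 'a \<Rightarrow> real"
  where "graph_norm S u = sqrt (Re (graph_cinner S u u))"

definition graph_norm2 :: "('a::complex_inner \<times> 'a) set \<Rightarrow> 'a \<times> 'a \<Rightarrow> real"
  where "graph_norm2 S p = sqrt ((graph_norm S (fst p))\<^sup>2 + (graph_norm S (snd p))\<^sup>2)"

definition bounded_on ::
    "'a::complex_vector set \<Rightarrow> ('a \<Rightarrow> real) \<Rightarrow> ('a \<Rightarrow> 'b::complex_normed_vector) \<Rightarrow> bool"
  where "bounded_on D N f \<longleftrightarrow>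
    (\<forall>x\<in>D. \<forall>y\<in>D. f (x + y) = f x + f y) \<and> (\<forall>c. \<forall>x\<in>D. f (c *\<^sub>C x) = c *\<^sub>C f x) \<and>
    (\<exists>K. \<forall>x\<in>D. norm (f x) \<le> N x * K)"

definition onorm_on ::
    "'a set \<Rightarrow> ('a \<Rightarrow> real) \<Rightarrow> ('a \<Rightarrow> 'b::real_normed_vector) \<Rightarrow> real"
  where "onorm_on D N f = (SUP x\<in>D. norm (f x) / N x)"

text \<open>Differentiability with respect to the operator norm of \<open>B(D, K)\<close>, where \<open>D\<close> is normed by
  \<open>N\<close>.\<close>

definition has_operator_derivative_on ::
    "'a::complex_vector set \<Rightarrow> ('a \<Rightarrow> real) \<Rightarrow> (real \<Rightarrow> 'a \<Rightarrow> 'b::complex_normed_vector)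
      \<Rightarrow> ('a \<Rightarrow> 'b) \<Rightarrow> real \<Rightarrow> bool"
  where "has_operator_derivative_on D N T T' t\<^sub>0 \<longleftrightarrow> bounded_on D N T' \<and>
    ((\<lambda>t. onorm_on D N (\<lambda>x. (T t x - T t\<^sub>0 x) /\<^sub>R (t - t\<^sub>0) - T' x)) \<longlongrightarrow> 0) (at t\<^sub>0)"

text \<open>\<open>tr = (\<Gamma>\<^sub>0, \<Gamma>\<^sub>1)\<close>; the last condition is the abstract Green identity.\<close>

definition abstract_trace :: "('h::complex_inner \<times> 'h) set \<Rightarrow> ('h \<Rightarrow> 'k::complex_inner \<times> 'k) \<Rightarrow> bool"
  where "abstract_trace S tr \<longleftrightarrow>
    bounded_on (Domain S) (graph_norm S) tr \<and> tr ` Domain S = UNIV \<and>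
    (\<forall>u\<in>Domain S. \<forall>v\<in>Domain S.
      cinner (op_apply S u) v - cinner u (op_apply S v) =
      cinner (snd (tr u)) (fst (tr v)) - cinner (fst (tr u)) (snd (tr v)))"


section \<open>Symplectic structure and block operators\<close>

definition \<tau> :: "'h \<times> 'h \<Rightarrow> 'h \<times> 'h"
  where "\<tau> = (\<lambda>(u, v). (v, u))"

definition J :: "'k \<times> 'k \<Rightarrow> 'k \<times> 'k::uminus"
  where "J = (\<lambda>(f, g). (g, - f))"

text \<open>\<open>map_prod X Y\<close> is the block diagonal operator \<open>X \<oplus> Y\<close>.\<close>

definition JJ :: "('k \<times> 'k) \<times> ('k \<times> 'k) \<Rightarrow> ('k \<times> 'k) \<times> ('k \<times> 'k::ab_group_add)"
  where "JJ = map_prod J (\<lambda>f. - J f)"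

definition \<omega> :: "'k \<times> 'k \<Rightarrow> 'k \<times> 'k::complex_inner \<Rightarrow> complex"
  where "\<omega> f g = cinner (J f) g"

definition \<Omega> :: "('k \<times> 'k) \<times> ('k \<times> 'k) \<Rightarrow> ('k \<times> 'k) \<times> ('k \<times> 'k::complex_inner) \<Rightarrow> complex"
  where "\<Omega> f g = cinner (JJ f) g"

definition Lagrangian :: "('k \<times> 'k::complex_inner) set \<Rightarrow> bool"
  where "Lagrangian L \<longleftrightarrow> csubspace L \<and> L = {f. \<forall>g\<in>L. \<omega> f g = 0}"

text \<open>The block operators with rows \<open>(0, -B)\<close> and \<open>(A, 0)\<close>, for unbounded \<open>A\<close>, \<open>B\<close> (on
  \<open>dom A \<times> dom B\<close>) and for bounded ones.\<close>

definition antidiag_op ::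
    "('h \<times> 'h) set \<Rightarrow> ('h \<times> 'h) set \<Rightarrow> (('h \<times> 'h) \<times> ('h \<times> 'h::uminus)) set"
  where "antidiag_op A B = {((u, v), (- b, a)) | u v a b. (u, a) \<in> A \<and> (v, b) \<in> B}"

lift_definition antidiag_bounded ::
    "('h \<Rightarrow>\<^sub>L 'h) \<Rightarrow> ('h \<Rightarrow>\<^sub>L 'h) \<Rightarrow> ('h \<times> 'h) \<Rightarrow>\<^sub>L ('h \<times> 'h::real_normed_vector)"
  is "\<lambda>F G p. (- G (snd p), F (fst p))"
  by (intro bounded_linear_Pair bounded_linear_minus bounded_linear_compose[OF _ bounded_linear_fst]
      bounded_linear_compose[OF _ bounded_linear_snd])

text \<open>The operator \<open>T\<^sup>(\<^sup>1\<^sup>)\<close>: \<open>P\<^sub>0\<close> is the Riesz projection at \<open>t\<^sub>0\<close>, and \<open>V'\<close>, \<open>P'\<close>, \<open>Q'\<close>, \<open>T'\<close>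
  are the derivatives at \<open>t\<^sub>0\<close>, while \<open>T\<close> is the trace \<open>T\<^bsub>t\<^sub>0\<^esub>\<close> itself.\<close>

definition first_order_operator ::
    "(('h \<times> 'h) \<Rightarrow>\<^sub>L ('h \<times> 'h::complex_inner)) \<Rightarrow> (('h \<times> 'h) \<Rightarrow>\<^sub>L ('h \<times> 'h))
      \<Rightarrow> (('k \<times> 'k) \<Rightarrow>\<^sub>L ('k \<times> 'k::complex_inner)) \<Rightarrow> (('k \<times> 'k) \<Rightarrow>\<^sub>L ('k \<times> 'k))
      \<Rightarrow> ('h \<times> 'h \<Rightarrow> ('k \<times> 'k) \<times> ('k \<times> 'k)) \<Rightarrow> ('h \<times> 'h \<Rightarrow> ('k \<times> 'k) \<times> ('k \<times> 'k))
      \<Rightarrow> 'h \<times> 'h \<Rightarrow> 'h \<times> 'h"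
  where "first_order_operator P\<^sub>0 V' P' Q' T T' x =
      P\<^sub>0 (V' (P\<^sub>0 x))
      - \<tau> (hilbert_adjoint (\<lambda>y. T (P\<^sub>0 y))
            (map_prod (\<lambda>f. P' (J f)) (\<lambda>f. - Q' (J f)) (T (P\<^sub>0 x))))
      - \<tau> (hilbert_adjoint (\<lambda>y. T (P\<^sub>0 y)) (JJ (T' (P\<^sub>0 x))))"

end

theory Submission
  imports Defs "HOL-Complex_Analysis.Complex_Residues"
begin

text \<open>
  Write \<open>T\<close> for the doubled trace and \<open>N p = (- A\<^sup>* p\<^sub>2, A\<^sup>* p\<^sub>1)\<close> for the maximal block operator
  (\<open>max_op\<close> below). Green's identity says that \<open>N\<close> is symmetric for the indefinite form
  \<open>\<langle>p, \<tau> q\<rangle>\<close> up to a boundary term: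
  \<open>\<langle>N p, \<tau> q\<rangle> - \<langle>p, \<tau> (N q)\<rangle> = \<Omega> (T p) (T q)\<close>. The term vanishes if both traces lie in the range of the
  same pair of Lagrangian projections, and if they belong to two nearby parameters it is a sum of
  differences of \<open>T\<close>, \<open>P\<close> and \<open>Q\<close>. This identity yields the continuity of the resolvents, the
  derivative of the eigenvalue, and the nonvanishing of the denominator.

  First, it gives the norm continuity of the resolvents \<open>K t\<close> of \<open>L t\<close> at a fixed point
  \<open>z0\<close> (\<open>resolvent_stability\<close>, \<open>resolvent_continuous\<close>), although the domains move with \<open>t\<close>. Pair
  \<open>(K t - K t0) x\<close> with a vector \<open>y\<close>. The adjoint of \<open>L t\<close> is \<open>\<tau> (L t) \<tau>\<close>, so the adjoint
  resolvent moves \<open>y\<close> to \<open>\<tau>\<close> of an element of the domain of \<open>L t\<close>, and only differences of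
  coefficients survive. The size of \<open>K t\<close> enters the bound multiplied by such a difference and is
  absorbed in the left-hand side.

  Second comes a purely functional-analytic step (\<open>simple_eigenvalue_perturbation\<close>). A point \<open>z\<close> lies
  in the spectrum iff \<open>1 - (z - z0) K t\<close> is not invertible. At \<open>t0\<close> the Riesz projection is
  \<open>x \<mapsto> \<phi>(x) u\<close>; subtracting \<open>\<mu>\<close> times it from \<open>K t0\<close>, where \<open>\<mu> = 1 / (\<lambda> - z0)\<close>, makes the pencil
  invertible on the whole disc, including \<open>\<lambda>\<close> (\<open>simple_eigenvalue_deflation\<close>). Invertibility
  survives a small change of \<open>K\<close>, and the spectrum in the disc becomes the zero set of one scalar
  holomorphic function, the perturbation determinant \<open>1 - (z - z0) \<mu> \<phi>(E z u)\<close> with the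
  deflated inverse \<open>E\<close>. At \<open>t0\<close> it equals \<open>\<mu> (\<lambda> - z)\<close>, so nearby it has exactly one zero, which is
  simple, and the residue of the resolvent there has rank one. This yields \<open>\<lambda>(t)\<close> together with
  eigenvectors \<open>e t\<close> that converge to \<open>u\<close>.

  Third, the derivative (\<open>eigenvalue_derivative\<close>). The eigenvalue equation makes
  \<open>N (e t)\<close> converge as well, so \<open>e t\<close> converges in the graph norm and its traces converge. Green's
  identity for \<open>e t\<close> and \<open>u\<close> reads
  \<open>(\<lambda>(t) - \<lambda>) \<langle>e t, \<tau> u\<rangle> = \<Omega> (T\<^sub>t (e t)) (T\<^sub>t u) + \<langle>(V\<^sub>t - V\<^bsub>t0\<^esub>) (e t), \<tau> u\<rangle>\<close>, and dividing by
  \<open>t - t0\<close> gives the quotient in the theorem without differentiating eigenvectors or resolvents.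

  For real \<open>\<lambda>\<close> the same symmetry shows that \<open>\<tau> u\<close> annihilates the range of \<open>L t0 - \<lambda>\<close>, which is
  \<open>ker \<phi>\<close>. Hence \<open>\<langle>u, \<tau> u\<rangle> \<noteq> 0\<close> (\<open>eigenvector_nondegenerate\<close>), the Riesz projection is the
  \<open>\<tau>\<close>-orthogonal projection onto \<open>u\<close>, and the first-order operator acts on \<open>u\<close> as a scalar that can be
  written down. It is the above derivative because \<open>P' J = - J P'\<close> (and likewise for \<open>Q'\<close>) and
  \<open>\<Omega> (T' u) (T u) = - \<Omega> (T u) (T' u)\<close>. The contour is a genuine circle because
  \<open>- \<lambda>\<close> is a second point of the spectrum (\<open>opposite_eigenvalue\<close>).
\<close>

section \<open>Complex Hilbert spaces\<close>

lemma cinner_add_right: "cinner x (y + z) = cinner x y + cinner x z"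
  for x y z :: "'a::complex_inner"
  using cinner_commute[of x "y + z"] cinner_commute[of x y] cinner_commute[of x z]
  by (simp add: cinner_add_left)

lemma cinner_zero_left [simp]: "cinner 0 y = 0" for y :: "'a::complex_inner"
  using cinner_add_left[of 0 0 y] by simp

lemma cinner_zero_right [simp]: "cinner y 0 = 0" for y :: "'a::complex_inner"
  using cinner_add_right[of y 0 0] by simp

lemma cinner_minus_left: "cinner (- x) y = - cinner x y" for x y :: "'a::complex_inner"
  using cinner_add_left[of x "- x" y] by (simp add: eq_neg_iff_add_eq_0 add.commute)

lemma cinner_minus_right: "cinner x (- y) = - cinner x y" for x y :: "'a::complex_inner"
  using cinner_add_right[of x y "- y"] by (simp add: eq_neg_iff_add_eq_0 add.commute)

lemma cinner_diff_left: "cinner (x - y) z = cinner x z - cinner y z"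
  for x y z :: "'a::complex_inner"
  using cinner_add_left[of x "- y" z] by (simp add: cinner_minus_left)

lemma cinner_diff_right: "cinner x (y - z) = cinner x y - cinner x z"
  for x y z :: "'a::complex_inner"
  using cinner_add_right[of x y "- z"] by (simp add: cinner_minus_right)

lemma scaleC_zero_left [simp]: "0 *\<^sub>C x = 0" for x :: "'a::complex_vector"
  by (rule complex_vector.scale_zero_left)

lemma scaleC_zero_right [simp]: "c *\<^sub>C (0::'a::complex_vector) = 0"
  by (rule complex_vector.scale_zero_right)

lemma scaleC_one [simp]: "1 *\<^sub>C x = x" for x :: "'a::complex_vector"
  by (rule complex_vector.scale_one)

lemma scaleC_diff_right: "c *\<^sub>C (x - y) = c *\<^sub>C x - c *\<^sub>C y" for x y :: "'a::complex_vector"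
  by (rule complex_vector.scale_right_diff_distrib)

lemma scaleC_diff_left: "(c - d) *\<^sub>C x = c *\<^sub>C x - d *\<^sub>C x" for x :: "'a::complex_vector"
  by (rule complex_vector.scale_left_diff_distrib)

lemma scaleC_minus_right: "c *\<^sub>C (- x) = - (c *\<^sub>C x)" for x :: "'a::complex_vector"
  by (rule complex_vector.scale_minus_right)

lemma scaleC_minus_left: "(- c) *\<^sub>C x = - (c *\<^sub>C x)" for x :: "'a::complex_vector"
  by (rule complex_vector.scale_minus_left)

lemma scaleC_scaleR: "c *\<^sub>C (r *\<^sub>R x) = r *\<^sub>R (c *\<^sub>C x)" for x :: "'a::complex_vector"
  by (simp add: scaleC_of_real[symmetric] scaleC_scaleC mult.commute)

lemma cinner_scaleR: "cinner (r *\<^sub>R x) y = of_real r * cinner x y" "cinner x (r *\<^sub>R y) = of_real r * cinner x y"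
  for x :: "'a::complex_inner"
  by (simp_all add: cinner_scaleC_left cinner_scaleC_right flip: scaleC_of_real)

lemmas cinner_simps = cinner_add_left cinner_add_right cinner_diff_left cinner_diff_right
  cinner_minus_left cinner_minus_right cinner_scaleC_left cinner_scaleC_right

lemma cinner_self_zero [simp]: "cinner x x = 0 \<longleftrightarrow> x = 0" for x :: "'a::complex_inner"
  by (simp add: cinner_norm)

lemma cinner_ext:
  fixes x x' :: "'a::complex_inner"
  assumes "\<And>y. cinner x y = cinner x' y"
  shows "x = x'"
proof -
  have "cinner (x - x') (x - x') = 0"
    by (simp add: cinner_diff_left assms del: cinner_self_zero)
  then show ?thesis by simp
qed

lemma norm_sum_square: "(norm (x + y))\<^sup>2 = (norm x)\<^sup>2 + (norm y)\<^sup>2 + 2 * Re (cinner x y)"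
  for x :: "'a::complex_inner"
proof -
  have "complex_of_real ((norm (x + y))\<^sup>2) = cinner (x + y) (x + y)"
    by (simp add: cinner_norm)
  also have "\<dots> = complex_of_real ((norm x)\<^sup>2) + complex_of_real ((norm y)\<^sup>2)
      + (cinner x y + cnj (cinner x y))"
    by (simp add: cinner_add_left cinner_add_right cinner_commute[of y x] flip: cinner_norm
        del: of_real_power)
  also have "\<dots> = complex_of_real ((norm x)\<^sup>2 + (norm y)\<^sup>2 + 2 * Re (cinner x y))"
    by (simp add: complex_add_cnj)
  finally show ?thesis
    using of_real_eq_iff by blast
qed

lemma complex_Cauchy_Schwarz: "cmod (cinner x y) \<le> norm x * norm y" for x :: "'a::complex_inner"
proof (cases "y = 0")
  case False
  define c where "c = cinner x y / of_real ((norm y)\<^sup>2)"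
  have n: "(norm y)\<^sup>2 > 0"
    using False by simp
  have "0 \<le> (norm (x + (- c) *\<^sub>C y))\<^sup>2"
    by simp
  also have "\<dots> = (norm x)\<^sup>2 + (cmod c)\<^sup>2 * (norm y)\<^sup>2 - 2 * Re (cnj c * cinner x y)"
    unfolding norm_sum_square
      by (simp add: norm_scaleC cinner_scaleC_right cinner_minus_right scaleC_minus_left power_mult_distrib)
  also have "cnj c * cinner x y = of_real ((cmod (cinner x y))\<^sup>2 / (norm y)\<^sup>2)"
    by (simp add: c_def mult.commute complex_norm_square del: of_real_power)
  also have "(cmod c)\<^sup>2 * (norm y)\<^sup>2 = (cmod (cinner x y))\<^sup>2 / (norm y)\<^sup>2"
    using n by (simp add: c_def norm_divide norm_mult power2_eq_square)
  finally have "(cmod (cinner x y))\<^sup>2 / (norm y)\<^sup>2 \<le> (norm x)\<^sup>2"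
    by simp
  then have "(cmod (cinner x y))\<^sup>2 \<le> (norm x * norm y)\<^sup>2"
    using n by (simp add: field_simps power_mult_distrib)
  then show ?thesis
    by (rule power2_le_imp_le) simp
qed simp

lemma cinner_bounded_bilinear: "bounded_bilinear (cinner :: 'a::complex_inner \<Rightarrow> 'a \<Rightarrow> complex)"
proof
  show "\<exists>K. \<forall>a b. norm (cinner a b) \<le> norm (a::'a) * norm b * K"
    by (intro exI[of _ 1]) (simp add: complex_Cauchy_Schwarz)
qed (simp_all add: cinner_simps cinner_scaleC_left cinner_scaleC_right scaleR_conv_of_real
    flip: scaleC_of_real)

lemmas bounded_linear_cinner_left = bounded_bilinear.bounded_linear_left[OF cinner_bounded_bilinear]
lemmas tendsto_cinner [tendsto_intros] = bounded_bilinear.tendsto[OF cinner_bounded_bilinear]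

lemma scaleC_bounded_bilinear:
  "bounded_bilinear (scaleC :: complex \<Rightarrow> 'a::complex_normed_vector \<Rightarrow> 'a)"
proof
  show "\<exists>K. \<forall>a b. norm (a *\<^sub>C b) \<le> norm a * norm (b::'a) * K"
    by (intro exI[of _ 1]) (simp add: norm_scaleC)
  show "(r *\<^sub>R a) *\<^sub>C b = r *\<^sub>R a *\<^sub>C b" for r a and b :: 'a
    by (simp only: scaleR_conv_of_real scaleC_of_real flip: scaleC_scaleC)
qed (simp_all add: scaleC_add_left scaleC_add_right scaleC_scaleR)

lemmas tendsto_scaleC [tendsto_intros] = bounded_bilinear.tendsto[OF scaleC_bounded_bilinear]
lemmas bounded_linear_scaleC_left = bounded_bilinear.bounded_linear_left[OF scaleC_bounded_bilinear]

lemma cbounded_iff: "cbounded T \<longleftrightarrow> (\<forall>c x. T (c *\<^sub>C x) = c *\<^sub>C T x)"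
  for T :: "'a::complex_normed_vector \<Rightarrow>\<^sub>L 'b::complex_normed_vector"
proof
  assume "cbounded T"
  then interpret Vector_Spaces.linear scaleC scaleC "blinfun_apply T"
    by (simp add: cbounded_def)
  show "\<forall>c x. T (c *\<^sub>C x) = c *\<^sub>C T x"
    by (simp add: scale)
next
  assume T: "\<forall>c x. T (c *\<^sub>C x) = c *\<^sub>C T x"
  show "cbounded T"
    unfolding cbounded_def by unfold_locales (simp_all add: blinfun.add_right T)
qed

definition cfunctional :: "('a::complex_normed_vector \<Rightarrow> complex) \<Rightarrow> bool"
  where "cfunctional f \<longleftrightarrow> bounded_linear f \<and> (\<forall>c x. f (c *\<^sub>C x) = c * f x)"

lemma cfunctional_simps:
  assumes "cfunctional f"
  shows "f (x + y) = f x + f y" "f (x - y) = f x - f y" "f (c *\<^sub>C x) = c * f x" "f 0 = 0"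
proof -
  interpret f: bounded_linear f
    using assms by (simp add: cfunctional_def)
  show "f (x + y) = f x + f y" "f (x - y) = f x - f y" "f 0 = 0"
    by (rule f.add f.diff f.zero)+
  show "f (c *\<^sub>C x) = c * f x"
    using assms unfolding cfunctional_def by blast
qed

lemma parallelogram: "(norm (x + y))\<^sup>2 + (norm (x - y))\<^sup>2 = 2 * (norm x)\<^sup>2 + 2 * (norm y)\<^sup>2"
  for x :: "'a::complex_inner"
  using norm_sum_square[of x y] norm_sum_square[of x "- y"] by (simp add: cinner_simps)

text \<open>The representing vector is a multiple of the point \<open>w\<close> of least norm in the hyperplane \<open>f = 1\<close>. A
minimising sequence is Cauchy by the parallelogram law, and minimality makes \<open>w\<close> orthogonal to
\<open>ker f\<close>.\<close>

lemma Riesz_representation: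
  fixes f :: "'a::chilbert_space \<Rightarrow> complex"
  assumes "cfunctional f"
  shows "\<exists>w. \<forall>x. f x = cinner x w"
proof (cases "\<forall>x. f x = 0")
  case True
  then show ?thesis by (intro exI[of _ 0]) simp
next
  case False
  interpret f: bounded_linear f
    using assms by (simp add: cfunctional_def)
  have fs: "f (c *\<^sub>C x) = c * f x" for c x
    using assms by (simp add: cfunctional_def)
  define C where "C = {x. f x = 1}"
  define d where "d = Inf (norm ` C)"
  obtain x0 where "f x0 \<noteq> 0"
    using False by blast
  then have "(1 / f x0) *\<^sub>C x0 \<in> C"
    by (simp add: C_def fs)
  then have ne: "C \<noteq> {}" by blast
  have bdd: "bdd_below (norm ` C)"
    by (rule bdd_belowI2[of _ 0]) simp
  have d_le: "d \<le> norm x" if "x \<in> C" for x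
    unfolding d_def using that bdd by (simp add: cInf_lower)
  have d0: "0 \<le> d"
    unfolding d_def using ne by (intro cInf_greatest) auto
  have "\<exists>x\<in>C. norm x < d + 1 / real (Suc n)" for n
    using cInf_lessD[of "norm ` C" "d + 1 / real (Suc n)"] ne by (auto simp: d_def)
  then obtain X where X: "\<And>n. X n \<in> C" "\<And>n. norm (X n) < d + 1 / real (Suc n)"
    by metis
  have diff: "(norm (X m - X n))\<^sup>2 \<le> 2 * (d + 1 / Suc N)\<^sup>2 + 2 * (d + 1 / Suc N)\<^sup>2 - 4 * d\<^sup>2"
    if "N \<le> m" "N \<le> n" for m n N
  proof -
    have "(1/2) *\<^sub>R (X m + X n) \<in> C"
      using X(1)[of m] X(1)[of n] by (simp add: C_def f.scaleR f.add scaleR_conv_of_real)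
    then have "d \<le> norm ((1/2) *\<^sub>R (X m + X n))"
      by (rule d_le)
    then have "2 * d \<le> norm (X m + X n)"
      by simp
    then have m: "4 * d\<^sup>2 \<le> (norm (X m + X n))\<^sup>2"
      using power_mono[of "2 * d" _ 2] d0 by (simp add: power_mult_distrib)
    have "(norm (X k))\<^sup>2 \<le> (d + 1 / Suc N)\<^sup>2" if "N \<le> k" for k
    proof (rule power_mono)
      have "1 / real (Suc k) \<le> 1 / real (Suc N)"
        using that by (simp add: field_simps)
      with X(2)[of k] show "norm (X k) \<le> d + 1 / Suc N"
        by linarith
    qed simp
    from this[OF that(1)] this[OF that(2)] show ?thesis
      using parallelogram[of "X m" "X n"] m by linarith
  qed
  have lim0: "(\<lambda>N. 2 * (d + 1 / real (Suc N))\<^sup>2 + 2 * (d + 1 / real (Suc N))\<^sup>2 - 4 * d\<^sup>2) \<longlonglongrightarrow> 0"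
  proof -
    have "(\<lambda>N. 2 * (d + 1 / real (Suc N))\<^sup>2 + 2 * (d + 1 / real (Suc N))\<^sup>2 - 4 * d\<^sup>2)
        \<longlonglongrightarrow> 2 * (d + 0)\<^sup>2 + 2 * (d + 0)\<^sup>2 - 4 * d\<^sup>2"
      by (intro tendsto_intros LIMSEQ_Suc[OF lim_inverse_n'])
    then show ?thesis by simp
  qed
  have "Cauchy X"
  proof (rule metric_CauchyI)
    fix e :: real
    assume "0 < e"
    then have "\<forall>\<^sub>F N in sequentially.
        2 * (d + 1 / real (Suc N))\<^sup>2 + 2 * (d + 1 / real (Suc N))\<^sup>2 - 4 * d\<^sup>2 < e\<^sup>2"
      by (intro order_tendstoD(2)[OF lim0]) simp
    then obtain N where N: "2 * (d + 1 / real (Suc N))\<^sup>2 + 2 * (d + 1 / real (Suc N))\<^sup>2 - 4 * d\<^sup>2 < e\<^sup>2"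
      by (auto simp: eventually_sequentially)
    have "dist (X m) (X n) < e" if "m \<ge> N" "n \<ge> N" for m n
      using diff[OF that] N \<open>0 < e\<close> by (simp add: dist_norm power2_less_imp_less)
    then show "\<exists>M. \<forall>m\<ge>M. \<forall>n\<ge>M. dist (X m) (X n) < e"
      by blast
  qed
  then obtain w where w: "X \<longlonglongrightarrow> w"
    using Cauchy_convergent convergent_def by blast
  have "(\<lambda>n. f (X n)) \<longlonglongrightarrow> f w"
    by (rule f.tendsto[OF w])
  then have fw: "f w = 1"
    using X(1) by (simp add: C_def LIMSEQ_const_iff)
  have "norm w \<le> d + 0"
  proof (rule LIMSEQ_le[OF tendsto_norm[OF w]])
    show "(\<lambda>n. d + 1 / real (Suc n)) \<longlonglongrightarrow> d + 0"
      by (intro tendsto_intros LIMSEQ_Suc[OF lim_inverse_n'])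
  qed (use X(2) less_imp_le in blast)
  then have nw: "norm w \<le> norm x" if "x \<in> C" for x
    using d_le[OF that] by simp
  have orth: "cinner h w = 0" if h: "f h = 0" for h
  proof (cases "h = 0")
    case False
    define c where "c = cinner w h / of_real ((norm h)\<^sup>2)"
    have n: "(norm h)\<^sup>2 > 0"
      using False by simp
    have "w + (- c) *\<^sub>C h \<in> C"
      by (simp add: C_def f.add fs h fw f.diff)
    then have "(norm w)\<^sup>2 \<le> (norm (w + (- c) *\<^sub>C h))\<^sup>2"
      by (intro power_mono nw) simp_all
    also have "\<dots> = (norm w)\<^sup>2 + (cmod c)\<^sup>2 * (norm h)\<^sup>2 - 2 * Re (cnj c * cinner w h)"
      unfolding norm_sum_square
      by (simp add: norm_scaleC cinner_scaleC_right cinner_minus_right scaleC_minus_left power_mult_distrib)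
    also have "cnj c * cinner w h = of_real ((cmod (cinner w h))\<^sup>2 / (norm h)\<^sup>2)"
      by (simp add: c_def mult.commute complex_norm_square del: of_real_power)
    also have "(cmod c)\<^sup>2 * (norm h)\<^sup>2 = (cmod (cinner w h))\<^sup>2 / (norm h)\<^sup>2"
      using n by (simp add: c_def norm_divide norm_mult power2_eq_square)
    finally have "(cmod (cinner w h))\<^sup>2 / (norm h)\<^sup>2 \<le> 0"
      by simp
    then have "cinner w h = 0"
      using n by (simp add: divide_le_0_iff)
    then show ?thesis
      using cinner_commute[of h w] by simp
  qed simp
  have "w \<noteq> 0"
    using fw f.zero by auto
  then have nz: "cinner w w \<noteq> 0" by simp
  have "f x = cinner x ((1 / cinner w w) *\<^sub>C w)" for x
  proof -
    have "cinner (x - f x *\<^sub>C w) w = 0"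
      by (rule orth) (simp add: f.diff fs fw)
    then have "cinner x w = f x * cinner w w"
      by (simp add: cinner_simps)
    moreover have "cnj (cinner w w) = cinner w w"
      by (rule cinner_commute[symmetric])
    ultimately show ?thesis
      using nz by (simp add: cinner_simps)
  qed
  then show ?thesis by blast
qed

text \<open>The value at \<open>y\<close> of the adjoint of \<open>K\<close>, with the norm bound that the resolvent estimate needs.\<close>

lemma adjoint_vector:
  fixes K :: "'a::chilbert_space \<Rightarrow>\<^sub>L 'b::chilbert_space"
  assumes "cbounded K"
  obtains w where "\<And>x. cinner (K x) y = cinner x w" and "norm w \<le> norm K * norm y"
proof -
  have "cfunctional (\<lambda>x. cinner (K x) y)"
    unfolding cfunctional_def using assms
    by (auto simp: cbounded_iff cinner_scaleC_left
        intro!: bounded_linear_compose[OF bounded_linear_cinner_left] blinfun.bounded_linear_right)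
  then obtain w where w: "\<And>x. cinner (K x) y = cinner x w"
    using Riesz_representation by blast
  have "(norm w)\<^sup>2 = cmod (cinner (K w) y)"
    by (simp add: w cinner_norm norm_power)
  also have "\<dots> \<le> norm (K w) * norm y"
    by (rule complex_Cauchy_Schwarz)
  also have "\<dots> \<le> norm K * norm w * norm y"
    by (intro mult_right_mono norm_blinfun) simp
  finally have "norm w * norm w \<le> norm w * (norm K * norm y)"
    by (simp add: power2_eq_square mult_ac)
  then have "norm w \<le> norm K * norm y"
    by (cases "w = 0") (auto simp: mult_le_cancel_left)
  with w that show thesis by blast
qed

section \<open>Inverses of operator pencils\<close>

definition mutually_inverse :: "('a::real_normed_vector \<Rightarrow>\<^sub>L 'a) \<Rightarrow> ('a \<Rightarrow>\<^sub>L 'a) \<Rightarrow> bool"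
  where "mutually_inverse M E \<longleftrightarrow> (\<forall>x. M (E x) = x) \<and> (\<forall>x. E (M x) = x)"

lemma mutually_inverse_unique:
  assumes "mutually_inverse M E" "mutually_inverse M E'"
  shows "E = E'"
  by (rule blinfun_eqI) (metis assms mutually_inverse_def)

lemma cbounded_inverse:
  assumes "mutually_inverse M E" "cbounded M"
  shows "cbounded E"
  using assms unfolding mutually_inverse_def cbounded_iff by metis

text \<open>\<open>M x = y\<close> is the fixed point equation \<open>x = E0 (y - (M - M0) x)\<close> of a contraction with constant
\<open>1/2\<close>.\<close>

lemma Neumann_perturbation:
  fixes M M0 E0 :: "'a::banach \<Rightarrow>\<^sub>L 'a"
  assumes inv: "mutually_inverse M0 E0" and small: "norm (M - M0) * norm E0 \<le> 1/2"
  obtains E where "mutually_inverse M E" and "norm (E - E0) \<le> 2 * (norm E0)\<^sup>2 * norm (M - M0)"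
proof -
  have E0: "E0 (M0 x) = x" "M0 (E0 x) = x" for x
    using inv by (auto simp: mutually_inverse_def)
  have contr: "norm (E0 ((M - M0) x)) \<le> 1/2 * norm x" for x
  proof -
    have "norm (E0 ((M - M0) x)) \<le> norm E0 * (norm (M - M0) * norm x)"
      by (rule order_trans[OF norm_blinfun]) (simp add: mult_left_mono norm_blinfun)
    also have "\<dots> \<le> 1/2 * norm x"
      using mult_right_mono[OF small, of "norm x"] by (simp add: mult_ac)
    finally show ?thesis .
  qed
  have fixp: "M x = y \<longleftrightarrow> E0 (y - (M - M0) x) = x" for x y
  proof -
    have "E0 (y - (M - M0) x) = x \<longleftrightarrow> y - (M - M0) x = M0 x"
      using E0 by metis
    then show ?thesis by (auto simp: blinfun.diff_left)
  qed
  have ex1: "\<exists>!x. E0 (y - (M - M0) x) = x" for y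
  proof (rule banach_fix_type[of "1/2"])
    show "\<forall>x x'. dist (E0 (y - (M - M0) x)) (E0 (y - (M - M0) x')) \<le> 1/2 * dist x x'"
    proof (intro allI)
      fix x x'
      have "E0 (y - (M - M0) x) - E0 (y - (M - M0) x') = E0 ((M - M0) (x' - x))"
        by (simp add: blinfun.diff_right flip: blinfun.diff_left)
      then show "dist (E0 (y - (M - M0) x)) (E0 (y - (M - M0) x')) \<le> 1/2 * dist x x'"
        using contr[of "x' - x"] by (simp add: dist_norm norm_minus_commute)
    qed
  qed simp_all
  define e where "e y = (THE x. M x = y)" for y
  have e: "M x = y \<longleftrightarrow> x = e y" for x y
  proof -
    have "\<exists>!x. M x = y"
      using ex1[of y] by (simp only: fixp)
    then show ?thesis
      unfolding e_def using theI'[of "\<lambda>x. M x = y"] by blast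
  qed
  have bnd: "norm (e y) \<le> norm y * (2 * norm E0)" for y
  proof -
    have "e y = E0 y - E0 ((M - M0) (e y))"
      using e[of "e y" y] fixp[of "e y" y] by (simp add: blinfun.diff_right)
    then have "norm (e y) \<le> norm (E0 y) + norm (E0 ((M - M0) (e y)))"
      by (metis norm_triangle_ineq4)
    also have "\<dots> \<le> norm E0 * norm y + 1/2 * norm (e y)"
      by (intro add_mono norm_blinfun contr)
    finally show ?thesis by (simp add: mult_ac)
  qed
  have bl: "bounded_linear e"
  proof (rule bounded_linear_intro[OF _ _ bnd])
    show "e (x + y) = e x + e y" for x y
      using e[of "e x + e y" "x + y"] e[of "e x" x] e[of "e y" y] by (simp add: blinfun.add_right)
    show "e (r *\<^sub>R x) = r *\<^sub>R e x" for r x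
      using e[of "r *\<^sub>R e x" "r *\<^sub>R x"] e[of "e x" x] by (simp add: blinfun.scaleR_right)
  qed
  define E where "E = Blinfun e"
  have E: "blinfun_apply E = e"
    unfolding E_def by (rule bounded_linear_Blinfun_apply[OF bl])
  have mi: "mutually_inverse M E"
    unfolding mutually_inverse_def E
  proof (intro conjI allI)
    show "M (e x) = x" for x
      using e[of "e x" x] by simp
    show "e (M x) = x" for x
      using e[of x "M x"] by simp
  qed
  have "norm (E - E0) \<le> 2 * (norm E0)\<^sup>2 * norm (M - M0)"
  proof (rule norm_blinfun_bound)
    fix y
    have "(E - E0) y = - E0 ((M - M0) (e y))"
      using e[of "e y" y] fixp[of "e y" y] by (simp add: blinfun.diff_left blinfun.diff_right E)
    then have "norm ((E - E0) y) \<le> norm E0 * norm ((M - M0) (e y))"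
      using norm_blinfun[of E0] by simp
    also have "\<dots> \<le> norm E0 * (norm (M - M0) * norm (e y))"
      by (intro mult_left_mono norm_blinfun) simp
    also have "\<dots> \<le> norm E0 * (norm (M - M0) * (norm y * (2 * norm E0)))"
      by (intro mult_left_mono bnd) simp_all
    finally show "norm ((E - E0) y) \<le> 2 * (norm E0)\<^sup>2 * norm (M - M0) * norm y"
      by (simp add: power2_eq_square mult_ac)
  qed simp
  with mi show thesis by (rule that)
qed

lemmas scaleC_blinfun_apply [simp] = scaleC_blinfun.rep_eq

lemma norm_scaleC_blinfun_le: "norm (c *\<^sub>C T) \<le> cmod c * norm T"
  for T :: "'a::real_normed_vector \<Rightarrow>\<^sub>L 'b::complex_normed_vector"
proof (rule norm_blinfun_bound)
  show "norm ((c *\<^sub>C T) x) \<le> cmod c * norm T * norm x" for x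
    using mult_left_mono[OF norm_blinfun[of T x], of "cmod c"] by (simp add: norm_scaleC mult_ac)
qed simp

lemma scaleC_blinfun_bounded_bilinear:
  "bounded_bilinear (scaleC :: complex \<Rightarrow> ('a::real_normed_vector \<Rightarrow>\<^sub>L 'b::complex_normed_vector) \<Rightarrow> _)"
proof
  show "\<exists>K. \<forall>a b. norm (a *\<^sub>C b) \<le> norm a * norm (b :: 'a \<Rightarrow>\<^sub>L 'b) * K"
    by (intro exI[of _ 1]) (simp add: norm_scaleC_blinfun_le)
  show "(r *\<^sub>R a) *\<^sub>C b = r *\<^sub>R a *\<^sub>C b" for r a and b :: "'a \<Rightarrow>\<^sub>L 'b"
    by (simp only: scaleR_conv_of_real scaleC_of_real flip: scaleC_scaleC)
qed (simp_all add: scaleC_add_left scaleC_add_right scaleC_scaleR)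

lemma cfunctional_cinner: "cfunctional (\<lambda>x. cinner (x :: 'a::complex_inner) y)"
  by (simp add: cfunctional_def bounded_linear_cinner_left cinner_scaleC_left)

lemma cfunctional_compose:
  assumes "cfunctional f" "cbounded B"
  shows "cfunctional (\<lambda>x. f (B x))"
  using assms unfolding cfunctional_def cbounded_iff
  by (auto intro: bounded_linear_compose blinfun.bounded_linear_right)

text \<open>If \<open>K\<close> is the resolvent of \<open>L\<close> at \<open>z0\<close>, then \<open>L - z = (L - z0) (1 - (z - z0) K)\<close>. The pencil thus
replaces the unbounded \<open>L - z\<close> by a bounded operator that is affine in \<open>z\<close>.\<close>

definition pencil :: "complex \<Rightarrow> ('a::complex_normed_vector \<Rightarrow>\<^sub>L 'a) \<Rightarrow> complex \<Rightarrow> ('a \<Rightarrow>\<^sub>L 'a)"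
  where "pencil z0 K z = id_blinfun - (z - z0) *\<^sub>C K"

lemma pencil_apply: "pencil z0 K z x = x - (z - z0) *\<^sub>C K x"
  by (simp add: pencil_def blinfun.diff_left)

lemma cbounded_pencil: "cbounded K \<Longrightarrow> cbounded (pencil z0 K z)"
  by (simp add: cbounded_iff pencil_apply scaleC_diff_right scaleC_scaleC mult.commute)

locale inverse_family =
  fixes z0 :: complex and K :: "'a::chilbert_space \<Rightarrow>\<^sub>L 'a" and W :: "complex set"
    and E :: "complex \<Rightarrow> 'a \<Rightarrow>\<^sub>L 'a"
  assumes K: "cbounded K"
    and E: "\<And>z. z \<in> W \<Longrightarrow> mutually_inverse (pencil z0 K z) (E z)"
begin

lemma cbounded_E: "z \<in> W \<Longrightarrow> cbounded (E z)"
  by (rule cbounded_inverse[OF E cbounded_pencil[OF K]])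

lemma E_diff:
  assumes "z \<in> W" "z' \<in> W"
  shows "E z' x - E z x = (z' - z) *\<^sub>C E z' (K (E z x))"
proof -
  have "E z' (pencil z0 K z (E z x) - pencil z0 K z' (E z x)) = (z' - z) *\<^sub>C E z' (K (E z x))"
    using cbounded_E[OF assms(2)]
    by (simp add: pencil_apply cbounded_iff flip: scaleC_diff_left)
  then show ?thesis
    using E[OF assms(1)] E[OF assms(2)] by (simp add: mutually_inverse_def blinfun.diff_right)
qed

lemma continuous_E: "continuous_on W E"
  unfolding continuous_on_def
proof
  fix z assume z: "z \<in> W"
  define C where "C = 2 * (norm (E z))\<^sup>2 * norm K"
  have pd: "norm (pencil z0 K z' - pencil z0 K z) \<le> cmod (z' - z) * norm K" for z'
  proof -
    have "pencil z0 K z' - pencil z0 K z = (z - z') *\<^sub>C K"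
      by (simp add: pencil_def scaleC_diff_left)
    then show ?thesis
      using norm_scaleC_blinfun_le[of "z - z'" K] by (simp add: norm_minus_commute)
  qed
  have bnd: "norm (E z' - E z) \<le> C * cmod (z' - z)"
    if z': "z' \<in> W" and sm: "cmod (z' - z) * (norm K * norm (E z)) \<le> 1/2" for z'
  proof -
    have "norm (pencil z0 K z' - pencil z0 K z) * norm (E z) \<le> cmod (z' - z) * norm K * norm (E z)"
      by (intro mult_right_mono pd) simp
    also have "\<dots> \<le> 1/2"
      using sm by (simp add: mult_ac)
    finally obtain E' where E': "mutually_inverse (pencil z0 K z') E'"
      "norm (E' - E z) \<le> 2 * (norm (E z))\<^sup>2 * norm (pencil z0 K z' - pencil z0 K z)"
      using Neumann_perturbation[OF E[OF z]] by blast
    have "E' = E z'"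
      by (rule mutually_inverse_unique[OF E'(1) E[OF z']])
    then have "norm (E z' - E z) \<le> 2 * (norm (E z))\<^sup>2 * norm (pencil z0 K z' - pencil z0 K z)"
      using E'(2) by simp
    also have "\<dots> \<le> 2 * (norm (E z))\<^sup>2 * (cmod (z' - z) * norm K)"
      by (intro mult_left_mono pd) simp
    finally show ?thesis
      by (simp add: C_def mult_ac)
  qed
  have "((\<lambda>z'. cmod (z' - z) * (norm K * norm (E z))) \<longlongrightarrow> cmod (z - z) * (norm K * norm (E z))) (at z within W)"
    by (intro tendsto_intros)
  then have "\<forall>\<^sub>F z' in at z within W. cmod (z' - z) * (norm K * norm (E z)) < 1/2"
    by (rule order_tendstoD) simp
  then have ev: "\<forall>\<^sub>F z' in at z within W. norm (E z' - E z) \<le> C * cmod (z' - z)"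
    unfolding eventually_at_filter by (rule eventually_mono) (auto intro!: bnd)
  have "((\<lambda>z'. C * cmod (z' - z)) \<longlongrightarrow> C * cmod (z - z)) (at z within W)"
    by (intro tendsto_intros)
  then have "((\<lambda>z'. E z' - E z) \<longlongrightarrow> 0) (at z within W)"
    by (intro Lim_null_comparison[OF ev]) simp
  then show "(E \<longlongrightarrow> E z) (at z within W)"
    by (simp add: LIM_zero_iff)
qed

lemma has_field_derivative_E:
  assumes f: "cfunctional f" and z: "z \<in> W"
  shows "((\<lambda>z. f (E z x)) has_field_derivative f (E z (K (E z x)))) (at z within W)"
  unfolding has_field_derivative_iff
proof (rule Lim_transform_eventually)
  interpret f: bounded_linear f
    using f by (simp add: cfunctional_def)
  have "(E \<longlongrightarrow> E z) (at z within W)"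
    using continuous_E z by (simp add: continuous_on_def)
  then show "((\<lambda>z'. f (E z' (K (E z x)))) \<longlongrightarrow> f (E z (K (E z x)))) (at z within W)"
    by (intro f.tendsto blinfun.tendsto tendsto_const)
  show "\<forall>\<^sub>F z' in at z within W. f (E z' (K (E z x))) = (f (E z' x) - f (E z x)) / (z' - z)"
    unfolding eventually_at_filter
  proof (rule always_eventually, intro allI impI)
    fix z' assume "z' \<noteq> z" "z' \<in> W"
    then have "f (E z' x) - f (E z x) = (z' - z) * f (E z' (K (E z x)))"
      using E_diff[OF z, of z' x] f by (simp add: cfunctional_def flip: f.diff)
    then show "f (E z' (K (E z x))) = (f (E z' x) - f (E z x)) / (z' - z)"
      using \<open>z' \<noteq> z\<close> by simp
  qed
qed

lemma holomorphic_E: "cfunctional f \<Longrightarrow> (\<lambda>z. f (E z x)) holomorphic_on W"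
  unfolding holomorphic_on_def field_differentiable_def using has_field_derivative_E by blast

end

section \<open>Contour integrals of operators\<close>

text \<open>Bounded functionals commute with the integral, so that identities between operator-valued contour
integrals reduce to scalar ones.\<close>

lemma cfunctional_operator_contour_integral:
  fixes F :: "complex \<Rightarrow> 'a::chilbert_space \<Rightarrow>\<^sub>L 'b::chilbert_space"
  assumes r: "0 \<le> r" and F: "continuous_on (sphere a r) F" and f: "cfunctional f"
  shows "f (operator_contour_integral (circlepath a r) F x)
       = contour_integral (circlepath a r) (\<lambda>z. f (F z x))"
proof -
  let ?g = "circlepath a r"
  define d where "d s = 2 * of_real pi * \<i> * of_real r * exp (2 * of_real pi * \<i> * of_real s)" for s
  have d: "vector_derivative ?g (at s within {0..1}) = d s" if "s \<in> {0..1}" for s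
    using that by (simp add: vector_derivative_circlepath01 d_def)
  have cd: "continuous_on {0..1} d"
    unfolding d_def by (intro continuous_intros)
  have img: "?g ` {0..1} \<subseteq> sphere a r"
    using r path_image_circlepath[of a r] by (simp add: path_image_def)
  have cF: "continuous_on {0..1} (\<lambda>s. F (?g s))"
    using continuous_on_compose2[OF F _ img] path_circlepath[of a r]
    by (simp add: path_def)
  have "continuous_on {0..1} (\<lambda>s. d s *\<^sub>C F (?g s))"
    by (rule bounded_bilinear.continuous_on[OF scaleC_blinfun_bounded_bilinear cd cF])
  then have int: "(\<lambda>s. d s *\<^sub>C F (?g s)) integrable_on {0..1}"
    by (rule integrable_continuous_real)
  have bl: "bounded_linear (\<lambda>T. f (blinfun_apply T x))"
    using f bounded_linear_compose[OF _ blinfun.bounded_linear_left[of x]]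
    by (auto simp: cfunctional_def)
  have "operator_contour_integral ?g F = integral {0..1} (\<lambda>s. d s *\<^sub>C F (?g s))"
    unfolding operator_contour_integral_def by (intro integral_cong) (simp add: d)
  then have "f (operator_contour_integral ?g F x) = integral {0..1} ((\<lambda>T. f (blinfun_apply T x)) \<circ> (\<lambda>s. d s *\<^sub>C F (?g s)))"
    by (simp only: integral_linear[OF int bl])
  also have "\<dots> = contour_integral ?g (\<lambda>z. f (F z x))"
    unfolding contour_integral_integral using f
    by (intro integral_cong) (simp add: cfunctional_def vector_derivative_circlepath d_def)
  finally show ?thesis .
qed

lemma cfunctional_contour_integrable:
  fixes F :: "complex \<Rightarrow> 'a::chilbert_space \<Rightarrow>\<^sub>L 'b::chilbert_space"
  assumes "0 \<le> r" and F: "continuous_on (sphere a r) F" and f: "cfunctional f"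
  shows "(\<lambda>z. f (F z x)) contour_integrable_on circlepath a r"
  using assms
  by (intro contour_integrable_continuous_circlepath)
     (auto simp: cfunctional_def intro!: bounded_linear.continuous_on[of f] continuous_intros
       bounded_linear.continuous_on[OF blinfun.bounded_linear_left])

lemma operator_contour_integral_commute:
  fixes F :: "complex \<Rightarrow> 'a::chilbert_space \<Rightarrow>\<^sub>L 'a"
  assumes r: "0 \<le> r" and F: "continuous_on (sphere a r) F" and B: "cbounded B"
    and comm: "\<And>z x. z \<in> sphere a r \<Longrightarrow> B (F z x) = F z (B x)"
  shows "B (operator_contour_integral (circlepath a r) F x) = operator_contour_integral (circlepath a r) F (B x)"
proof (rule cinner_ext)
  fix y
  have "cinner (B (operator_contour_integral (circlepath a r) F x)) y =
     contour_integral (circlepath a r) (\<lambda>z. cinner (B (F z x)) y)"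
    by (rule cfunctional_operator_contour_integral[OF r F cfunctional_compose[OF cfunctional_cinner B]])
  also have "\<dots> = contour_integral (circlepath a r) (\<lambda>z. cinner (F z (B x)) y)"
    using r by (intro contour_integral_cong) (auto simp: comm)
  also have "\<dots> = cinner (operator_contour_integral (circlepath a r) F (B x)) y"
    by (rule cfunctional_operator_contour_integral[OF r F cfunctional_cinner, symmetric])
  finally show "cinner (B (operator_contour_integral (circlepath a r) F x)) y =
      cinner (operator_contour_integral (circlepath a r) F (B x)) y" .
qed

lemma cbounded_operator_contour_integral:
  fixes F :: "complex \<Rightarrow> 'a::chilbert_space \<Rightarrow>\<^sub>L 'b::chilbert_space"
  assumes r: "0 \<le> r" and F: "continuous_on (sphere a r) F"
    and cb: "\<And>z. z \<in> sphere a r \<Longrightarrow> cbounded (F z)"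
  shows "cbounded (operator_contour_integral (circlepath a r) F)"
  unfolding cbounded_iff
proof (intro allI cinner_ext)
  fix c x y
  have "cinner (operator_contour_integral (circlepath a r) F (c *\<^sub>C x)) y =
     contour_integral (circlepath a r) (\<lambda>z. cinner (F z (c *\<^sub>C x)) y)"
    by (rule cfunctional_operator_contour_integral[OF r F cfunctional_cinner])
  also have "\<dots> = contour_integral (circlepath a r) (\<lambda>z. c * cinner (F z x) y)"
    using r cb by (intro contour_integral_cong) (auto simp: cbounded_iff cinner_scaleC_left)
  also have "\<dots> = c * contour_integral (circlepath a r) (\<lambda>z. cinner (F z x) y)"
    by (rule contour_integral_lmul[OF cfunctional_contour_integrable[OF r F cfunctional_cinner]])
  also have "\<dots> = c * cinner (operator_contour_integral (circlepath a r) F x) y"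
    by (simp only: cfunctional_operator_contour_integral[OF r F cfunctional_cinner])
  finally show "cinner (operator_contour_integral (circlepath a r) F (c *\<^sub>C x)) y
      = cinner (c *\<^sub>C operator_contour_integral (circlepath a r) F x) y"
    by (simp add: cinner_scaleC_left)
qed

section \<open>Resolvents\<close>

text \<open>In this form a resolvent at one point describes the graph of \<open>L\<close> completely.\<close>

lemma is_resolvent_iff:
  "is_resolvent L z R \<longleftrightarrow> cbounded R \<and> (\<forall>x y. (x, y) \<in> L \<longleftrightarrow> x = R (y - z *\<^sub>C x))"
proof -
  have "(op_shift L z)\<inverse> = {(v, R v) | v. True} \<longleftrightarrow> (\<forall>x y. (x, y) \<in> L \<longleftrightarrow> x = R (y - z *\<^sub>C x))"
  proof
    assume eq: "(op_shift L z)\<inverse> = {(v, R v) | v. True}"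
    show "\<forall>x y. (x, y) \<in> L \<longleftrightarrow> x = R (y - z *\<^sub>C x)"
    proof (intro allI)
      fix x y
      have "(x, y) \<in> L \<longleftrightarrow> (y - z *\<^sub>C x, x) \<in> (op_shift L z)\<inverse>"
        by (auto simp: op_shift_def)
      also have "\<dots> \<longleftrightarrow> x = R (y - z *\<^sub>C x)"
        unfolding eq by auto
      finally show "(x, y) \<in> L \<longleftrightarrow> x = R (y - z *\<^sub>C x)" .
    qed
  next
    assume L: "\<forall>x y. (x, y) \<in> L \<longleftrightarrow> x = R (y - z *\<^sub>C x)"
    show "(op_shift L z)\<inverse> = {(v, R v) | v. True}"
    proof (intro equalityI subsetI)
      fix p assume "p \<in> (op_shift L z)\<inverse>"
      then show "p \<in> {(v, R v) | v. True}"
        using L by (auto simp: op_shift_def)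
    next
      fix p assume "p \<in> {(v, R v) | v. True}"
      then obtain v where p: "p = (v, R v)" by blast
      have "(R v, v + z *\<^sub>C R v) \<in> L"
        using L by simp
      then have "(R v, v + z *\<^sub>C R v - z *\<^sub>C R v) \<in> op_shift L z"
        unfolding op_shift_def by blast
      then show "p \<in> (op_shift L z)\<inverse>"
        by (simp add: p)
    qed
  qed
  then show ?thesis by (simp add: is_resolvent_def)
qed

lemma is_resolventD:
  assumes "is_resolvent L z R"
  shows "(x, y) \<in> L \<longleftrightarrow> x = R (y - z *\<^sub>C x)" and "cbounded R" and "(R v, v + z *\<^sub>C R v) \<in> L"
  using assms by (auto simp: is_resolvent_iff)

lemma resolvent_identity:
  assumes "is_resolvent L z R" "is_resolvent L z' R'"
  shows "R v - R' v = (z - z') *\<^sub>C R (R' v)"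
proof -
  define a where "a = R (R' v)"
  have "R' v = R (v + z' *\<^sub>C R' v - z *\<^sub>C R' v)"
    using is_resolventD(1)[OF assms(1)] is_resolventD(3)[OF assms(2)] by blast
  also have "\<dots> = R v + (z' *\<^sub>C a - z *\<^sub>C a)"
    using is_resolventD(2)[OF assms(1)]
    by (simp add: cbounded_iff blinfun.add_right blinfun.diff_right a_def)
  finally have "R' v = R v + (z' *\<^sub>C a - z *\<^sub>C a)" .
  then show ?thesis
    unfolding a_def[symmetric] by (simp add: scaleC_diff_left)
qed

lemma is_resolvent_unique:
  assumes "is_resolvent L z R" "is_resolvent L z R'"
  shows "R = R'"
  using resolvent_identity[OF assms] by (intro blinfun_eqI) simp

lemma resolvent_eq: "is_resolvent L z R \<Longrightarrow> resolvent L z = R"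
  unfolding resolvent_def by (rule the_equality) (auto intro: is_resolvent_unique)

lemma is_resolvent_resolvent: "z \<notin> Spec L \<Longrightarrow> is_resolvent L z (resolvent L z)"
  using resolvent_eq by (auto simp: Spec_def)

lemma is_resolvent_notin_Spec: "is_resolvent L z R \<Longrightarrow> z \<notin> Spec L"
  by (auto simp: Spec_def)

lemma resolvents_commute:
  assumes "is_resolvent L z R" "is_resolvent L z' R'"
  shows "R (R' v) = R' (R v)"
proof (cases "z = z'")
  case True
  then show ?thesis using is_resolvent_unique assms by blast
next
  case False
  have "(z - z') *\<^sub>C R (R' v) = (z - z') *\<^sub>C R' (R v)"
    using resolvent_identity[OF assms, of v] resolvent_identity[OF assms(2,1), of v]
    by (metis minus_diff_eq scaleC_minus_left)
  then show ?thesis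
    using False complex_vector.scale_left_imp_eq by fastforce
qed

text \<open>This and the next lemma express the resolvent at \<open>z\<close> and the inverse of the pencil at \<open>z\<close> by
each other.\<close>

lemma pencil_inverse_from_resolvent:
  assumes K: "is_resolvent L z0 K" and R: "is_resolvent L z R"
  shows "mutually_inverse (pencil z0 K z) (id_blinfun + (z - z0) *\<^sub>C R)"
proof -
  have 1: "R x - K x = (z - z0) *\<^sub>C K (R x)" for x
    using resolvent_identity[OF R K] resolvents_commute[OF K R] by metis
  have 2: "K ((z - z0) *\<^sub>C R x) = R x - K x" for x
    using 1 is_resolventD(2)[OF K] by (simp add: cbounded_iff)
  have 3: "R ((z - z0) *\<^sub>C K x) = R x - K x" for x
    using resolvent_identity[OF R K] is_resolventD(2)[OF R] by (simp add: cbounded_iff)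
  show ?thesis
    unfolding mutually_inverse_def
    by (simp add: pencil_apply blinfun.add_left blinfun.add_right blinfun.diff_right 2 3 scaleC_diff_right)
qed

lemma resolvent_from_pencil_inverse:
  assumes K: "is_resolvent L z0 K" and E: "mutually_inverse (pencil z0 K z) E"
  shows "is_resolvent L z (K o\<^sub>L E)"
proof -
  note cK = is_resolventD(2)[OF K]
  have KE: "K (pencil z0 K z x) = pencil z0 K z (K x)" for x
    using cK by (simp add: pencil_apply blinfun.diff_right cbounded_iff)
  have EK: "E (K x) = K (E x)" for x
    using E KE unfolding mutually_inverse_def by metis
  have "(x, y) \<in> L \<longleftrightarrow> x = K (E (y - z *\<^sub>C x))" for x y
  proof -
    have "(x, y) \<in> L \<longleftrightarrow> x = K (y - z *\<^sub>C x + (z - z0) *\<^sub>C x)"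
      using is_resolventD(1)[OF K] by (simp add: scaleC_diff_left)
    also have "\<dots> \<longleftrightarrow> pencil z0 K z x = K (y - z *\<^sub>C x)"
      using cK by (auto simp: blinfun.add_right pencil_apply cbounded_iff diff_eq_eq)
    also have "\<dots> \<longleftrightarrow> x = E (K (y - z *\<^sub>C x))"
      using E unfolding mutually_inverse_def by metis
    finally show ?thesis by (simp add: EK)
  qed
  then show ?thesis
    using cK cbounded_inverse[OF E cbounded_pencil[OF cK]] by (simp add: is_resolvent_iff cbounded_iff)
qed

lemma op_kernel_shift_iff: "x \<in> op_kernel (op_shift L z) \<longleftrightarrow> (x, z *\<^sub>C x) \<in> L"
  by (auto simp: op_kernel_def op_shift_def)

lemma eigenvector_iff_pencil:
  assumes "is_resolvent L z0 K"
  shows "(x, z *\<^sub>C x) \<in> L \<longleftrightarrow> pencil z0 K z x = 0"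
  using assms by (auto simp: is_resolvent_iff pencil_apply cbounded_iff simp flip: scaleC_diff_left)

lemma continuous_on_resolvent:
  fixes L :: "('a::chilbert_space \<times> 'a) set"
  assumes K: "is_resolvent L z0 K"
  shows "continuous_on (- Spec L) (resolvent L)"
proof -
  define B where "B z = id_blinfun + (z - z0) *\<^sub>C resolvent L z" for z
  have R: "is_resolvent L z (resolvent L z)" if "z \<in> - Spec L" for z
    using that is_resolvent_resolvent by blast
  interpret inverse_family z0 K "- Spec L" B
    by unfold_locales
      (auto simp: B_def intro: is_resolventD(2)[OF K] pencil_inverse_from_resolvent[OF K] R)
  have "continuous_on (- Spec L) (\<lambda>z. K o\<^sub>L B z)"
    by (intro bounded_linear.continuous_on[OF bounded_bilinear.bounded_linear_right[OF bounded_bilinear_blinfun_compose]]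
       continuous_E)
  moreover have "K o\<^sub>L B z = resolvent L z" if "z \<in> - Spec L" for z
    by (rule resolvent_eq[symmetric], rule resolvent_from_pencil_inverse[OF assms E[OF that]])
  ultimately show ?thesis
    using continuous_on_cong by metis
qed

lemma cfunctional_riesz_projection:
  fixes L :: "('a::chilbert_space \<times> 'a) set"
  assumes K: "is_resolvent L z0 K" and r: "0 \<le> r" and S: "sphere a r \<inter> Spec L = {}"
    and f: "cfunctional f"
  shows "f (riesz_projection L a r x)
       = (- 1 / (2 * of_real pi * \<i>)) * contour_integral (circlepath a r) (\<lambda>z. f (resolvent L z x))"
proof -
  have "continuous_on (sphere a r) (resolvent L)"
    using S by (intro continuous_on_subset[OF continuous_on_resolvent[OF K]]) auto
  from cfunctional_operator_contour_integral[OF r this f] show ?thesis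
    using f by (simp only: riesz_projection_def cfunctional_def scaleC_blinfun_apply)
qed

section \<open>Rank-one perturbation of a pencil\<close>

text \<open>Adding a constant \<open>c\<close> to the numerator reduces this to the case of a simple pole, where the numerator
must not vanish at \<open>z\<close>.\<close>

lemma residue_quotient:
  assumes "open s" "connected s" "z \<in> s" "h holomorphic_on s" "g holomorphic_on s"
    and g: "(g has_field_derivative g') (at z)" "g z = 0" "g' \<noteq> 0"
    and nz: "\<And>w. w \<in> s - {z} \<Longrightarrow> g w \<noteq> 0"
  shows "residue (\<lambda>w. h w / g w) z = h z / g'"
proof -
  define c where "c = complex_of_real (cmod (h z) + 1)"
  have c: "c \<noteq> 0" "h z + c \<noteq> 0"
  proof -
    have "cmod c = cmod (h z) + 1"
      unfolding c_def norm_of_real by simp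
    then show "c \<noteq> 0" "h z + c \<noteq> 0"
      using norm_triangle_ineq2[of c "- h z"] by (auto simp: add_eq_0_iff)
  qed
  have hol: "(\<lambda>w. k w / g w) holomorphic_on s - {z}" if "k holomorphic_on s" for k
    using that assms by (intro holomorphic_intros) (auto elim: holomorphic_on_subset)
  have "residue (\<lambda>w. (h w + c) / g w - c / g w) z
      = residue (\<lambda>w. (h w + c) / g w) z - residue (\<lambda>w. c / g w) z"
    using assms by (intro residue_diff[OF \<open>open s\<close> \<open>z \<in> s\<close>] hol holomorphic_intros) auto
  also have "residue (\<lambda>w. (h w + c) / g w) z = (h z + c) / g'"
    using assms c by (intro residue_simple_pole_deriv[of _ s]) (auto intro!: holomorphic_intros)
  also have "residue (\<lambda>w. c / g w) z = c / g'"
    using assms c by (intro residue_simple_pole_deriv[of "\<lambda>_. c" s]) (auto intro!: holomorphic_intros)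
  also have "(\<lambda>w. (h w + c) / g w - c / g w) = (\<lambda>w. h w / g w)"
    by (simp add: fun_eq_iff add_divide_distrib)
  finally show ?thesis
    by (simp add: add_divide_distrib)
qed

lemma cspan_singleton: "cspan {v} = range (\<lambda>c. c *\<^sub>C v)"
  by (auto simp: complex_vector.span_singleton)

lemma cdim_span_singleton:
  assumes "v \<noteq> 0"
  shows "cdim (cspan {v}) = 1"
  using complex_vector.dim_span_eq_card_independent[of "{v}"] assms
  by (simp add: complex_vector.dependent_single)

text \<open>Here \<open>K\<close> is the resolvent at \<open>z0\<close> of an operator \<open>L\<close> for which only the deflated pencil, built from
\<open>K - \<mu> Pr\<close> with a rank-one operator \<open>Pr\<close>, is known to be invertible on \<open>W\<close>. The resolvent of \<open>L\<close> on
\<open>W\<close> is recovered by the Sherman-Morrison formula.\<close>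

locale deflated = inverse_family z0 "K - mu *\<^sub>C Pr" W E
  for z0 K mu Pr W E +
  fixes L :: "('a::chilbert_space \<times> 'a) set" and phi :: "'a \<Rightarrow> complex" and u :: 'a
  assumes resolvent_K: "is_resolvent L z0 K"
    and phi: "cfunctional phi"
    and Pr: "\<And>x. Pr x = phi x *\<^sub>C u"
    and phi_u: "phi u = 1"
begin

text \<open>The determinant of the identity minus the rank-one operator
\<open>x \<mapsto> (z - z0) \<mu> \<phi>(E z x) u\<close>, by which the two pencils differ.\<close>

definition pert_det :: "complex \<Rightarrow> complex"
  where "pert_det z = 1 - (z - z0) * mu * phi (E z u)"

lemma pencil_split: "pencil z0 K z x = pencil z0 (K - mu *\<^sub>C Pr) z x - ((z - z0) * mu * phi x) *\<^sub>C u"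
  by (simp add: pencil_apply blinfun.diff_left Pr scaleC_diff_right scaleC_scaleC)

lemmas phi_simps = cfunctional_simps(1-3)[OF phi]

lemma E_inverse:
  assumes "z \<in> W"
  shows "pencil z0 (K - mu *\<^sub>C Pr) z (E z x) = x" "E z (pencil z0 (K - mu *\<^sub>C Pr) z x) = x"
    "E z (c *\<^sub>C x) = c *\<^sub>C E z x"
  using E[OF assms] cbounded_E[OF assms] by (auto simp: mutually_inverse_def cbounded_iff)

lemma resolvent_formula:
  assumes z: "z \<in> W" and nz: "pert_det z \<noteq> 0"
  obtains R where "is_resolvent L z R"
    and "\<And>x. R x = K (E z x) + ((z - z0) * mu / pert_det z * phi (E z x)) *\<^sub>C K (E z u)"
proof -
  define a where "a = (z - z0) * mu"
  define G where "G x = E z x + (a / pert_det z * phi (E z x)) *\<^sub>C E z u" for x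
  have bphi: "bounded_linear phi"
    using phi by (simp add: cfunctional_def)
  have "bounded_linear G"
    unfolding G_def
    by (intro bounded_linear_add blinfun.bounded_linear_right
        bounded_linear_compose[OF bounded_linear_scaleC_left]
        bounded_linear_compose[OF bounded_linear_mult_right] bounded_linear_compose[OF bphi])
  then have G: "Blinfun G x = G x" for x
    by (simp add: bounded_linear_Blinfun_apply)
  have ps: "pencil z0 K z x = pencil z0 (K - mu *\<^sub>C Pr) z x - (a * phi x) *\<^sub>C u" for x
    by (simp add: pencil_split a_def)
  have e: "a * phi (E z u) = 1 - pert_det z"
    by (simp add: pert_det_def a_def)
  have "mutually_inverse (pencil z0 K z) (Blinfun G)"
    unfolding mutually_inverse_def G
  proof (intro conjI allI)
    fix x
    define k where "k = a / pert_det z * phi (E z x)"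
    have cP: "pencil z0 (K - mu *\<^sub>C Pr) z (c *\<^sub>C y) = c *\<^sub>C pencil z0 (K - mu *\<^sub>C Pr) z y" for c y
      using cbounded_pencil[OF local.K] by (simp add: cbounded_iff)
    have Gx: "G x = E z x + k *\<^sub>C E z u"
      by (simp add: G_def k_def)
    have "pencil z0 K z (G x) = x + k *\<^sub>C u - (a * (phi (E z x) + k * phi (E z u))) *\<^sub>C u"
      by (simp add: ps Gx blinfun.add_right cP E_inverse[OF z] phi_simps distrib_left scaleC_add_left)
    also have "a * (phi (E z x) + k * phi (E z u)) = a * phi (E z x) + k * (1 - pert_det z)"
      by (simp add: distrib_left mult.left_commute[of a k] e)
    also have "\<dots> = k"
      using nz by (simp add: k_def right_diff_distrib)
    finally show "pencil z0 K z (G x) = x"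
      by simp
    have E1: "E z (pencil z0 K z x) = x - (a * phi x) *\<^sub>C E z u"
      by (simp add: ps blinfun.diff_right E_inverse[OF z])
    have "phi (E z (pencil z0 K z x)) = phi x * pert_det z"
      using e by (simp add: E1 phi_simps mult.assoc mult.left_commute[of a "phi x"] right_diff_distrib)
    then show "G (pencil z0 K z x) = x"
      using nz by (simp add: G_def E1)
  qed
  from resolvent_from_pencil_inverse[OF resolvent_K this] show thesis
  proof (rule that)
    show "(K o\<^sub>L Blinfun G) x = K (E z x) + ((z - z0) * mu / pert_det z * phi (E z x)) *\<^sub>C K (E z u)" for x
      using is_resolventD(2)[OF resolvent_K] by (simp add: G G_def blinfun.add_right cbounded_iff a_def)
  qed
qed

text \<open>A null vector \<open>x\<close> of the pencil of \<open>K\<close> satisfies \<open>x = (z - z0) \<mu> \<phi>(x) E z u\<close>, which determines it up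
to a scalar.\<close>

lemma eigenspace:
  assumes z: "z \<in> W" and 0: "pert_det z = 0"
  shows "op_kernel (op_shift L z) = cspan {E z u}" and "E z u \<noteq> 0" and "z \<in> Spec L"
    and "(z - z0) *\<^sub>C K (E z u) = E z u"
proof -
  have e: "(z - z0) * mu * phi (E z u) = 1"
    using 0 by (simp add: pert_det_def)
  have cK: "pencil z0 K z (c *\<^sub>C y) = c *\<^sub>C pencil z0 K z y" for c y
    using cbounded_pencil[OF is_resolventD(2)[OF resolvent_K]] by (simp add: cbounded_iff)
  have Eu: "pencil z0 K z (E z u) = 0"
    by (simp add: pencil_split E_inverse[OF z] e)
  then show "(z - z0) *\<^sub>C K (E z u) = E z u"
    by (simp add: pencil_apply)
  show ne: "E z u \<noteq> 0"
    using e phi_simps(3)[of 0 0] by auto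
  show "op_kernel (op_shift L z) = cspan {E z u}"
  proof (intro equalityI subsetI)
    fix x assume "x \<in> op_kernel (op_shift L z)"
    then have "pencil z0 K z x = 0"
      by (simp add: op_kernel_shift_iff eigenvector_iff_pencil[OF resolvent_K])
    then have "pencil z0 (K - mu *\<^sub>C Pr) z x = ((z - z0) * mu * phi x) *\<^sub>C u"
      by (simp add: pencil_split)
    then have "x = ((z - z0) * mu * phi x) *\<^sub>C E z u"
      using E_inverse[OF z] by metis
    then show "x \<in> cspan {E z u}"
      unfolding cspan_singleton by blast
  next
    fix x assume "x \<in> cspan {E z u}"
    then show "x \<in> op_kernel (op_shift L z)"
      by (auto simp: cspan_singleton op_kernel_shift_iff eigenvector_iff_pencil[OF resolvent_K] cK Eu)
  qed
  show "z \<in> Spec L"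
  proof (rule ccontr)
    assume "z \<notin> Spec L"
    then have "mutually_inverse (pencil z0 K z) (id_blinfun + (z - z0) *\<^sub>C resolvent L z)"
      by (intro pencil_inverse_from_resolvent[OF resolvent_K] is_resolvent_resolvent)
    then have "E z u = 0"
      using Eu unfolding mutually_inverse_def by (metis blinfun.zero_right)
    with ne show False by simp
  qed
qed

lemma Spec_iff: "z \<in> W \<Longrightarrow> z \<in> Spec L \<longleftrightarrow> pert_det z = 0"
  using eigenspace(3) resolvent_formula is_resolvent_notin_Spec by metis

lemma holomorphic_pert_det: "pert_det holomorphic_on W"
  unfolding pert_det_def[abs_def] by (intro holomorphic_intros holomorphic_E phi)

text \<open>In the Sherman-Morrison formula only the summand with the denominator \<open>pert_det\<close> has a pole; it is
simple, and its residue is the rank-one operator on the right.\<close>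

lemma riesz_projection_at_simple_zero:
  assumes W: "open W" "connected W" and z1: "z1 \<in> W" "pert_det z1 = 0"
    and only: "\<And>z. z \<in> W \<Longrightarrow> pert_det z = 0 \<Longrightarrow> z = z1"
    and d: "(pert_det has_field_derivative d) (at z1)" "d \<noteq> 0"
    and rho: "0 < rho" "cball z1 rho \<subseteq> W"
  shows "riesz_projection L z1 rho x = (- mu * phi (E z1 x) / d) *\<^sub>C E z1 u"
proof (rule cinner_ext)
  fix y
  define f where "f v = cinner (K v) y" for v
  have f: "cfunctional f"
    unfolding f_def by (rule cfunctional_compose[OF cfunctional_cinner is_resolventD(2)[OF resolvent_K]])
  define h where "h z = (z - z0) * mu * phi (E z x) * f (E z u)" for z
  have hol: "(\<lambda>z. f (E z x)) holomorphic_on W" "h holomorphic_on W"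
    unfolding h_def by (intro holomorphic_intros holomorphic_E phi f)+
  have quot: "(\<lambda>z. h z / pert_det z) holomorphic_on W - {z1}"
    using hol holomorphic_pert_det only by (intro holomorphic_intros) (auto elim: holomorphic_on_subset)
  have sp: "sphere z1 rho \<inter> Spec L = {}"
    using rho Spec_iff only by force
  have "cinner (riesz_projection L z1 rho x) y = (- 1 / (2 * of_real pi * \<i>)) *
      contour_integral (circlepath z1 rho) (\<lambda>z. cinner (resolvent L z x) y)"
    using rho(1) by (intro cfunctional_riesz_projection[OF resolvent_K _ sp cfunctional_cinner]) simp
  also have "contour_integral (circlepath z1 rho) (\<lambda>z. cinner (resolvent L z x) y)
      = contour_integral (circlepath z1 rho) (\<lambda>z. f (E z x) + h z / pert_det z)"
  proof (rule contour_integral_cong[OF refl])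
    fix z assume "z \<in> path_image (circlepath z1 rho)"
    then have z: "z \<in> W" "pert_det z \<noteq> 0"
      using rho only[of z] by auto
    obtain R where R: "is_resolvent L z R"
      and R': "\<And>x. R x = K (E z x) + ((z - z0) * mu / pert_det z * phi (E z x)) *\<^sub>C K (E z u)"
      using resolvent_formula[OF z] by blast
    show "cinner (resolvent L z x) y = f (E z x) + h z / pert_det z"
      by (simp add: resolvent_eq[OF R] R' f_def h_def cinner_simps)
  qed
  also have "\<dots> = complex_of_real (2 * pi) * \<i> * residue (\<lambda>z. f (E z x) + h z / pert_det z) z1"
    by (intro contour_integral_unique base_residue[OF W(1) z1(1) rho(1) _ rho(2)]
        holomorphic_on_add[OF holomorphic_on_subset[OF hol(1)] quot]) auto
  also have "residue (\<lambda>z. f (E z x) + h z / pert_det z) z1 = residue (\<lambda>z. f (E z x)) z1 + residue (\<lambda>z. h z / pert_det z) z1"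
    using hol quot by (intro residue_add[OF W(1) z1(1)]) (auto elim: holomorphic_on_subset)
  also have "residue (\<lambda>z. f (E z x)) z1 = 0"
    by (rule residue_holo[OF W(1) z1(1) hol(1)])
  also have "residue (\<lambda>z. h z / pert_det z) z1 = h z1 / d"
    using only by (intro residue_quotient[OF W z1(1) hol(2) holomorphic_pert_det d(1) z1(2) d(2)]) auto
  also have "h z1 = mu * phi (E z1 x) * cinner (E z1 u) y"
    using eigenspace(4)[OF z1] by (metis (no_types, lifting) cinner_scaleC_left f_def h_def mult.assoc mult.commute)
  finally show "cinner (riesz_projection L z1 rho x) y = cinner ((- mu * phi (E z1 x) / d) *\<^sub>C E z1 u) y"
    unfolding cinner_scaleC_left by simp
qed

lemma simple_zero_imp_simple_eigenvalue:
  assumes W: "open W" "connected W" and z1: "z1 \<in> W" "pert_det z1 = 0"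
    and only: "\<And>z. z \<in> W \<Longrightarrow> pert_det z = 0 \<Longrightarrow> z = z1"
    and d: "(pert_det has_field_derivative d) (at z1)" "d \<noteq> 0"
  shows "\<And>rho. 0 < rho \<Longrightarrow> cball z1 rho \<subseteq> W \<Longrightarrow>
      range (riesz_projection L z1 rho) = op_kernel (op_shift L z1) \<and> cdim (range (riesz_projection L z1 rho)) = 1"
    and "isolated_simple_eigenvalue L z1"
proof -
  show r: "range (riesz_projection L z1 rho) = op_kernel (op_shift L z1) \<and> cdim (range (riesz_projection L z1 rho)) = 1"
    if rho: "0 < rho" "cball z1 rho \<subseteq> W" for rho
  proof -
    note P = riesz_projection_at_simple_zero[OF assms rho]
    have nz: "mu \<noteq> 0" "phi (E z1 u) \<noteq> 0"
      using z1(2) by (auto simp: pert_det_def)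
    have "range (riesz_projection L z1 rho) = cspan {E z1 u}"
    proof (intro equalityI subsetI)
      fix x assume "x \<in> range (riesz_projection L z1 rho)"
      then obtain v where "x = (- mu * phi (E z1 v) / d) *\<^sub>C E z1 u"
        by (metis P imageE)
      then show "x \<in> cspan {E z1 u}"
        unfolding cspan_singleton by (rule range_eqI)
    next
      fix x assume "x \<in> cspan {E z1 u}"
      then obtain c where x: "x = c *\<^sub>C E z1 u"
        by (auto simp: cspan_singleton)
      define k where "k = - mu * phi (E z1 u) / d"
      have "riesz_projection L z1 rho ((c / k) *\<^sub>C u) = (- mu * (c / k * phi (E z1 u)) / d) *\<^sub>C E z1 u"
        by (simp only: P E_inverse(3)[OF z1(1)] phi_simps)
      also have "- mu * (c / k * phi (E z1 u)) / d = c / k * k"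
        by (simp add: k_def)
      also have "\<dots> = c"
        using nz d(2) by (simp add: k_def)
      finally have "x = riesz_projection L z1 rho ((c / k) *\<^sub>C u)"
        by (simp add: x)
      then show "x \<in> range (riesz_projection L z1 rho)" by blast
    qed
    then show ?thesis
      using eigenspace(1,2)[OF z1] cdim_span_singleton by simp
  qed
  have "Spec L \<inter> W = {z1}"
    using Spec_iff only z1 by blast
  then have "z1 isolated_in Spec L"
    unfolding isolated_in_def using W(1) by (metis Int_commute Int_iff insertI1)
  moreover have "op_kernel (op_shift L z1) \<noteq> {0}"
    using eigenspace(1,2)[OF z1] by (metis complex_vector.span_base singletonD singletonI)
  moreover have "\<forall>\<^sub>F r in at_right 0. cdim (range (riesz_projection L z1 r)) = 1"
  proof -
    obtain e where e: "0 < e" "cball z1 e \<subseteq> W"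
      using W(1) z1(1) open_contains_cball by blast
    have "\<forall>\<^sub>F r in at_right 0. r \<in> {0<..<e}"
      using e(1) by (rule eventually_at_right_real)
    then show ?thesis
    proof (rule eventually_mono)
      fix r assume "r \<in> {0<..<e}"
      then show "cdim (range (riesz_projection L z1 r)) = 1"
        using r[of r] e(2) by force
    qed
  qed
  ultimately show "isolated_simple_eigenvalue L z1"
    by (simp add: isolated_simple_eigenvalue_def)
qed

end

section \<open>Deflation at an isolated simple eigenvalue\<close>

lemma rank_one_range:
  assumes P: "cbounded P" and dim: "cdim (range (blinfun_apply P)) = 1" and u: "u \<in> range P" "u \<noteq> 0"
  shows "range P = cspan {u}"
proof -
  have sub: "csubspace (range P)"
    unfolding complex_vector.subspace_def
  proof (intro conjI ballI allI)
    show "0 \<in> range P"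
      by (rule range_eqI[of _ _ 0]) simp
    fix x assume "x \<in> range P"
    then obtain x' where x: "x = P x'" by blast
    show "c *\<^sub>C x \<in> range P" for c
      using P by (intro range_eqI[of _ _ "c *\<^sub>C x'"]) (simp add: x cbounded_iff)
    fix y assume "y \<in> range P"
    then obtain y' where y: "y = P y'" by blast
    show "x + y \<in> range P"
      by (rule range_eqI[of _ _ "x' + y'"]) (simp add: x y blinfun.add_right)
  qed
  obtain B where B: "B \<subseteq> range P" "\<not> complex_vector.dependent B" "range P \<subseteq> cspan B"
      "card B = cdim (range P)"
    by (rule complex_vector.basis_exists)
  then obtain b where b: "B = {b}"
    using B(4) dim by (auto simp: card_1_singleton_iff)
  obtain c where c: "u = c *\<^sub>C b"
    using u(1) B(3) by (auto simp: b cspan_singleton)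
  then have "c \<noteq> 0"
    using u(2) by auto
  then have "b = (1 / c) *\<^sub>C u"
    by (simp add: c scaleC_scaleC)
  then have "cspan {b} \<subseteq> cspan {u}"
    by (auto simp: cspan_singleton scaleC_scaleC)
  moreover have "cspan {u} \<subseteq> range P"
    using u(1) sub by (intro complex_vector.span_minimal) auto
  ultimately show ?thesis
    using B(3) b by blast
qed

text \<open>Deflation leaves the pencil unchanged on \<open>ker Pr\<close> and makes it the identity on the range of \<open>Pr\<close>.
Hence \<open>B\<close> has to invert the original pencil on \<open>ker Pr\<close> only, where the eigenvalue is absent.\<close>

lemma deflated_pencil_inverse:
  fixes K B Pr :: "'a::complex_normed_vector \<Rightarrow>\<^sub>L 'a"
  assumes K: "cbounded K" and B: "cbounded B"
    and PP: "\<And>x. Pr (Pr x) = Pr x" and PK: "\<And>x. Pr (K x) = mu *\<^sub>C Pr x" "\<And>x. K (Pr x) = mu *\<^sub>C Pr x"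
    and cP: "cbounded Pr"
    and BK: "\<And>x. B (K x) = K (B x)" and BP: "\<And>x. B (Pr x) = Pr (B x)"
    and inv: "\<And>x. Pr x = 0 \<Longrightarrow> pencil z0 K z (B x) = x"
  shows "mutually_inverse (pencil z0 (K - mu *\<^sub>C Pr) z) ((B o\<^sub>L (id_blinfun - Pr)) + Pr)"
proof -
  define k where "k = z - z0"
  define M where "M x = pencil z0 (K - mu *\<^sub>C Pr) z x" for x
  have M: "M x = pencil z0 K z x + (k * mu) *\<^sub>C Pr x" for x
    by (simp add: M_def pencil_apply blinfun.diff_left scaleC_diff_right scaleC_scaleC k_def)
  have E: "((B o\<^sub>L (id_blinfun - Pr)) + Pr) x = B (x - Pr x) + Pr x" for x
    by (simp add: blinfun.add_left blinfun.diff_left)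
  have ker: "Pr (x - Pr x) = 0" for x
    by (simp add: blinfun.diff_right PP)
  have BM: "B (pencil z0 K z x) = pencil z0 K z (B x)" for x
    using B by (simp add: pencil_apply blinfun.diff_right BK cbounded_iff)
  have MP: "M (Pr x) = Pr x" for x
    by (simp add: M pencil_apply PP PK scaleC_scaleC k_def)
  have PM: "Pr (M x) = Pr x" for x
    using cP by (simp add: M pencil_apply blinfun.add_right blinfun.diff_right PP PK cbounded_iff
        scaleC_scaleC k_def)
  have Mker: "M x = pencil z0 K z x" if "Pr x = 0" for x
    using that by (simp add: M)
  show ?thesis
    unfolding mutually_inverse_def E M_def[symmetric]
  proof (intro conjI allI)
    fix x
    have "Pr (B (x - Pr x)) = 0"
      by (simp add: BP[symmetric] ker)
    then have "M (B (x - Pr x)) = x - Pr x"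
      by (simp add: Mker inv[OF ker])
    moreover have "M (B (x - Pr x) + Pr x) = M (B (x - Pr x)) + M (Pr x)"
      by (simp add: M_def blinfun.add_right)
    ultimately show "M (B (x - Pr x) + Pr x) = x"
      by (simp add: MP)
    have "M x - Pr (M x) = M (x - Pr x)"
      using MP[of x] by (simp add: PM) (simp add: M_def blinfun.diff_right)
    then have "B (M x - Pr (M x)) = x - Pr x"
      by (simp add: Mker[OF ker] BM inv[OF ker])
    then show "B (M x - Pr (M x)) + Pr (M x) = x"
      by (simp add: PM)
  qed
qed

lemma contour_integral_circlepath_inverse:
  "0 < r \<Longrightarrow> contour_integral (circlepath z r) (\<lambda>w. c / (w - z)) = 2 * of_real pi * \<i> * c"
proof -
  assume r: "0 < r"
  have "(\<lambda>w. 1 / (w - z)) contour_integrable_on circlepath z r"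
    using r by (intro contour_integrable_continuous_circlepath continuous_intros) auto
  from contour_integral_lmul[OF this, of c] show ?thesis
    using contour_integral_circlepath[OF r, of z] by (simp add: mult_ac)
qed

text \<open>The hypothesis gives a circle around \<open>\<lambda>\<close> whose Riesz projection \<open>Pr\<close> has rank one. It fixes every
eigenvector, so its range is spanned by one of them, and it commutes with \<open>K\<close>. Away from \<open>\<lambda>\<close> the
resolvent inverts the pencil. At \<open>\<lambda>\<close> itself this is done on \<open>ker Pr\<close> by the reduced resolvent
\<open>S = (1 / 2\<pi>i) \<integral> R(z) / (z - \<lambda>) dz\<close>, which satisfies
\<open>(1 - (\<lambda> - z0) K) S = K - K Pr\<close>. The last conclusion, that \<open>L - \<lambda>\<close> maps onto \<open>ker \<phi>\<close>, follows from
the deflated inverse at \<open>\<lambda>\<close>.\<close>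

lemma simple_eigenvalue_deflation:
  fixes L :: "('a::chilbert_space \<times> 'a) set"
  assumes K: "is_resolvent L z0 K" and simple: "isolated_simple_eigenvalue L lambda"
  defines "mu \<equiv> 1 / (lambda - z0)"
  obtains Pr :: "'a \<Rightarrow>\<^sub>L 'a" and phi u where "lambda \<noteq> z0" "cbounded Pr" "cfunctional phi" "\<And>x. Pr x = phi x *\<^sub>C u" "phi u = 1"
    "(u, lambda *\<^sub>C u) \<in> L" "K u = mu *\<^sub>C u" "\<And>x. phi (K x) = mu * phi x" "\<And>x. (x, lambda *\<^sub>C x) \<in> L \<Longrightarrow> x = phi x *\<^sub>C u"
    "\<And>z. z \<notin> Spec L \<or> z = lambda \<Longrightarrow> \<exists>E. mutually_inverse (pencil z0 (K - mu *\<^sub>C Pr) z) E"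
    "\<And>y. phi y = 0 \<Longrightarrow> \<exists>x. (x, lambda *\<^sub>C x + y) \<in> L"
proof -
  note cK = is_resolventD(2)[OF K]
  have lS: "lambda \<in> Spec L"
    using simple by (auto simp: isolated_simple_eigenvalue_def isolated_in_def)
  have lz: "lambda \<noteq> z0"
    using lS is_resolvent_notin_Spec[OF K] by blast
  obtain d where d: "0 < d" "\<And>y. y \<in> Spec L \<Longrightarrow> dist lambda y < d \<Longrightarrow> y = lambda"
    using simple isolated_inE_dist unfolding isolated_simple_eigenvalue_def by metis
  have "\<forall>\<^sub>F r in at_right 0. r \<in> {0<..<d} \<and> cdim (range (riesz_projection L lambda r)) = 1"
    using simple unfolding isolated_simple_eigenvalue_def
    by (intro eventually_conj eventually_at_right_real[OF d(1)]) blast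
  then obtain r where r: "0 < r" "r < d" "cdim (range (riesz_projection L lambda r)) = 1"
    using eventually_happens[of _ "at_right (0::real)"] by auto
  define Pr where "Pr = riesz_projection L lambda r"
  define R where "R = resolvent L"
  have S: "sphere lambda r \<inter> Spec L = {}"
    using d(2) r by fastforce
  have R: "is_resolvent L z (R z)" if "z \<in> sphere lambda r" for z
    unfolding R_def using S that by (intro is_resolvent_resolvent) blast
  have cont: "continuous_on (sphere lambda r) R"
    unfolding R_def using S by (intro continuous_on_subset[OF continuous_on_resolvent[OF K]]) auto
  have r0: "0 \<le> r" using r(1) by simp
  let ?c = "- 1 / (2 * of_real pi * \<i>)"
  have Pr_test: "f (Pr x) = ?c * contour_integral (circlepath lambda r) (\<lambda>z. f (R z x))"
    if "cfunctional f" for f x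
    unfolding Pr_def R_def by (rule cfunctional_riesz_projection[OF K r0 S that])
  have Pr_eq: "Pr x = ?c *\<^sub>C operator_contour_integral (circlepath lambda r) R x" for x
    by (simp only: Pr_def R_def riesz_projection_def scaleC_blinfun_apply)
  have cPr: "cbounded Pr"
    using cbounded_operator_contour_integral[OF r0 cont] is_resolventD(2)[OF R]
    unfolding cbounded_iff Pr_eq by (simp add: scaleC_scaleC mult.commute del: scaleC_scaleC[symmetric])
  have Pr_commute: "B (Pr x) = Pr (B x)"
    if "cbounded B" "\<And>z x. z \<in> sphere lambda r \<Longrightarrow> B (R z x) = R z (B x)" for B :: "'a \<Rightarrow>\<^sub>L 'a" and x
    using operator_contour_integral_commute[OF r0 cont that] that(1) unfolding Pr_eq cbounded_iff by metis
  have eigR: "R z x = (1 / (lambda - z)) *\<^sub>C x" if x: "(x, lambda *\<^sub>C x) \<in> L" and z: "z \<in> sphere lambda r" for z x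
  proof -
    have "x = R z ((lambda - z) *\<^sub>C x)"
      using is_resolventD(1)[OF R[OF z]] x by (simp add: scaleC_diff_left)
    also have "\<dots> = (lambda - z) *\<^sub>C R z x"
      using is_resolventD(2)[OF R[OF z]] by (simp add: cbounded_iff)
    finally have "(1 / (lambda - z)) *\<^sub>C x = (1 / (lambda - z) * (lambda - z)) *\<^sub>C R z x"
      by (metis scaleC_scaleC)
    moreover have "lambda - z \<noteq> 0"
      using z r(1) by auto
    ultimately show ?thesis by simp
  qed
  have Pr_eigen: "Pr x = x" if x: "(x, lambda *\<^sub>C x) \<in> L" for x
  proof (rule cinner_ext)
    fix y
    have "cinner (Pr x) y = ?c * contour_integral (circlepath lambda r) (\<lambda>z. cinner (R z x) y)"
      by (rule Pr_test[OF cfunctional_cinner])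
    also have "contour_integral (circlepath lambda r) (\<lambda>z. cinner (R z x) y)
        = contour_integral (circlepath lambda r) (\<lambda>z. - cinner x y / (z - lambda))"
    proof (rule contour_integral_cong[OF refl])
      fix z assume "z \<in> path_image (circlepath lambda r)"
      then have "R z x = (1 / (lambda - z)) *\<^sub>C x"
        using eigR[OF x] r0 by simp
      then show "cinner (R z x) y = - cinner x y / (z - lambda)"
        by (metis cinner_scaleC_left minus_diff_eq minus_divide_divide mult.left_neutral times_divide_eq_left)
    qed
    finally show "cinner (Pr x) y = cinner x y"
      by (simp only: contour_integral_circlepath_inverse[OF r(1)]) simp
  qed
  have sub0: "0 \<in> op_kernel (op_shift L lambda)"
    unfolding op_kernel_shift_iff using is_resolventD(1)[OF K] by simp
  obtain u where u: "u \<noteq> 0" "(u, lambda *\<^sub>C u) \<in> L"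
    using simple sub0 unfolding isolated_simple_eigenvalue_def op_kernel_shift_iff[symmetric] by blast
  have "u \<in> range Pr"
    by (rule range_eqI[of _ _ u]) (simp add: Pr_eigen[OF u(2)])
  then have rng: "range Pr = cspan {u}"
    using rank_one_range[OF cPr] r(3) u(1) by (simp add: Pr_def)
  define phi where "phi x = cinner (Pr x) ((1 / cnj (cinner u u)) *\<^sub>C u)" for x
  have phi: "cfunctional phi"
    unfolding phi_def by (rule cfunctional_compose[OF cfunctional_cinner cPr])
  have Pr_phi: "Pr x = phi x *\<^sub>C u" for x
  proof -
    obtain c where c: "Pr x = c *\<^sub>C u"
      using rng by (auto simp: cspan_singleton)
    then have "phi x = c"
      using u(1) by (simp add: phi_def cinner_simps)
    with c show ?thesis by simp
  qed
  have phi_u: "phi u = 1"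
    using u(1) by (simp add: phi_def Pr_eigen[OF u(2)] cinner_simps)
  have Ku: "K u = mu *\<^sub>C u"
  proof -
    have "u = K ((lambda - z0) *\<^sub>C u)"
      using is_resolventD(1)[OF K] u(2) by (simp add: scaleC_diff_left)
    also have "\<dots> = (lambda - z0) *\<^sub>C K u"
      using cK by (simp add: cbounded_iff)
    finally have "mu *\<^sub>C u = (mu * (lambda - z0)) *\<^sub>C K u"
      by (metis scaleC_scaleC)
    then show ?thesis
      using lz by (simp add: mu_def)
  qed
  have KPr: "K (Pr x) = mu *\<^sub>C Pr x" for x
    using cK by (simp add: Pr_phi Ku cbounded_iff scaleC_scaleC mult.commute)
  have KR: "K (R z x) = R z (K x)" if "z \<in> sphere lambda r" for z x
    by (rule resolvents_commute[OF K R[OF that]])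
  have PrK: "Pr (K x) = mu *\<^sub>C Pr x" for x
    using Pr_commute[OF cK KR] KPr by simp
  have PrPr: "Pr (Pr x) = Pr x" for x
    using phi by (simp add: Pr_phi phi_u cfunctional_def)
  \<comment> \<open>the reduced resolvent, the value at \<open>\<lambda>\<close> of the regular part of the resolvent\<close>
  define F where "F z = (1 / (z - lambda)) *\<^sub>C R z" for z
  have contF: "continuous_on (sphere lambda r) F"
    unfolding F_def using r(1)
    by (intro bounded_bilinear.continuous_on[OF scaleC_blinfun_bounded_bilinear] cont continuous_intros) auto
  have cF: "cbounded (F z)" if "z \<in> sphere lambda r" for z
    using is_resolventD(2)[OF R[OF that]] by (simp add: F_def cbounded_iff scaleC_scaleC mult.commute)
  define S where "S = (1 / (2 * of_real pi * \<i>)) *\<^sub>C operator_contour_integral (circlepath lambda r) F"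
  have S_test: "f (S x) = 1 / (2 * of_real pi * \<i>) * contour_integral (circlepath lambda r) (\<lambda>z. f (F z x))"
    if "cfunctional f" for f x
    using cfunctional_operator_contour_integral[OF r0 contF that] that
    by (simp only: S_def cfunctional_def scaleC_blinfun_apply)
  have cS: "cbounded S"
    using cbounded_operator_contour_integral[OF r0 contF cF]
    by (simp add: cbounded_iff S_def scaleC_scaleC mult.commute)
  have S_commute: "B (S x) = S (B x)"
    if "cbounded B" "\<And>z x. z \<in> sphere lambda r \<Longrightarrow> B (R z x) = R z (B x)" for B :: "'a \<Rightarrow>\<^sub>L 'a" and x
  proof -
    have "B (F z x) = F z (B x)" if "z \<in> sphere lambda r" for z x
      using \<open>cbounded B\<close> \<open>\<And>z x. z \<in> sphere lambda r \<Longrightarrow> B (R z x) = R z (B x)\<close>[OF that]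
      by (simp add: F_def cbounded_iff)
    from operator_contour_integral_commute[OF r0 contF that(1) this] that(1)
    show ?thesis
      by (simp add: S_def cbounded_iff)
  qed
  have RPr: "R z (Pr x) = Pr (R z x)" if z: "z \<in> sphere lambda r" for z x
    by (rule Pr_commute[OF is_resolventD(2)[OF R[OF z]] resolvents_commute[OF R[OF z] R]])
  have S_inv: "pencil z0 K lambda (S x) = K x - K (Pr x)" for x
  proof (rule cinner_ext)
    fix y
    define f where "f v = cinner v y" for v :: 'a
    have f: "cfunctional f"
      unfolding f_def by (rule cfunctional_cinner)
    have fK: "cfunctional (\<lambda>v. f (K v))"
      by (rule cfunctional_compose[OF f cK])
    have "f (pencil z0 K lambda (S x)) = 1 / (2 * of_real pi * \<i>) *
        contour_integral (circlepath lambda r) (\<lambda>z. f (pencil z0 K lambda (F z x)))"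
      by (rule S_test[OF cfunctional_compose[OF f cbounded_pencil[OF cK]]])
    also have "contour_integral (circlepath lambda r) (\<lambda>z. f (pencil z0 K lambda (F z x)))
        = contour_integral (circlepath lambda r) (\<lambda>z. f (K x) / (z - lambda) + f (K (R z x)))"
    proof (rule contour_integral_cong[OF refl])
      fix z assume "z \<in> path_image (circlepath lambda r)"
      then have z: "z \<in> sphere lambda r" using r0 by simp
      then have zl: "z \<noteq> lambda" using r(1) by auto
      have "R z x - K x = (z - z0) *\<^sub>C K (R z x)"
        using resolvent_identity[OF R[OF z] K] KR[OF z] by simp
      then have Rz: "R z x = K x + (z - z0) *\<^sub>C K (R z x)"
        by (simp add: diff_eq_eq add.commute)
      have "pencil z0 K lambda (R z x) = K x + ((z - z0) - (lambda - z0)) *\<^sub>C K (R z x)"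
        unfolding pencil_apply scaleC_diff_left[of "z - z0"] using Rz by (simp add: algebra_simps)
      then have "pencil z0 K lambda (F z x) = (1 / (z - lambda)) *\<^sub>C (K x + (z - lambda) *\<^sub>C K (R z x))"
        using cbounded_pencil[OF cK] by (simp add: F_def cbounded_iff)
      also have "\<dots> = (1 / (z - lambda)) *\<^sub>C K x + K (R z x)"
        using zl by (simp add: scaleC_add_right scaleC_scaleC)
      finally show "f (pencil z0 K lambda (F z x)) = f (K x) / (z - lambda) + f (K (R z x))"
        by (simp add: f_def cinner_simps)
    qed
    also have "\<dots> = contour_integral (circlepath lambda r) (\<lambda>z. f (K x) / (z - lambda))
        + contour_integral (circlepath lambda r) (\<lambda>z. f (K (R z x)))"
      using r(1) by (intro contour_integral_add cfunctional_contour_integrable[OF r0 cont fK]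
          contour_integrable_continuous_circlepath continuous_intros) auto
    also have "contour_integral (circlepath lambda r) (\<lambda>z. f (K x) / (z - lambda)) = 2 * of_real pi * \<i> * f (K x)"
      by (rule contour_integral_circlepath_inverse[OF r(1)])
    also have "contour_integral (circlepath lambda r) (\<lambda>z. f (K (R z x))) = - (2 * of_real pi * \<i>) * f (K (Pr x))"
      using Pr_test[OF fK] by simp
    finally show "cinner (pencil z0 K lambda (S x)) y = cinner (K x - K (Pr x)) y"
      by (simp add: f_def[symmetric] cinner_diff_left ring_distribs) (simp add: f_def cinner_diff_left)
  qed
  have defl: "\<exists>E. mutually_inverse (pencil z0 (K - mu *\<^sub>C Pr) z) E" if z: "z \<notin> Spec L \<or> z = lambda" for z
  proof -
    define B where "B = id_blinfun + (z - z0) *\<^sub>C (if z = lambda then S else R z)"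
    let ?T = "if z = lambda then S else R z"
    have Rz: "is_resolvent L z (R z)" if "z \<noteq> lambda"
      using z that is_resolvent_resolvent unfolding R_def by blast
    have cT: "cbounded ?T"
      using cS is_resolventD(2)[OF Rz] by simp
    have TK: "?T (K x) = K (?T x)" for x
      using S_commute[OF cK KR] resolvents_commute[OF Rz K] by simp
    have TP: "?T (Pr x) = Pr (?T x)" for x
    proof (cases "z = lambda")
      case True
      then show ?thesis using S_commute[OF cPr RPr[symmetric]] by simp
    next
      case False
      then show ?thesis
        using Pr_commute[OF is_resolventD(2)[OF Rz[OF False]] resolvents_commute[OF Rz[OF False] R]] by simp
    qed
    have "mutually_inverse (pencil z0 (K - mu *\<^sub>C Pr) z) ((B o\<^sub>L (id_blinfun - Pr)) + Pr)"
    proof (rule deflated_pencil_inverse[OF cK _ PrPr PrK KPr cPr])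
      show "cbounded B"
        using cT by (simp add: B_def cbounded_iff blinfun.add_left scaleC_add_right scaleC_scaleC mult.commute
          del: if_split)
      show "B (K x) = K (B x)" for x
        using cK TK by (simp add: B_def blinfun.add_left blinfun.add_right cbounded_iff del: if_split)
      show "B (Pr x) = Pr (B x)" for x
        using cPr TP by (simp add: B_def blinfun.add_left blinfun.add_right cbounded_iff del: if_split)
      show "pencil z0 K z (B x) = x" if "Pr x = 0" for x
      proof (cases "z = lambda")
        case True
        have "pencil z0 K z (B x) = pencil z0 K lambda x + (lambda - z0) *\<^sub>C pencil z0 K lambda (S x)"
          using cbounded_pencil[OF cK] True by (simp add: B_def blinfun.add_left blinfun.add_right cbounded_iff)
        also have "pencil z0 K lambda (S x) = K x"
          using that by (simp add: S_inv)
        finally show ?thesis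
          by (simp add: pencil_apply)
      next
        case False
        then show ?thesis
          using pencil_inverse_from_resolvent[OF K Rz[OF False]] by (simp add: B_def mutually_inverse_def)
      qed
    qed
    then show ?thesis by blast
  qed
  have surj: "\<exists>x. (x, lambda *\<^sub>C x + y) \<in> L" if y: "phi y = 0" for y
  proof -
    obtain E where E: "mutually_inverse (pencil z0 (K - mu *\<^sub>C Pr) lambda) E"
      using defl by blast
    define x where "x = E (K y)"
    have x: "pencil z0 K lambda x + ((lambda - z0) * mu) *\<^sub>C Pr x = K y"
      using E unfolding mutually_inverse_def x_def
      by (simp add: pencil_apply blinfun.diff_left scaleC_diff_right scaleC_scaleC algebra_simps)
    have "Pr (pencil z0 K lambda x) = Pr x - ((lambda - z0) * mu) *\<^sub>C Pr x"
      using cPr by (simp add: pencil_apply blinfun.diff_right cbounded_iff PrK scaleC_scaleC)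
    moreover have "Pr (K y) = 0"
      by (simp add: PrK) (simp add: Pr_phi y)
    ultimately have "Pr x = 0"
      using arg_cong[OF x, of "blinfun_apply Pr"] cPr
      by (simp add: blinfun.add_right cbounded_iff PrPr)
    then have "x = K (y + (lambda - z0) *\<^sub>C x)"
      using x cK by (simp add: pencil_apply blinfun.add_right cbounded_iff diff_eq_eq)
    then have "(x, lambda *\<^sub>C x + y) \<in> L"
      using is_resolventD(1)[OF K] by (simp add: scaleC_diff_left algebra_simps)
    then show ?thesis by blast
  qed
  have phiK: "phi (K x) = mu * phi x" for x
    by (simp add: phi_def PrK cinner_scaleC_left)
  show thesis
    by (rule that[OF lz cPr phi Pr_phi phi_u u(2) Ku phiK _ defl surj]) (simp add: Pr_eigen flip: Pr_phi)
qed

section \<open>Perturbation of a simple eigenvalue\<close>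

text \<open>The zeros of \<open>a + g z - z\<close> are the fixed points of \<open>z \<mapsto> a + g z\<close>. By the Cauchy estimate this map is a
contraction of the disc of half the radius, and the bound on \<open>g\<close> confines all fixed points to
that disc.\<close>

lemma perturbed_simple_zero:
  fixes a :: complex
  assumes r: "0 < r" and hol: "g holomorphic_on ball a r"
    and small: "\<And>z. z \<in> ball a r \<Longrightarrow> cmod (g z) < r / 16"
  obtains z1 where "z1 \<in> ball a r" "a + g z1 = z1" "\<And>z. z \<in> ball a r \<Longrightarrow> a + g z = z \<Longrightarrow> z = z1"
    "cmod (deriv g z1) < 1"
proof -
  let ?s = "cball a (r / 2)"
  have sub: "ball z (r / 2) \<subseteq> ball a r" if "z \<in> ?s" for z
  proof
    fix w assume "w \<in> ball z (r / 2)"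
    then show "w \<in> ball a r"
      using that dist_triangle[of a w z] by simp
  qed
  \<comment> \<open>Cauchy's estimate on discs of radius \<open>r / 4\<close>; \<open>1 / 4 = (r / 16) / (r / 4)\<close>\<close>
  have der: "cmod (deriv g z) \<le> 1 / 4" if z: "z \<in> ?s" for z
  proof -
    have sub': "cball z (r / 4) \<subseteq> ball a r"
      using sub[OF z] r by (intro order_trans[OF _ sub[OF z]]) auto
    have "cmod ((deriv ^^ 1) g z) \<le> fact 1 * (r / 16) / (r / 4) ^ 1"
    proof (rule Cauchy_higher_deriv_bound[where y = 0])
      show "g holomorphic_on ball z (r / 4)"
        using sub' by (intro holomorphic_on_subset[OF hol]) auto
      show "continuous_on (cball z (r / 4)) g"
        using sub' by (intro holomorphic_on_imp_continuous_on holomorphic_on_subset[OF hol])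
      show "g w \<in> ball 0 (r / 16)" if "w \<in> ball z (r / 4)" for w
        using small[of w] that subsetD[OF sub', of w] by auto
    qed (use r in auto)
    then show ?thesis using r by simp
  qed
  have lip: "cmod (g w - g z) \<le> 1 / 4 * cmod (w - z)" if "z \<in> ?s" "w \<in> ?s" for z w
  proof (rule field_differentiable_bound[of ?s g "deriv g"])
    fix x assume x: "x \<in> ?s"
    then have "x \<in> ball a r"
      using r by auto
    then show "(g has_field_derivative deriv g x) (at x within ?s)"
      using hol holomorphic_derivI[of g "ball a r" x] by (auto intro: has_field_derivative_at_within)
    show "cmod (deriv g x) \<le> 1 / 4"
      by (rule der[OF x])
  qed (use that in auto)
  have "\<exists>!z\<in>?s. a + g z = z"
  proof (rule Banach_fix[of _ "1/4"])
    show "complete ?s" "?s \<noteq> {}"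
      using r by (auto simp: complete_eq_closed)
    show "(\<lambda>z. a + g z) ` ?s \<subseteq> ?s"
    proof
      fix w assume "w \<in> (\<lambda>z. a + g z) ` ?s"
      then obtain z where z: "z \<in> ?s" "w = a + g z" by blast
      then have "cmod (g z) < r / 16"
        using small[of z] r by auto
      then show "w \<in> ?s"
        using z(2) r by (simp add: dist_norm)
    qed
    show "dist (a + g x) (a + g y) \<le> 1 / 4 * dist x y" if "x \<in> ?s" "y \<in> ?s" for x y
      using lip[OF that(2,1)] by (simp add: dist_norm)
  qed simp_all
  then obtain z1 where z1: "z1 \<in> ?s" "a + g z1 = z1" "\<And>z. z \<in> ?s \<Longrightarrow> a + g z = z \<Longrightarrow> z = z1"
    by blast
  show thesis
  proof (rule that[of z1])
    show "z1 \<in> ball a r"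
      using z1(1) r by auto
    show "z = z1" if "z \<in> ball a r" "a + g z = z" for z
    proof (rule z1(3))
      have "dist a z = cmod (g z)"
        using that(2) by (metis add_diff_cancel_left' dist_commute dist_norm)
      then show "z \<in> ?s"
        using small[OF that(1)] r by simp
    qed fact
    show "cmod (deriv g z1) < 1"
      using der[OF z1(1)] by simp
  qed (rule z1(2))
qed

text \<open>The scalars \<open>\<mu>\<close>, the functional \<open>\<phi>\<close> and the projection \<open>Pr\<close> are those of \<open>t0\<close> for all \<open>t\<close>, so that
the deflated pencils depend on \<open>t\<close> only through \<open>K t\<close>. The eigenvector \<open>e t\<close> is the deflated inverse
at \<open>ev t\<close> applied to \<open>u\<close>; at \<open>t0\<close> this is \<open>u\<close> for every point of the disc, which is why \<open>e t\<close> converges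
to \<open>u\<close>.\<close>

theorem simple_eigenvalue_perturbation:
  fixes L :: "real \<Rightarrow> ('a::chilbert_space \<times> 'a) set" and K :: "real \<Rightarrow> 'a \<Rightarrow>\<^sub>L 'a"
  assumes res: "\<forall>\<^sub>F t in nhds t0. is_resolvent (L t) z0 (K t)"
    and cont: "(K \<longlongrightarrow> K t0) (at t0)"
    and simple: "isolated_simple_eigenvalue (L t0) lambda"
    and r: "0 < r" and gap: "\<forall>z\<in>Spec (L t0). dist lambda z < 2 * r \<longrightarrow> z = lambda"
  obtains phi u ev e where
    "\<forall>x. riesz_projection (L t0) lambda r x = phi x *\<^sub>C u"
    "cfunctional phi" "phi u = 1" "\<forall>y. phi y = 0 \<longrightarrow> (\<exists>x. (x, lambda *\<^sub>C x + y) \<in> L t0)"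
    "range (riesz_projection (L t0) lambda r) = op_kernel (op_shift (L t0) lambda)"
    "cdim (range (riesz_projection (L t0) lambda r)) = 1"
    "op_kernel (op_shift (L t0) lambda) = cspan {u}" "u \<noteq> 0"
    "\<forall>\<^sub>F t in nhds t0. Spec (L t) \<inter> ball lambda r = {ev t} \<and> isolated_simple_eigenvalue (L t) (ev t)
       \<and> (e t, ev t *\<^sub>C e t) \<in> L t"
    "ev t0 = lambda" "(ev \<longlongrightarrow> lambda) (at t0)" "(e \<longlongrightarrow> u) (at t0)"
proof -
  have K0: "is_resolvent (L t0) z0 (K t0)"
    using eventually_nhds_x_imp_x[OF res] .
  define mu where "mu = 1 / (lambda - z0)"
  obtain Pr phi u where lz: "lambda \<noteq> z0" and cPr: "cbounded Pr" and phi: "cfunctional phi"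
    and Pr: "\<And>x. Pr x = phi x *\<^sub>C u" and phi_u: "phi u = 1" and Ku: "K t0 u = mu *\<^sub>C u"
    and phiK: "\<And>x. phi (K t0 x) = mu * phi x"
    and surj: "\<forall>y. phi y = 0 \<longrightarrow> (\<exists>x. (x, lambda *\<^sub>C x + y) \<in> L t0)"
    and inv0: "\<And>z. z \<notin> Spec (L t0) \<or> z = lambda \<Longrightarrow> \<exists>E. mutually_inverse (pencil z0 (K t0 - mu *\<^sub>C Pr) z) E"
    unfolding mu_def by (rule simple_eigenvalue_deflation[OF K0 simple]) blast
  have mu: "mu \<noteq> 0"
    using lz by (simp add: mu_def)
  have phis: "phi (x - y) = phi x - phi y" "phi (c *\<^sub>C x) = c * phi x" for x y c
    using phi by (auto simp: cfunctional_def linear_simps)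
  have cb: "cbounded (K t - mu *\<^sub>C Pr)" if "is_resolvent (L t) z0 (K t)" for t
    using is_resolventD(2)[OF that] cPr
    by (simp add: cbounded_iff blinfun.diff_left scaleC_diff_right scaleC_scaleC mult.commute)
  define E where "E t z = (SOME E. mutually_inverse (pencil z0 (K t - mu *\<^sub>C Pr) z) E)" for t z
  have E: "mutually_inverse (pencil z0 (K t - mu *\<^sub>C Pr) z) (E t z)"
    if "\<exists>E. mutually_inverse (pencil z0 (K t - mu *\<^sub>C Pr) z) E" for t z
    unfolding E_def by (rule someI_ex[OF that])
  have E0: "mutually_inverse (pencil z0 (K t0 - mu *\<^sub>C Pr) z) (E t0 z)" if "z \<in> ball lambda (2 * r)" for z
    using that gap by (intro E inv0) auto
  interpret d0: deflated z0 "K t0" mu Pr "ball lambda (2 * r)" "E t0" "L t0" phi u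
    by unfold_locales (auto intro: cb K0 E0 phi Pr phi_u)
  have E0u: "E t0 z u = u" if "z \<in> ball lambda (2 * r)" for z
  proof -
    have "pencil z0 (K t0 - mu *\<^sub>C Pr) z u = u"
      by (simp add: pencil_apply blinfun.diff_left Ku Pr phi_u)
    then show ?thesis
      using E0[OF that] unfolding mutually_inverse_def by metis
  qed
  have det0: "d0.pert_det z = mu * (lambda - z)" if "z \<in> ball lambda (2 * r)" for z
  proof -
    have "(lambda - z0) * mu = 1"
      using lz by (simp add: mu_def)
    then show ?thesis
      by (simp add: d0.pert_det_def E0u[OF that] phi_u algebra_simps)
  qed
  have l_in: "lambda \<in> ball lambda (2 * r)" and l_det: "d0.pert_det lambda = 0"
    using r by (simp_all add: det0)
  have "((\<lambda>z. mu * (lambda - z)) has_field_derivative - mu) (at lambda)"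
    by (auto intro!: derivative_eq_intros)
  then have d_det: "(d0.pert_det has_field_derivative - mu) (at lambda)"
    by (rule has_field_derivative_transform_within_open[OF _ open_ball l_in]) (simp add: det0)
  have riesz0: "range (riesz_projection (L t0) lambda r) = op_kernel (op_shift (L t0) lambda)
      \<and> cdim (range (riesz_projection (L t0) lambda r)) = 1"
    using mu det0 r by (intro d0.simple_zero_imp_simple_eigenvalue(1)[OF _ _ l_in l_det _ d_det]) auto
  have riesz_phi: "riesz_projection (L t0) lambda r x = phi x *\<^sub>C u" for x
  proof -
    have "riesz_projection (L t0) lambda r x = (- mu * phi (E t0 lambda x) / (- mu)) *\<^sub>C E t0 lambda u"
      using mu det0 r by (intro d0.riesz_projection_at_simple_zero[OF _ _ l_in l_det _ d_det]) auto
    also have "- mu * phi (E t0 lambda x) / (- mu) = phi (E t0 lambda x)"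
      using mu by simp
    also have "phi (E t0 lambda x) = phi (pencil z0 (K t0 - mu *\<^sub>C Pr) lambda (E t0 lambda x))"
      by (simp add: pencil_apply blinfun.diff_left phis phiK Pr phi_u)
    also have "\<dots> = phi x"
      using E0[OF l_in] by (simp add: mutually_inverse_def)
    finally show ?thesis
      by (simp add: E0u[OF l_in])
  qed
  have ker0: "op_kernel (op_shift (L t0) lambda) = cspan {u}" "u \<noteq> 0"
    using d0.eigenspace(1,2)[OF l_in l_det] by (simp_all add: E0u[OF l_in])
  \<comment> \<open>compactness of the closed disc makes the Neumann estimate below uniform in \<open>z\<close>\<close>
  have "compact (E t0 ` cball lambda r)"
    using r by (intro compact_continuous_image continuous_on_subset[OF d0.continuous_E]) auto
  then obtain C where C: "0 < C" "\<And>z. z \<in> cball lambda r \<Longrightarrow> norm (E t0 z) \<le> C"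
    using compact_imp_bounded bounded_pos by (metis imageI)
  define B where "B = cmod (lambda - z0) + r"
  have B: "cmod (z - z0) \<le> B" if "z \<in> cball lambda r" for z
    using that r norm_triangle_ineq[of "z - lambda" "lambda - z0"] by (auto simp: B_def dist_norm norm_minus_commute)
  have B0: "0 < B"
    using r by (simp add: B_def add_nonneg_pos)
  obtain c where c: "0 < c" "\<And>x. cmod (phi x) \<le> c * norm x"
    using phi bounded_linear.pos_bounded[of phi] by (auto simp: cfunctional_def mult.commute)
  define delta where "delta t = norm (K t - K t0)" for t
  have inv: "mutually_inverse (pencil z0 (K t - mu *\<^sub>C Pr) z) (E t z) \<and>
      norm (E t z - E t0 z) \<le> 2 * C\<^sup>2 * B * delta t"
    if z: "z \<in> cball lambda r" and sm: "B * C * delta t \<le> 1 / 2" for t z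
  proof -
    have z': "z \<in> ball lambda (2 * r)"
      using z r by auto
    let ?M = "\<lambda>t. pencil z0 (K t - mu *\<^sub>C Pr) z"
    have "?M t - ?M t0 = - (z - z0) *\<^sub>C (K t - K t0)"
      by (rule blinfun_eqI) (simp add: pencil_apply blinfun.diff_left blinfun.minus_left scaleC_diff_right
          scaleC_minus_left scaleC_diff_left)
    then have n: "norm (?M t - ?M t0) \<le> B * delta t"
      using norm_scaleC_blinfun_le[of "- (z - z0)" "K t - K t0"] B[OF z]
        mult_right_mono[of "cmod (z - z0)" B "delta t"]
      by (simp add: delta_def norm_minus_commute)
    have "norm (?M t - ?M t0) * norm (E t0 z) \<le> (B * delta t) * C"
      using C B0 by (intro mult_mono n C(2) z) (auto simp: delta_def)
    also have "\<dots> \<le> 1 / 2"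
      using sm by (simp add: mult_ac)
    finally obtain E' where E': "mutually_inverse (?M t) E'"
        "norm (E' - E t0 z) \<le> 2 * (norm (E t0 z))\<^sup>2 * norm (?M t - ?M t0)"
      using Neumann_perturbation[OF E0[OF z']] by blast
    then have Et: "mutually_inverse (?M t) (E t z)"
      by (intro E) blast
    have "norm (E t z - E t0 z) \<le> 2 * (norm (E t0 z))\<^sup>2 * norm (?M t - ?M t0)"
      using E'(2) mutually_inverse_unique[OF Et E'(1)] by simp
    also have "\<dots> \<le> 2 * C\<^sup>2 * (B * delta t)"
      using C(2)[OF z] C(1) by (intro mult_mono n power_mono) auto
    finally show ?thesis
      using Et by (simp add: mult_ac)
  qed
  \<comment> \<open>\<open>c1 * delta t\<close> bounds the distance of the perturbation determinant, divided by \<open>mu\<close>, from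
    \<open>lambda - z\<close>\<close>
  define c1 where "c1 = B * c * (2 * C\<^sup>2 * B) * norm u"
  have c1: "0 \<le> c1"
    using B0 c(1) by (simp add: c1_def)
  define good where "good t \<longleftrightarrow> is_resolvent (L t) z0 (K t) \<and> B * C * delta t < 1 / 2 \<and> c1 * delta t < r / 16" for t
  define ev where "ev t = (THE z. Spec (L t) \<inter> ball lambda r = {z})" for t
  define e where "e t = E t (ev t) u" for t
  have main: "Spec (L t) \<inter> ball lambda r = {ev t} \<and> isolated_simple_eigenvalue (L t) (ev t)
      \<and> (e t, ev t *\<^sub>C e t) \<in> L t \<and> cmod (ev t - lambda) \<le> c1 * delta t
      \<and> norm (e t - u) \<le> 2 * C\<^sup>2 * B * delta t * norm u" if t: "good t" for t
  proof -
    have inv_t: "mutually_inverse (pencil z0 (K t - mu *\<^sub>C Pr) z) (E t z)"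
        "norm (E t z - E t0 z) \<le> 2 * C\<^sup>2 * B * delta t" if "z \<in> ball lambda r" for z
      using inv[of z t] that t by (auto simp: good_def)
    interpret d: deflated z0 "K t" mu Pr "ball lambda r" "E t" "L t" phi u
      by unfold_locales (use t in \<open>auto simp: good_def intro: cb inv_t(1) phi Pr phi_u\<close>)
    have Eu: "norm (E t z u - u) \<le> 2 * C\<^sup>2 * B * delta t * norm u" if z: "z \<in> ball lambda r" for z
    proof -
      have "E t z u - u = (E t z - E t0 z) u"
        using E0u[of z] z r by (simp add: blinfun.diff_left)
      then have "norm (E t z u - u) \<le> norm (E t z - E t0 z) * norm u"
        by (simp add: norm_blinfun)
      also have "\<dots> \<le> 2 * C\<^sup>2 * B * delta t * norm u"
        by (intro mult_right_mono inv_t(2) z) simp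
      finally show ?thesis .
    qed
    define g where "g z = - (z - z0) * (phi (E t z u) - 1)" for z
    have g: "d.pert_det z = mu * (lambda + g z - z)" for z
    proof -
      have "(lambda - z0) * mu = 1"
        using lz by (simp add: mu_def)
      then have "mu * lambda = 1 + mu * z0"
        by (simp add: algebra_simps)
      then show ?thesis
        by (simp add: d.pert_det_def g_def algebra_simps)
    qed
    have g_hol: "g holomorphic_on ball lambda r"
      unfolding g_def by (intro holomorphic_intros d.holomorphic_E phi)
    have g_le: "cmod (g z) \<le> c1 * delta t" if z: "z \<in> ball lambda r" for z
    proof -
      have "cmod (phi (E t z u) - 1) \<le> c * norm (E t z u - u)"
        using c(2)[of "E t z u - u"] by (simp add: phis phi_u)
      also have "\<dots> \<le> c * (2 * C\<^sup>2 * B * delta t * norm u)"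
        using c(1) by (intro mult_left_mono Eu z) simp
      finally have "cmod (z - z0) * cmod (phi (E t z u) - 1) \<le> B * (c * (2 * C\<^sup>2 * B * delta t * norm u))"
        using z B0 by (intro mult_mono B) auto
      then show ?thesis
        by (simp add: g_def norm_mult c1_def mult_ac norm_minus_commute)
    qed
    have g_small: "cmod (g z) < r / 16" if "z \<in> ball lambda r" for z
      using g_le[OF that] t by (simp add: good_def)
    obtain z1 where z1: "z1 \<in> ball lambda r" "lambda + g z1 = z1"
      and only: "\<And>z. z \<in> ball lambda r \<Longrightarrow> lambda + g z = z \<Longrightarrow> z = z1" and dg: "cmod (deriv g z1) < 1"
      using perturbed_simple_zero[OF r g_hol g_small] by blast
    have det_iff: "d.pert_det z = 0 \<longleftrightarrow> lambda + g z = z" for z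
      using mu by (simp add: g)
    have "(g has_field_derivative deriv g z1) (at z1)"
      using holomorphic_derivI[OF g_hol _ z1(1)] by simp
    then have "((\<lambda>z. mu * (lambda + g z - z)) has_field_derivative mu * (deriv g z1 - 1)) (at z1)"
      by (auto intro!: derivative_eq_intros)
    then have d_det: "(d.pert_det has_field_derivative mu * (deriv g z1 - 1)) (at z1)"
      unfolding ext[of d.pert_det "\<lambda>z. mu * (lambda + g z - z)", OF g] .
    have d_nz: "mu * (deriv g z1 - 1) \<noteq> 0"
      using mu dg by auto
    have only': "z = z1" if "z \<in> ball lambda r" "d.pert_det z = 0" for z
      using only[OF that(1)] that(2) by (simp only: det_iff)
    have z1': "d.pert_det z1 = 0"
      using z1(2) by (simp only: det_iff)
    have simple_t: "isolated_simple_eigenvalue (L t) z1"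
      by (rule d.simple_zero_imp_simple_eigenvalue(2)[OF open_ball connected_ball z1(1) z1' only' d_det d_nz])
    have "Spec (L t) \<inter> ball lambda r = {z1}"
      using d.Spec_iff z1(1) z1' only' by blast
    then have spec: "ev t = z1" "Spec (L t) \<inter> ball lambda r = {ev t}"
      by (auto simp: ev_def)
    have "e t \<in> op_kernel (op_shift (L t) z1)"
      unfolding d.eigenspace(1)[OF z1(1) z1'] e_def spec(1) by (simp add: complex_vector.span_base)
    moreover have "cmod (z1 - lambda) \<le> c1 * delta t"
      using g_le[OF z1(1)] z1(2) by (metis add_diff_cancel_left')
    ultimately show ?thesis
      using spec simple_t Eu[OF z1(1)] by (simp add: op_kernel_shift_iff e_def)
  qed
  have lim: "(delta \<longlongrightarrow> 0) (at t0)"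
    unfolding delta_def using tendsto_norm_zero[OF LIM_zero[OF cont]] .
  have lim_c: "((\<lambda>t. k * delta t) \<longlongrightarrow> 0) (at t0)" for k
    using tendsto_mult_right_zero[OF lim, of k] .
  have delta0: "delta t0 = 0"
    by (simp add: delta_def)
  have small: "\<forall>\<^sub>F t in nhds t0. k * delta t < s" if "0 < s" for k s
    using order_tendstoD(2)[OF lim_c that, of k] that by (simp add: eventually_nhds_conv_at delta0)
  have good: "\<forall>\<^sub>F t in nhds t0. good t"
    unfolding good_def using r by (intro eventually_conj res small) auto
  then have good_at: "\<forall>\<^sub>F t in at t0. good t"
    by (simp add: eventually_nhds_conv_at)
  have "lambda \<in> Spec (L t0) \<inter> ball lambda r"
    using simple r by (auto simp: isolated_simple_eigenvalue_def isolated_in_def)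
  then have ev0: "ev t0 = lambda"
    using main[OF eventually_nhds_x_imp_x[OF good]] by auto
  show thesis
  proof (rule that[of phi u ev e, OF allI[OF riesz_phi] phi phi_u surj conjunct1[OF riesz0] conjunct2[OF riesz0] ker0 _ ev0])
    show "\<forall>\<^sub>F t in nhds t0. Spec (L t) \<inter> ball lambda r = {ev t} \<and> isolated_simple_eigenvalue (L t) (ev t)
       \<and> (e t, ev t *\<^sub>C e t) \<in> L t"
      using good by (rule eventually_mono) (use main in blast)
    have "((\<lambda>t. ev t - lambda) \<longlongrightarrow> 0) (at t0)"
      by (rule Lim_null_comparison[OF _ lim_c[of c1]], rule eventually_mono[OF good_at]) (use main in blast)
    then show "(ev \<longlongrightarrow> lambda) (at t0)"
      by (simp add: LIM_zero_iff)
    have "((\<lambda>t. e t - u) \<longlongrightarrow> 0) (at t0)"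
    proof (rule Lim_null_comparison[OF _ lim_c[of "2 * C\<^sup>2 * B * norm u"]], rule eventually_mono[OF good_at])
      show "norm (e t - u) \<le> 2 * C\<^sup>2 * B * norm u * delta t" if "good t" for t
        using main[OF that] by (simp add: mult_ac)
    qed
    then show "(e \<longlongrightarrow> u) (at t0)"
      by (simp add: LIM_zero_iff)
  qed
qed

section \<open>The block operator and Green's identity\<close>

lemma tau_apply [simp]: "\<tau> (a, b) = (b, a)"
  by (simp add: \<tau>_def)

lemma tau_eq: "\<tau> p = (snd p, fst p)"
  by (cases p) simp

lemma tau_simps: "\<tau> (p + q) = \<tau> p + \<tau> q" "\<tau> (p - q) = \<tau> p - \<tau> q" "\<tau> (c *\<^sub>C p) = c *\<^sub>C \<tau> p" "\<tau> 0 = 0"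
  "\<tau> (\<tau> p') = p'"
  for p q :: "'h::complex_vector \<times> 'h"
  by (auto simp: tau_eq scaleC_prod_def zero_prod_def)

lemma norm_tau [simp]: "norm (\<tau> p) = norm p" for p :: "'h::complex_inner \<times> 'h"
  by (simp add: tau_eq norm_prod_def add.commute)

lemma cinner_tau: "cinner (\<tau> p) q = cinner p (\<tau> q)" for p :: "'h::complex_inner \<times> 'h"
  by (simp add: tau_eq cinner_prod_def add.commute)

lemma Omega_eq: "\<Omega> p q = \<omega> (fst p) (fst q) - \<omega> (snd p) (snd q)"
  by (cases p; cases q) (simp add: \<Omega>_def \<omega>_def JJ_def cinner_prod_def cinner_minus_left)

lemma omega_eq: "\<omega> p q = cinner (snd p) (fst q) - cinner (fst p) (snd q)"
  by (cases p; cases q) (simp add: \<omega>_def J_def cinner_prod_def cinner_minus_left)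

lemma norm_J: "norm (J p) = norm p" for p :: "'k::complex_inner \<times> 'k"
  by (cases p) (simp add: J_def norm_prod_def add.commute)

lemma norm_JJ: "norm (JJ p) = norm p" for p :: "('k::complex_inner \<times> 'k) \<times> ('k \<times> 'k)"
  by (cases p) (simp add: JJ_def norm_Pair norm_J)

lemma norm_Omega_le: "cmod (\<Omega> p q) \<le> norm p * norm q"
  unfolding \<Omega>_def by (rule order_trans[OF complex_Cauchy_Schwarz]) (simp add: norm_JJ)

lemma Omega_bounded_bilinear:
  "bounded_bilinear (\<Omega> :: ('k::complex_inner \<times> 'k) \<times> ('k \<times> 'k) \<Rightarrow> _)"
proof
  show "\<exists>K. \<forall>a b. norm (\<Omega> a b) \<le> norm a * norm (b :: ('k \<times> 'k) \<times> ('k \<times> 'k)) * K"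
    by (intro exI[of _ 1] allI) (simp only: mult_1_right norm_Omega_le)
qed (simp_all add: Omega_eq omega_eq cinner_simps cinner_scaleR scaleR_conv_of_real algebra_simps)

lemmas tendsto_Omega = bounded_bilinear.tendsto[OF Omega_bounded_bilinear]

lemmas Omega_diff_left = bounded_bilinear.diff_left[OF Omega_bounded_bilinear]
lemmas Omega_diff_right = bounded_bilinear.diff_right[OF Omega_bounded_bilinear]

text \<open>The domain and the action of the block operator without boundary conditions.\<close>

definition max_dom :: "('h::complex_inner \<times> 'h) set \<Rightarrow> ('h \<times> 'h) set"
  where "max_dom A = Domain (op_adjoint A) \<times> Domain (op_adjoint A)"

definition max_op :: "('h::complex_inner \<times> 'h) set \<Rightarrow> 'h \<times> 'h \<Rightarrow> 'h \<times> 'h"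
  where "max_op A p = (- op_apply (op_adjoint A) (snd p), op_apply (op_adjoint A) (fst p))"

lemma graph_norm2_eq: "graph_norm2 (op_adjoint A) p = norm (p, max_op A p)"
  for A :: "('h::complex_inner \<times> 'h) set"
proof -
  have "graph_norm (op_adjoint A) x ^ 2 = (norm x)\<^sup>2 + (norm (op_apply (op_adjoint A) x))\<^sup>2" for x :: 'h
    by (simp add: graph_norm_def graph_cinner_def cinner_norm del: of_real_power)
  then show ?thesis
    by (simp add: graph_norm2_def norm_prod_def max_op_def add_ac)
qed

lemma graph_norm2_le: "graph_norm2 (op_adjoint A) p \<le> norm p + norm (max_op A p)"
  unfolding graph_norm2_eq by (rule norm_Pair_le)

lemma op_apply_adjoint:
  fixes A :: "('h::complex_inner \<times> 'h) set"
  assumes dense: "densely_defined A" and xy: "(x, y) \<in> op_adjoint A"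
  shows "op_apply (op_adjoint A) x = y"
  unfolding op_apply_def
proof (rule the_equality, rule xy)
  fix y' assume "(x, y') \<in> op_adjoint A"
  then have "cinner u (y' - y) = 0" if "u \<in> Domain A" for u
    using xy that by (fastforce simp: op_adjoint_def cinner_diff_right)
  then have "Domain A \<subseteq> {u. cinner u (y' - y) = 0}" by blast
  moreover have "closed {u. cinner u (y' - y) = 0}"
    by (intro closed_Collect_eq continuous_intros linear_continuous_on bounded_linear_cinner_left)
  ultimately have "closure (Domain A) \<subseteq> {u. cinner u (y' - y) = 0}"
    by (rule closure_minimal)
  then have "cinner (y' - y) (y' - y) = 0"
    using dense by (auto simp: densely_defined_def simp del: cinner_self_zero)
  then show "y' = y" by simp
qed

lemma op_adjoint_linear:
  "(x, y) \<in> op_adjoint A \<Longrightarrow> (x', y') \<in> op_adjoint A \<Longrightarrow> (x - x', y - y') \<in> op_adjoint A"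
  by (fastforce simp: op_adjoint_def cinner_diff_right)

lemma max_op_diff:
  assumes "densely_defined A" "p \<in> max_dom A" "q \<in> max_dom A"
  shows "p - q \<in> max_dom A" "max_op A (p - q) = max_op A p - max_op A q"
proof -
  obtain a b c d where ab: "(fst p, a) \<in> op_adjoint A" "(snd p, b) \<in> op_adjoint A"
      "(fst q, c) \<in> op_adjoint A" "(snd q, d) \<in> op_adjoint A"
    using assms by (cases p; cases q) (auto simp: max_dom_def)
  note diff = op_adjoint_linear[OF ab(1,3)] op_adjoint_linear[OF ab(2,4)]
  show "p - q \<in> max_dom A"
    using diff by (auto simp: max_dom_def mem_Times_iff)
  show "max_op A (p - q) = max_op A p - max_op A q"
    using ab diff by (simp add: max_op_def op_apply_adjoint[OF assms(1)])
qed

locale block_boundary_problem =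
  fixes A :: "('h::chilbert_space \<times> 'h) set" and tr :: "'h \<Rightarrow> 'k::chilbert_space \<times> 'k"
    and P Q :: "('k \<times> 'k) \<Rightarrow>\<^sub>L ('k \<times> 'k)" and \<A> \<B> :: "('h \<times> 'h) set" and F G :: "'h \<Rightarrow>\<^sub>L 'h"
  assumes dense: "densely_defined A"
    and trace: "abstract_trace (op_adjoint A) tr"
    and P: "orthogonal_projection P \<and> Lagrangian (range P)"
    and Q: "orthogonal_projection Q \<and> Lagrangian (range Q)"
    and opA: "self_adjoint_operator \<A> \<and> A \<subseteq> \<A> \<and> tr ` Domain \<A> = range P"
    and opB: "self_adjoint_operator \<B> \<and> A \<subseteq> \<B> \<and> tr ` Domain \<B> = range Q"
    and FG: "bounded_self_adjoint F \<and> bounded_self_adjoint G"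
begin

abbreviation T where "T \<equiv> map_prod tr tr"
abbreviation V where "V \<equiv> antidiag_bounded F G"
abbreviation L where "L \<equiv> op_add_bounded (antidiag_op \<A> \<B>) V"
abbreviation PQ where "PQ \<equiv> map_prod (blinfun_apply P) (blinfun_apply Q)"

lemma V_apply: "V p = (- G (snd p), F (fst p))"
  by (simp add: antidiag_bounded.rep_eq)

lemma L_iff: "(p, q) \<in> L \<longleftrightarrow> (\<exists>a b. (fst p, a) \<in> \<A> \<and> (snd p, b) \<in> \<B> \<and> q = (- b, a) + V p)"
  by (cases p) (auto simp: op_add_bounded_def antidiag_op_def)

lemma extension_subset: "\<A> \<subseteq> op_adjoint A" "\<B> \<subseteq> op_adjoint A"
proof -
  have "op_adjoint \<A> \<subseteq> op_adjoint A" "op_adjoint \<B> \<subseteq> op_adjoint A"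
    using opA opB by (auto simp: op_adjoint_def)
  then show "\<A> \<subseteq> op_adjoint A" "\<B> \<subseteq> op_adjoint A"
    using opA opB by (auto simp: self_adjoint_operator_def)
qed

lemma L_elem:
  assumes "(p, q) \<in> L"
  shows "p \<in> max_dom A" and "q = max_op A p + V p" and "PQ (T p) = T p"
proof -
  obtain a b where ab: "(fst p, a) \<in> \<A>" "(snd p, b) \<in> \<B>" "q = (- b, a) + V p"
    using assms L_iff by blast
  then have adj: "(fst p, a) \<in> op_adjoint A" "(snd p, b) \<in> op_adjoint A"
    using extension_subset by auto
  then show "p \<in> max_dom A"
    by (auto simp: max_dom_def mem_Times_iff)
  show "q = max_op A p + V p"
    using adj ab(3) by (simp add: max_op_def op_apply_adjoint[OF dense])
  have PP: "P (P x) = P x" "Q (Q x) = Q x" for x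
    using P Q by (auto simp: orthogonal_projection_def simp flip: blinfun_apply_blinfun_compose)
  have "tr (fst p) \<in> range P" "tr (snd p) \<in> range Q"
    using opA opB ab by (metis Domain.intros imageI)+
  then show "PQ (T p) = T p"
    by (cases p) (auto simp: PP)
qed

text \<open>The two components contribute Green's identity of \<open>A\<^sup>*\<close> with opposite signs, which is the sign in
\<open>J \<oplus> (- J)\<close>.\<close>

lemma green:
  assumes "p \<in> max_dom A" "q \<in> max_dom A"
  shows "cinner (max_op A p) (\<tau> q) - cinner p (\<tau> (max_op A q)) = \<Omega> (T p) (T q)"
proof -
  have g: "cinner (op_apply (op_adjoint A) u) v - cinner u (op_apply (op_adjoint A) v) = \<omega> (tr u) (tr v)"
    if "u \<in> Domain (op_adjoint A)" "v \<in> Domain (op_adjoint A)" for u v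
    using trace that by (simp add: abstract_trace_def omega_eq)
  have "fst p \<in> Domain (op_adjoint A)" "snd p \<in> Domain (op_adjoint A)"
      "fst q \<in> Domain (op_adjoint A)" "snd q \<in> Domain (op_adjoint A)"
    using assms by (auto simp: max_dom_def mem_Times_iff)
  then have "\<Omega> (T p) (T q) =
     (cinner (op_apply (op_adjoint A) (fst p)) (fst q) - cinner (fst p) (op_apply (op_adjoint A) (fst q))) -
     (cinner (op_apply (op_adjoint A) (snd p)) (snd q) - cinner (snd p) (op_apply (op_adjoint A) (snd q)))"
    by (cases p; cases q) (simp add: g Omega_eq)
  then show ?thesis
    by (simp add: max_op_def tau_eq cinner_prod_def cinner_minus_left cinner_minus_right)
qed

lemma isotropic: "\<Omega> (PQ x) (PQ y) = 0"
proof -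
  have "\<omega> f g = 0" if "Lagrangian R" "f \<in> R" "g \<in> R" for R and f g :: "'k \<times> 'k"
    using that unfolding Lagrangian_def by blast
  then have "\<omega> (P a) (P b) = 0" "\<omega> (Q a) (Q b) = 0" for a b
    using P Q by blast+
  then show ?thesis
    by (cases x; cases y) (simp add: Omega_eq)
qed

lemma V_symmetric: "cinner (V p) (\<tau> q) = cinner p (\<tau> (V q))"
  using FG by (simp add: V_apply tau_eq cinner_prod_def cinner_minus_left cinner_minus_right
      bounded_self_adjoint_def)

lemma L_symmetric:
  assumes "(p, q) \<in> L" "(p', q') \<in> L"
  shows "cinner q (\<tau> p') = cinner p (\<tau> q')"
proof -
  have "\<Omega> (T p) (T p') = 0"
    using isotropic[of "T p" "T p'"] L_elem(3)[OF assms(1)] L_elem(3)[OF assms(2)] by simp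
  then show ?thesis
    using green[OF L_elem(1)[OF assms(1)] L_elem(1)[OF assms(2)]] V_symmetric[of p p']
      L_elem(2)[OF assms(1)] L_elem(2)[OF assms(2)] by (simp add: cinner_add_left cinner_add_right tau_simps)
qed

text \<open>The vector \<open>w\<close> is the adjoint resolvent applied to \<open>y\<close>. Testing with elements of the domain that have
one component 0 shows that its components lie in the domains of the adjoints of \<open>\<A>\<close> and \<open>\<B>\<close>,
in exchanged order. Self-adjointness turns this into \<open>\<tau> w\<close> being in the domain of \<open>L\<close>: the
adjoint of \<open>L\<close> is \<open>\<tau> L \<tau>\<close>.\<close>

lemma resolvent_adjoint:
  assumes K: "is_resolvent L z K" and w: "\<And>x. cinner (K x) y = cinner x w"
  shows "(\<tau> w, \<tau> (y + cnj z *\<^sub>C w)) \<in> L"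
proof -
  define q where "q = y + cnj z *\<^sub>C w"
  have adj: "cinner p' w = cinner p q" if "(p, p') \<in> L" for p p'
  proof -
    have "cinner p y = cinner (p' - z *\<^sub>C p) w"
      using is_resolventD(1)[OF K, of p p'] that w by metis
    then show ?thesis
      by (simp add: q_def cinner_simps)
  qed
  have "0 \<in> \<A>" "0 \<in> \<B>"
    using opA opB unfolding self_adjoint_operator_def linear_operator_def
    by (auto intro: complex_vector.subspace_0)
  then have zA: "(0, 0) \<in> \<A>" and zB: "(0, 0) \<in> \<B>"
    by (simp_all add: zero_prod_def)
  have FGs: "cinner (F x) x' = cinner x (F x')" "cinner (G x) x' = cinner x (G x')" for x x'
    using FG by (auto simp: bounded_self_adjoint_def)
  have "cinner a (snd w) = cinner u (fst q - F (snd w))" if "(u, a) \<in> \<A>" for u a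
  proof -
    have "((u, 0), (- 0, a) + V (u, 0)) \<in> L"
      using that zB unfolding L_iff fst_conv snd_conv by blast
    from adj[OF this] show ?thesis
      by (simp add: V_apply cinner_prod_def cinner_simps FGs eq_diff_eq)
  qed
  then have "(snd w, fst q - F (snd w)) \<in> op_adjoint \<A>"
    by (auto simp: op_adjoint_def)
  then have wA: "(snd w, fst q - F (snd w)) \<in> \<A>"
    using opA by (simp add: self_adjoint_operator_def)
  have "cinner b (fst w) = cinner v (- snd q - G (fst w))" if "(v, b) \<in> \<B>" for v b
  proof -
    have "((0, v), (- b, 0) + V (0, v)) \<in> L"
      using that zA unfolding L_iff fst_conv snd_conv by blast
    from adj[OF this] have "- cinner b (fst w) = cinner v (snd q) + cinner v (G (fst w))"
      by (simp add: V_apply cinner_prod_def cinner_simps FGs algebra_simps)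
    then have "cinner b (fst w) = - (cinner v (snd q) + cinner v (G (fst w)))"
      by (metis minus_minus)
    then show ?thesis
      by (simp add: cinner_simps)
  qed
  then have "(fst w, - snd q - G (fst w)) \<in> op_adjoint \<B>"
    by (auto simp: op_adjoint_def)
  then have wB: "(fst w, - snd q - G (fst w)) \<in> \<B>"
    using opB by (simp add: self_adjoint_operator_def)
  show ?thesis
    unfolding q_def[symmetric] L_iff
    by (rule exI[of _ "fst q - F (snd w)"], rule exI[of _ "- snd q - G (fst w)"])
       (simp add: wA wB tau_eq V_apply)
qed

lemma eigenvalue_reflection:
  assumes "(p, z *\<^sub>C p) \<in> L"
  shows "((fst p, - snd p), (- z) *\<^sub>C (fst p, - snd p)) \<in> L"
proof -
  obtain a b where ab: "(fst p, a) \<in> \<A>" "(snd p, b) \<in> \<B>" "z *\<^sub>C p = (- b, a) + V p"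
    using assms L_iff by blast
  have "(- 1) *\<^sub>C (snd p, b) \<in> \<B>"
    using opB ab(2) complex_vector.subspace_scale unfolding self_adjoint_operator_def linear_operator_def by blast
  then have "(- snd p, - b) \<in> \<B>"
    by (simp add: scaleC_prod_def scaleC_minus_left)
  moreover have "(- z) *\<^sub>C (fst p, - snd p) = (b, a) + V (fst p, - snd p)"
    using ab(3) by (simp add: prod_eq_iff scaleC_prod_def V_apply scaleC_minus_left scaleC_minus_right blinfun.minus_right)
  ultimately show ?thesis
    unfolding L_iff using ab(1) by (intro exI[of _ a] exI[of _ "- b"]) simp
qed

end

section \<open>Stability of the resolvent\<close>

text \<open>The bound by \<open>K\<close> makes the supremum in \<open>onorm_on\<close> finite. Where \<open>N x = 0\<close> it forces
\<open>f x = 0\<close>, in accordance with division by 0.\<close>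

lemma onorm_on_bound:
  assumes x: "x \<in> D" and N: "\<And>x. x \<in> D \<Longrightarrow> 0 \<le> N x" and K: "\<And>x. x \<in> D \<Longrightarrow> norm (f x) \<le> N x * K"
  shows "norm (f x) \<le> onorm_on D N f * N x"
proof (cases "N x = 0")
  case True
  then show ?thesis using K[OF x] by simp
next
  case False
  have "bdd_above ((\<lambda>x. norm (f x) / N x) ` D)"
  proof (rule bdd_aboveI2)
    fix y assume y: "y \<in> D"
    show "norm (f y) / N y \<le> \<bar>K\<bar>"
    proof (cases "N y = 0")
      case False
      have "K * N y \<le> \<bar>K\<bar> * N y"
        by (intro mult_right_mono abs_ge_self N y)
      then have "norm (f y) \<le> \<bar>K\<bar> * N y"
        using K[OF y] by (simp add: mult.commute)
      then show ?thesis
        using False N[OF y] by (simp add: divide_le_eq)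
    qed simp
  qed
  then have "norm (f x) / N x \<le> onorm_on D N f"
    unfolding onorm_on_def by (intro cSUP_upper x)
  then show ?thesis
    using False N[OF x] by (simp add: divide_le_eq)
qed

lemma norm_map_prod_le:
  assumes "\<And>x. norm (f x) \<le> c * norm x" "\<And>x. norm (g x) \<le> c * norm x" "0 \<le> c"
  shows "norm (map_prod f g p) \<le> c * norm p"
proof -
  have "norm (map_prod f g p) = sqrt ((norm (f (fst p)))\<^sup>2 + (norm (g (snd p)))\<^sup>2)"
    by (cases p) (simp add: norm_Pair)
  also have "\<dots> \<le> sqrt ((c * norm (fst p))\<^sup>2 + (c * norm (snd p))\<^sup>2)"
    by (intro real_sqrt_le_mono add_mono power_mono assms) simp_all
  also have "\<dots> = c * norm p"
    using assms(3) by (simp add: norm_prod_def power_mult_distrib real_sqrt_mult flip: distrib_left)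
  finally show ?thesis .
qed

lemma graph_norm2_nonneg: "0 \<le> graph_norm2 (op_adjoint A) p" for A :: "('h::complex_inner \<times> 'h) set"
  by (simp add: graph_norm2_eq)

text \<open>Let \<open>b = K0 x\<close> and \<open>y = (K1 - K0) x\<close>, let \<open>w\<close> be the adjoint of \<open>K1\<close> applied to \<open>y\<close>, and \<open>d = \<tau> w\<close>, an
element of the domain of the second operator. Green's identity between \<open>b\<close> and \<open>d\<close> expresses
\<open>\<langle>y, y\<rangle>\<close> through \<open>V1 - V0\<close> and the boundary term of \<open>b\<close> and \<open>d\<close>; the latter is small since
\<open>T b\<close> nearly satisfies the second boundary condition. The graph norms of \<open>b\<close> and \<open>d\<close> are bounded by
\<open>norm x\<close> and \<open>(1 + norm K1) * norm y\<close>. The factor \<open>norm K1\<close> on the right is harmless as \<open>eta\<close> stands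
before it.\<close>

lemma resolvent_stability:
  fixes A :: "('h::chilbert_space \<times> 'h) set" and tr0 tr1 :: "'h \<Rightarrow> 'k::chilbert_space \<times> 'k"
  assumes bp0: "block_boundary_problem A tr0 P0 Q0 A0 B0 F0 G0"
    and bp1: "block_boundary_problem A tr1 P1 Q1 A1 B1 F1 G1"
  defines "V0 \<equiv> antidiag_bounded F0 G0" and "V1 \<equiv> antidiag_bounded F1 G1"
  assumes K0: "is_resolvent (op_add_bounded (antidiag_op A0 B0) V0) z K0"
    and K1: "is_resolvent (op_add_bounded (antidiag_op A1 B1) V1) z K1"
    and eta: "0 \<le> eta" "eta \<le> 1" and c: "0 \<le> c"
    and T0: "\<And>p. p \<in> max_dom A \<Longrightarrow> norm (map_prod tr0 tr0 p) \<le> c * graph_norm2 (op_adjoint A) p"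
    and T: "\<And>p. p \<in> max_dom A \<Longrightarrow>
      norm (map_prod tr1 tr1 p - map_prod tr0 tr0 p) \<le> eta * graph_norm2 (op_adjoint A) p"
    and V: "norm (V1 - V0) \<le> eta" and P: "norm (P1 - P0) \<le> eta" and Q: "norm (Q1 - Q0) \<le> eta"
  shows "norm (K1 - K0) \<le>
    (1 + norm K0 * (1 + cmod z + norm V0)) * (1 + (1 + c)\<^sup>2 * (2 + cmod z + norm V0)) * eta * (1 + norm K1)"
    (is "_ \<le> ?Cb * (1 + (1 + c)\<^sup>2 * ?Cc) * eta * _")
proof (rule norm_blinfun_bound)
  interpret b0: block_boundary_problem A tr0 P0 Q0 A0 B0 F0 G0 by (rule bp0)
  interpret b1: block_boundary_problem A tr1 P1 Q1 A1 B1 F1 G1 by (rule bp1)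
  let ?gn = "graph_norm2 (op_adjoint A)"
  have Cb: "0 \<le> ?Cb" and Cc: "0 \<le> ?Cc"
    by (simp_all add: add_nonneg_nonneg)
  show "0 \<le> ?Cb * (1 + (1 + c)\<^sup>2 * ?Cc) * eta * (1 + norm K1)"
    using eta Cb Cc by (intro mult_nonneg_nonneg add_nonneg_nonneg) auto
  fix x
  define b where "b = K0 x"
  define y where "y = (K1 - K0) x"
  have bL: "(b, x + z *\<^sub>C b) \<in> b0.L"
    using is_resolventD(3)[OF K0] by (simp add: b_def V0_def)
  have b_dom: "b \<in> max_dom A"
    by (rule b0.L_elem(1)[OF bL])
  have nb: "norm b \<le> norm K0 * norm x"
    unfolding b_def by (rule norm_blinfun)
  have max_b: "max_op A b = x + z *\<^sub>C b - V0 b"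
    using b0.L_elem(2)[OF bL] by (simp add: V0_def)
  have gb: "?gn b \<le> ?Cb * norm x"
  proof -
    have "norm (max_op A b) \<le> norm (x + z *\<^sub>C b) + norm (V0 b)"
      unfolding max_b by (rule norm_triangle_ineq4)
    also have "\<dots> \<le> norm x + cmod z * norm b + norm V0 * norm b"
      using norm_triangle_ineq[of x "z *\<^sub>C b"] norm_blinfun[of V0 b] by (simp add: norm_scaleC)
    finally have "?gn b \<le> norm x + (1 + cmod z + norm V0) * norm b"
      using graph_norm2_le[of A b] by (simp add: algebra_simps)
    also have "\<dots> \<le> norm x + (1 + cmod z + norm V0) * (norm K0 * norm x)"
      by (intro add_left_mono mult_left_mono nb) (simp add: add_nonneg_nonneg)
    finally show ?thesis by (simp add: algebra_simps)
  qed
  obtain w where w: "\<And>v. cinner (K1 v) y = cinner v w" and nw: "norm w \<le> norm K1 * norm y"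
    using adjoint_vector[OF is_resolventD(2)[OF K1]] by blast
  define d where "d = \<tau> w"
  have dL: "(d, \<tau> (y + cnj z *\<^sub>C w)) \<in> b1.L"
    unfolding d_def by (rule b1.resolvent_adjoint[OF _ w]) (use K1 in \<open>simp add: V1_def\<close>)
  have d_dom: "d \<in> max_dom A"
    by (rule b1.L_elem(1)[OF dL])
  have max_d: "max_op A d = \<tau> (y + cnj z *\<^sub>C w) - V1 d"
    using b1.L_elem(2)[OF dL] by (simp add: V1_def)
  have nd: "norm d = norm w"
    by (simp add: d_def)
  have nV1: "norm V1 \<le> 1 + norm V0"
    using V eta norm_triangle_ineq2[of V1 V0] by linarith
  have gd: "?gn d \<le> ?Cc * (1 + norm K1) * norm y"
  proof -
    have "norm (max_op A d) \<le> norm (y + cnj z *\<^sub>C w) + norm (V1 d)"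
      unfolding max_d using norm_triangle_ineq4[of "\<tau> (y + cnj z *\<^sub>C w)" "V1 d"] by simp
    also have "\<dots> \<le> norm y + cmod z * norm w + (1 + norm V0) * norm w"
      using norm_triangle_ineq[of y "cnj z *\<^sub>C w"] norm_blinfun[of V1 d] mult_right_mono[OF nV1, of "norm w"]
      by (simp add: norm_scaleC nd)
    finally have "?gn d \<le> norm y + ?Cc * norm w"
      using graph_norm2_le[of A d] by (simp add: nd algebra_simps)
    also have "\<dots> \<le> ?Cc * norm y + ?Cc * (norm K1 * norm y)"
      using nw mult_right_mono[of 1 ?Cc "norm y"] by (intro add_mono mult_left_mono Cc) simp_all
    finally show ?thesis by (simp add: algebra_simps)
  qed
  have gd0: "0 \<le> ?gn d" and gb0: "0 \<le> ?gn b"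
    by (rule graph_norm2_nonneg)+
  have nTd: "norm (b1.T d) \<le> (1 + c) * ?gn d"
  proof -
    have "norm (b1.T d) \<le> norm (b1.T d - b0.T d) + norm (b0.T d)"
      using norm_triangle_ineq[of "b1.T d - b0.T d" "b0.T d"] by simp
    also have "\<dots> \<le> eta * ?gn d + c * ?gn d"
      by (intro add_mono T T0 d_dom)
    also have "\<dots> \<le> 1 * ?gn d + c * ?gn d"
      using eta gd0 by (intro add_right_mono mult_right_mono) auto
    finally show ?thesis by (simp add: distrib_right)
  qed
  \<comment> \<open>Green's identity between \<open>b\<close> and \<open>d\<close> leaves only differences of the coefficients\<close>
  have key: "cinner y y = \<Omega> (b1.T b) (b1.T d) - cinner ((V1 - V0) b) w"
  proof -
    have y_eq: "y = \<tau> (max_op A d + V1 d) - cnj z *\<^sub>C w"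
      by (simp add: max_d tau_simps)
    have "cinner b y = cinner b (\<tau> (max_op A d)) + cinner b (\<tau> (V1 d)) - z * cinner b w"
      by (subst y_eq) (simp add: tau_simps cinner_simps)
    also have "cinner b (\<tau> (max_op A d)) = cinner (max_op A b) w - \<Omega> (b1.T b) (b1.T d)"
      using b1.green[OF b_dom d_dom] by (simp add: d_def tau_simps diff_eq_eq eq_diff_eq add.commute)
    also have "cinner b (\<tau> (V1 d)) = cinner (V1 b) w"
      using b1.V_symmetric[of b d] by (simp add: V1_def d_def tau_simps)
    finally have "cinner b y = cinner x w + cinner ((V1 - V0) b) w - \<Omega> (b1.T b) (b1.T d)"
      by (simp add: max_b cinner_simps blinfun.diff_left)
    moreover have "cinner (K1 x) y = cinner x w"
      by (rule w)
    ultimately show ?thesis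
      by (simp add: y_def b_def blinfun.diff_left cinner_diff_left)
  qed
  have Om: "cmod (\<Omega> (b1.T b) (b1.T d)) \<le> (1 + c) * eta * ?gn b * ((1 + c) * ?gn d)"
  proof -
    have "\<Omega> (b1.PQ (b0.T b)) (b1.T d) = 0"
      using b1.isotropic[of "b0.T b" "b1.T d"] b1.L_elem(3)[OF dL] by simp
    then have "\<Omega> (b1.T b) (b1.T d) = \<Omega> ((b1.T b - b0.T b) + (b0.T b - b1.PQ (b0.T b))) (b1.T d)"
      by (simp add: Omega_diff_left)
    then have "cmod (\<Omega> (b1.T b) (b1.T d)) \<le>
        norm ((b1.T b - b0.T b) + (b0.T b - b1.PQ (b0.T b))) * norm (b1.T d)"
      using norm_Omega_le by simp
    also have "\<dots> \<le> ((1 + c) * eta * ?gn b) * ((1 + c) * ?gn d)"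
    proof (rule mult_mono[OF _ nTd])
      have "b0.T b - b1.PQ (b0.T b) = b0.PQ (b0.T b) - b1.PQ (b0.T b)"
        using b0.L_elem(3)[OF bL] by simp
      also have "\<dots> = map_prod (P0 - P1) (Q0 - Q1) (b0.T b)"
        by (cases "b0.T b") (simp add: blinfun.diff_left)
      finally have eq: "b0.T b - b1.PQ (b0.T b) = map_prod (P0 - P1) (Q0 - Q1) (b0.T b)" .
      have bl: "norm (X v) \<le> eta * norm v" if "norm X \<le> eta" for X :: "('k \<times> 'k) \<Rightarrow>\<^sub>L ('k \<times> 'k)" and v
        by (rule order_trans[OF norm_blinfun]) (intro mult_right_mono that, simp)
      have "norm (b0.T b - b1.PQ (b0.T b)) \<le> eta * norm (b0.T b)"
        unfolding eq using P Q eta by (intro norm_map_prod_le bl) (simp_all add: norm_minus_commute)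
      also have "\<dots> \<le> eta * (c * ?gn b)"
        using eta by (intro mult_left_mono T0 b_dom)
      finally have "norm (b0.T b - b1.PQ (b0.T b)) \<le> eta * (c * ?gn b)" .
      with T[OF b_dom] show "norm ((b1.T b - b0.T b) + (b0.T b - b1.PQ (b0.T b))) \<le> (1 + c) * eta * ?gn b"
        using norm_triangle_ineq[of "b1.T b - b0.T b" "b0.T b - b1.PQ (b0.T b)"] by (simp add: algebra_simps)
      show "0 \<le> (1 + c) * eta * ?gn b"
        using c eta gb0 by simp
    qed simp
    finally show ?thesis .
  qed
  have "norm y * norm y = cmod (cinner y y)"
    by (simp add: cinner_norm norm_power power2_eq_square flip: of_real_mult)
  also have "\<dots> \<le> cmod (\<Omega> (b1.T b) (b1.T d)) + norm ((V1 - V0) b) * norm w"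
    unfolding key by (rule order_trans[OF norm_triangle_ineq4 add_left_mono[OF complex_Cauchy_Schwarz]])
  also have "\<dots> \<le> (1 + c) * eta * (?Cb * norm x) * ((1 + c) * (?Cc * (1 + norm K1) * norm y))
      + eta * (?Cb * norm x) * ((1 + norm K1) * norm y)"
  proof (rule add_mono)
    show "cmod (\<Omega> (b1.T b) (b1.T d)) \<le>
        (1 + c) * eta * (?Cb * norm x) * ((1 + c) * (?Cc * (1 + norm K1) * norm y))"
      using c eta gd0 gb0 Cb by (intro order_trans[OF Om] mult_mono gb gd) auto
    show "norm ((V1 - V0) b) * norm w \<le> eta * (?Cb * norm x) * ((1 + norm K1) * norm y)"
    proof (rule mult_mono)
      have "norm b \<le> ?gn b"
        by (simp add: graph_norm2_eq norm_prod_def)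
      then have "norm (V1 - V0) * norm b \<le> eta * (?Cb * norm x)"
        using gb eta by (intro mult_mono V) auto
      then show "norm ((V1 - V0) b) \<le> eta * (?Cb * norm x)"
        using norm_blinfun[of "V1 - V0" b] by linarith
      show "norm w \<le> (1 + norm K1) * norm y"
        using nw by (simp add: distrib_right add_increasing)
    qed (use eta Cb in auto)
  qed
  also have "\<dots> = norm y * (?Cb * (1 + (1 + c)\<^sup>2 * ?Cc) * eta * (1 + norm K1) * norm x)"
    by (simp add: algebra_simps power2_eq_square)
  finally have "norm y * norm y \<le> norm y * (?Cb * (1 + (1 + c)\<^sup>2 * ?Cc) * eta * (1 + norm K1) * norm x)" .
  moreover have "0 \<le> ?Cb * (1 + (1 + c)\<^sup>2 * ?Cc) * eta * (1 + norm K1) * norm x"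
    using eta Cb Cc by (intro mult_nonneg_nonneg add_nonneg_nonneg) auto
  ultimately have "norm y \<le> ?Cb * (1 + (1 + c)\<^sup>2 * ?Cc) * eta * (1 + norm K1) * norm x"
    by (cases "y = 0") (auto simp: mult_le_cancel_left)
  then show "norm ((K1 - K0) x) \<le> ?Cb * (1 + (1 + c)\<^sup>2 * ?Cc) * eta * (1 + norm K1) * norm x"
    by (simp add: y_def)
qed

section \<open>Real simple eigenvalues of the block operator\<close>

context block_boundary_problem
begin

text \<open>By symmetry \<open>\<tau> u\<close> is orthogonal to the range of \<open>L - \<lambda>\<close>, which contains \<open>ker \<phi>\<close>. If it were also orthogonal
to \<open>u\<close>, it would vanish.\<close>

lemma eigenvector_nondegenerate:
  assumes K: "is_resolvent L z0 K" and simple: "isolated_simple_eigenvalue L lambda"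
    and real: "lambda \<in> \<real>" and u: "(u, lambda *\<^sub>C u) \<in> L" "u \<noteq> 0"
  shows "cinner u (\<tau> u) \<noteq> 0"
proof
  assume 0: "cinner u (\<tau> u) = 0"
  obtain phi e where phi: "cfunctional phi" and ker: "\<And>x. (x, lambda *\<^sub>C x) \<in> L \<Longrightarrow> x = phi x *\<^sub>C e"
    and surj: "\<And>y. phi y = 0 \<Longrightarrow> \<exists>x. (x, lambda *\<^sub>C x + y) \<in> L"
    by (rule simple_eigenvalue_deflation[OF K simple]) blast
  have phi_u: "phi u \<noteq> 0"
    using ker[OF u(1)] u(2) by auto
  have "cinner x (\<tau> u) = cinner 0 (\<tau> u)" for x
  proof -
    define y where "y = x - (phi x / phi u) *\<^sub>C u"
    have "phi y = 0"
      using phi_u by (simp add: y_def cfunctional_simps[OF phi])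
    then obtain v where v: "(v, lambda *\<^sub>C v + y) \<in> L"
      using surj by blast
    have "cnj lambda = lambda"
      using real by (simp add: Reals_cnj_iff)
    then have "cinner y (\<tau> u) = 0"
      using L_symmetric[OF v u(1)] by (simp add: tau_simps cinner_simps)
    then show ?thesis
      by (simp add: y_def cinner_simps 0)
  qed
  then have "cinner (\<tau> u) (\<tau> u) = 0"
    by simp
  then have "norm (\<tau> u) = 0"
    by simp
  then show False
    using u(2) by simp
qed

text \<open>If \<open>(a, b)\<close> is an eigenvector for \<open>\<lambda>\<close>, then \<open>(a, - b)\<close> is one for \<open>- \<lambda>\<close>. For \<open>\<lambda> = 0\<close> both would
span the same line, so \<open>a = 0\<close> or \<open>b = 0\<close>, against the nondegeneracy of the eigenvector. This keeps the
distance of \<open>\<lambda>\<close> to the rest of the spectrum from being the default value 0 of \<open>infdist\<close>.\<close>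

lemma opposite_eigenvalue:
  assumes K: "is_resolvent L z0 K" and simple: "isolated_simple_eigenvalue L lambda" and real: "lambda \<in> \<real>"
  shows "- lambda \<in> Spec L - {lambda}"
proof -
  obtain phi e where phi: "cfunctional phi" and e: "(e, lambda *\<^sub>C e) \<in> L" "phi e = 1"
    and ker: "\<And>x. (x, lambda *\<^sub>C x) \<in> L \<Longrightarrow> x = phi x *\<^sub>C e"
    by (rule simple_eigenvalue_deflation[OF K simple]) blast
  have e0: "e \<noteq> 0"
    using e(2) cfunctional_simps(4)[OF phi] by auto
  define e' where "e' = (fst e, - snd e)"
  have e': "(e', (- lambda) *\<^sub>C e') \<in> L"
    unfolding e'_def by (rule eigenvalue_reflection[OF e(1)])
  have "lambda \<noteq> 0"
  proof
    assume "lambda = 0"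
    then have "e' = phi e' *\<^sub>C e"
      using ker[of e'] e' by simp
    then have c: "fst e = phi e' *\<^sub>C fst e" "- snd e = phi e' *\<^sub>C snd e"
      by (auto simp: e'_def scaleC_prod_def prod_eq_iff)
    have "cinner (fst e) (snd e) = 0"
    proof -
      have "cinner (fst e) (snd e) = phi e' * cinner (fst e) (snd e)"
        using arg_cong[OF c(1), of "\<lambda>x. cinner x (snd e)"] by (simp only: cinner_scaleC_left)
      then have "(1 - phi e') * cinner (fst e) (snd e) = 0"
        by (simp add: left_diff_distrib)
      moreover have m: "- cinner (snd e) (fst e) = phi e' * cinner (snd e) (fst e)"
        using arg_cong[OF c(2), of "\<lambda>x. cinner x (fst e)"] by (simp only: cinner_scaleC_left cinner_minus_left)
      then have "(1 + phi e') * cinner (snd e) (fst e) = 0"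
        by (simp add: distrib_right flip: m)
      ultimately have "phi e' = 1 \<and> phi e' = - 1 \<or> cinner (fst e) (snd e) = 0"
        using cinner_commute[of "snd e" "fst e"] by (auto simp: add_eq_0_iff)
      then show ?thesis by auto
    qed
    then have "cinner e (\<tau> e) = 0"
      using cinner_commute[of "snd e" "fst e"] by (simp add: tau_eq cinner_prod_def)
    with eigenvector_nondegenerate[OF K simple real e(1) e0] show False by simp
  qed
  moreover have "- lambda \<in> Spec L"
  proof (rule ccontr)
    assume "- lambda \<notin> Spec L"
    then have "is_resolvent L (- lambda) (resolvent L (- lambda))"
      by (rule is_resolvent_resolvent)
    from is_resolventD(1)[OF this, of e' "(- lambda) *\<^sub>C e'"] e' have "e' = 0"
      by simp
    then show False
      using e0 by (auto simp: e'_def prod_eq_iff)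
  qed
  ultimately show ?thesis by (simp add: eq_neg_iff_add_eq_0)
qed

lemma trace_diff:
  assumes "p \<in> max_dom A" "q \<in> max_dom A"
  shows "T (p - q) = T p - T q"
proof -
  have "tr (x - y) = tr x - tr y"
    if "x - y \<in> Domain (op_adjoint A)" "y \<in> Domain (op_adjoint A)" for x y
  proof -
    have "tr ((x - y) + y) = tr (x - y) + tr y"
      using trace that unfolding abstract_trace_def bounded_on_def by blast
    then show ?thesis by simp
  qed
  moreover have "p - q \<in> max_dom A"
    by (rule max_op_diff[OF dense assms])
  ultimately show ?thesis
    using assms(2) by (cases p; cases q) (auto simp: max_dom_def)
qed

lemma trace_scale: "p \<in> max_dom A \<Longrightarrow> T (c *\<^sub>C p) = c *\<^sub>C T p"
  using trace by (cases p) (auto simp: abstract_trace_def bounded_on_def max_dom_def scaleC_prod_def)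

lemma trace_bounded: "\<exists>c\<ge>0. \<forall>p\<in>max_dom A. norm (T p) \<le> c * graph_norm2 (op_adjoint A) p"
proof -
  obtain K where K: "\<And>x. x \<in> Domain (op_adjoint A) \<Longrightarrow> norm (tr x) \<le> graph_norm (op_adjoint A) x * K"
    using trace unfolding abstract_trace_def bounded_on_def by blast
  have g0: "0 \<le> graph_norm (op_adjoint A) x" for x
    by (simp add: graph_norm_def graph_cinner_def cinner_norm del: of_real_power)
  have K': "norm (tr x) \<le> \<bar>K\<bar> * graph_norm (op_adjoint A) x" if "x \<in> Domain (op_adjoint A)" for x
    using K[OF that] mult_left_mono[OF abs_ge_self g0[of x], of K] by (simp add: mult.commute)
  have "norm (T p) \<le> \<bar>K\<bar> * graph_norm2 (op_adjoint A) p" if "p \<in> max_dom A" for p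
  proof -
    have "norm (T p) = sqrt ((norm (tr (fst p)))\<^sup>2 + (norm (tr (snd p)))\<^sup>2)"
      by (cases p) (simp add: norm_Pair)
    also have "\<dots> \<le> sqrt ((\<bar>K\<bar> * graph_norm (op_adjoint A) (fst p))\<^sup>2 + (\<bar>K\<bar> * graph_norm (op_adjoint A) (snd p))\<^sup>2)"
      using that by (intro real_sqrt_le_mono add_mono power_mono K') (auto simp: max_dom_def mem_Times_iff)
    also have "\<dots> = \<bar>K\<bar> * graph_norm2 (op_adjoint A) p"
      by (simp add: graph_norm2_def power_mult_distrib real_sqrt_mult flip: distrib_left)
    finally show ?thesis .
  qed
  then show ?thesis
    by (intro exI[of _ "\<bar>K\<bar>"]) simp
qed

end

section \<open>Differentiable families\<close>

lemma J_J: "J (J f) = - f" for f :: "'k::ab_group_add \<times> 'k"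
  by (cases f) (simp add: J_def)

lemma J_linear: "J (f + g) = J f + J g" "J (f - g) = J f - J g" "J (r *\<^sub>R f) = r *\<^sub>R J f"
  for f g :: "'k::complex_inner \<times> 'k"
  by (cases f; cases g; simp add: J_def)+

text \<open>\<open>J\<close> exchanges a Lagrangian subspace and its orthogonal complement.\<close>

lemma Lagrangian_projection_J:
  fixes P :: "('k::complex_inner \<times> 'k) \<Rightarrow>\<^sub>L ('k \<times> 'k)"
  assumes "orthogonal_projection P" "Lagrangian (range P)"
  shows "P (J f) + J (P f) = J f"
proof -
  have PP: "P (P x) = P x" for x
    using assms(1) by (auto simp: orthogonal_projection_def simp flip: blinfun_apply_blinfun_compose)
  have sym: "cinner (P x) y = cinner x (P y)" for x y
    using assms(1) unfolding orthogonal_projection_def bounded_self_adjoint_def by blast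
  have range_iff: "x \<in> range P \<longleftrightarrow> (\<forall>y. cinner (J x) (P y) = 0)" for x
    using assms(2) unfolding Lagrangian_def \<omega>_def by blast
  have PJP: "P (J (P f)) = 0"
  proof (rule cinner_ext)
    fix y
    have "cinner (J (P f)) (P y) = 0"
      using range_iff[of "P f"] by blast
    then show "cinner (P (J (P f))) y = cinner 0 y"
      by (simp add: sym)
  qed
  have "J (f - P f) \<in> range P"
    unfolding range_iff by (simp add: J_J cinner_minus_left blinfun.diff_right PP flip: sym)
  then have "P (J (f - P f)) = J (f - P f)"
    using PP by auto
  then show ?thesis
    by (simp add: J_linear blinfun.diff_right PJP)
qed

lemma has_vector_derivative_iff_quotient:
  "(f has_vector_derivative D) (at x) \<longleftrightarrow> ((\<lambda>y. (f y - f x) /\<^sub>R (y - x)) \<longlongrightarrow> D) (at x)"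
proof -
  have "(f has_vector_derivative D) (at x) \<longleftrightarrow>
      ((\<lambda>y. norm (f y - f x - (y - x) *\<^sub>R D) / norm (y - x)) \<longlongrightarrow> 0) (at x)"
    by (simp add: has_vector_derivative_def has_derivative_iff_norm bounded_linear_scaleR_left)
  also have "\<dots> \<longleftrightarrow> ((\<lambda>y. norm ((f y - f x) /\<^sub>R (y - x) - D)) \<longlongrightarrow> 0) (at x)"
  proof (rule Lim_cong_within[OF refl refl refl])
    fix y assume "y \<noteq> x"
    then have "(f y - f x) /\<^sub>R (y - x) - D = (f y - f x - (y - x) *\<^sub>R D) /\<^sub>R (y - x)"
      by (simp add: scaleR_diff_right)
    then show "norm (f y - f x - (y - x) *\<^sub>R D) / norm (y - x) = norm ((f y - f x) /\<^sub>R (y - x) - D)"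
      by (simp add: divide_inverse mult.commute)
  qed
  also have "\<dots> \<longleftrightarrow> ((\<lambda>y. (f y - f x) /\<^sub>R (y - x)) \<longlongrightarrow> D) (at x)"
    by (simp add: tendsto_norm_zero_iff LIM_zero_iff)
  finally show ?thesis .
qed

locale differentiable_family =
  fixes A :: "('h::chilbert_space \<times> 'h) set" and tr :: "real \<Rightarrow> 'h \<Rightarrow> 'k::chilbert_space \<times> 'k"
    and P Q :: "real \<Rightarrow> ('k \<times> 'k) \<Rightarrow>\<^sub>L ('k \<times> 'k)" and \<A> \<B> :: "real \<Rightarrow> ('h \<times> 'h) set"
    and F G :: "real \<Rightarrow> 'h \<Rightarrow>\<^sub>L 'h" and t0 :: real
    and T' :: "'h \<times> 'h \<Rightarrow> ('k \<times> 'k) \<times> ('k \<times> 'k)" and V' :: "('h \<times> 'h) \<Rightarrow>\<^sub>L ('h \<times> 'h)"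
    and P' Q' :: "('k \<times> 'k) \<Rightarrow>\<^sub>L ('k \<times> 'k)"
  assumes problem: "\<And>t. t \<in> {0..1} \<Longrightarrow> block_boundary_problem A (tr t) (P t) (Q t) (\<A> t) (\<B> t) (F t) (G t)"
    and t0: "t0 \<in> {0<..<1}"
    and T': "has_operator_derivative_on (max_dom A) (graph_norm2 (op_adjoint A)) (\<lambda>t. map_prod (tr t) (tr t)) T' t0"
    and V': "((\<lambda>t. antidiag_bounded (F t) (G t)) has_vector_derivative V') (at t0)"
    and P': "(P has_vector_derivative P') (at t0)" and Q': "(Q has_vector_derivative Q') (at t0)"
begin

abbreviation T where "T t \<equiv> map_prod (tr t) (tr t)"
abbreviation V where "V t \<equiv> antidiag_bounded (F t) (G t)"
abbreviation L where "L t \<equiv> op_add_bounded (antidiag_op (\<A> t) (\<B> t)) (V t)"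
abbreviation PQ where "PQ t \<equiv> map_prod (blinfun_apply (P t)) (blinfun_apply (Q t))"
abbreviation gn where "gn \<equiv> graph_norm2 (op_adjoint A)"
abbreviation slope where "slope f t \<equiv> (f t - f t0) /\<^sub>R (t - t0)"

lemma t0_mem: "t0 \<in> {0..1}"
  using t0 by simp

lemma near_t0_unit: "\<forall>\<^sub>F t in nhds t0. t \<in> {0..1}"
  using t0 eventually_nhds_in_open[of "{0<..<1}" t0] by (auto elim: eventually_mono)

definition trace_error where
  "trace_error t = onorm_on (max_dom A) gn (\<lambda>p. (T t p - T t0 p) /\<^sub>R (t - t0) - T' p)"

lemma trace_error_lim: "(trace_error \<longlongrightarrow> 0) (at t0)"
  using T' by (simp add: has_operator_derivative_on_def trace_error_def[abs_def])

lemma trace_derivative_bounded: "\<exists>c\<ge>0. \<forall>p\<in>max_dom A. norm (T' p) \<le> c * gn p"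
proof -
  obtain K where K: "\<And>p. p \<in> max_dom A \<Longrightarrow> norm (T' p) \<le> gn p * K"
    using T' unfolding has_operator_derivative_on_def bounded_on_def by blast
  have "norm (T' p) \<le> \<bar>K\<bar> * gn p" if "p \<in> max_dom A" for p
    using K[OF that] mult_left_mono[OF abs_ge_self graph_norm2_nonneg[of A p], of K] by (simp add: mult.commute)
  then show ?thesis
    by (intro exI[of _ "\<bar>K\<bar>"]) simp
qed

lemma trace_slope:
  assumes t: "t \<in> {0..1}" and p: "p \<in> max_dom A"
  shows "norm ((T t p - T t0 p) /\<^sub>R (t - t0) - T' p) \<le> trace_error t * gn p"
proof -
  obtain c1 where c1: "\<And>p. p \<in> max_dom A \<Longrightarrow> norm (T t p) \<le> c1 * gn p"
    using block_boundary_problem.trace_bounded[OF problem[OF t]] by blast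
  obtain c0 where c0: "\<And>p. p \<in> max_dom A \<Longrightarrow> norm (T t0 p) \<le> c0 * gn p"
    using block_boundary_problem.trace_bounded[OF problem[OF t0_mem]] by blast
  obtain c2 where c2: "\<And>p. p \<in> max_dom A \<Longrightarrow> norm (T' p) \<le> c2 * gn p"
    using trace_derivative_bounded by blast
  have "norm ((T t p - T t0 p) /\<^sub>R (t - t0) - T' p) \<le> gn p * (\<bar>inverse (t - t0)\<bar> * (c1 + c0) + c2)"
    if p: "p \<in> max_dom A" for p
  proof -
    have "norm ((T t p - T t0 p) /\<^sub>R (t - t0) - T' p) \<le> \<bar>inverse (t - t0)\<bar> * norm (T t p - T t0 p) + norm (T' p)"
      using norm_triangle_ineq4[of "(T t p - T t0 p) /\<^sub>R (t - t0)" "T' p"] by simp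
    also have "\<dots> \<le> \<bar>inverse (t - t0)\<bar> * (c1 * gn p + c0 * gn p) + c2 * gn p"
      using norm_triangle_ineq4[of "T t p" "T t0 p"] c1[OF p] c0[OF p]
      by (intro add_mono mult_left_mono c2 p) auto
    finally show ?thesis
      by (simp add: algebra_simps)
  qed
  then show ?thesis
    unfolding trace_error_def by (rule onorm_on_bound[OF p graph_norm2_nonneg])
qed

lemma trace_has_derivative:
  assumes p: "p \<in> max_dom A"
  shows "((\<lambda>t. (T t p - T t0 p) /\<^sub>R (t - t0)) \<longlongrightarrow> T' p) (at t0)"
proof -
  have "((\<lambda>t. trace_error t * gn p) \<longlongrightarrow> 0 * gn p) (at t0)"
    by (intro tendsto_intros trace_error_lim)
  then have lim: "((\<lambda>t. trace_error t * gn p) \<longlongrightarrow> 0) (at t0)"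
    by simp
  have "\<forall>\<^sub>F t in at t0. norm ((T t p - T t0 p) /\<^sub>R (t - t0) - T' p) \<le> trace_error t * gn p"
    using near_t0_unit[unfolded eventually_nhds_conv_at, THEN conjunct1]
    by (rule eventually_mono) (rule trace_slope[OF _ p])
  from Lim_null_comparison[OF this lim]
  have "((\<lambda>t. (T t p - T t0 p) /\<^sub>R (t - t0) - T' p) \<longlongrightarrow> 0) (at t0)" .
  then show ?thesis
    by (simp add: LIM_zero_iff)
qed

definition coefficient_modulus :: "(real \<Rightarrow> real) \<Rightarrow> bool"
  where "coefficient_modulus eta \<longleftrightarrow> (eta \<longlongrightarrow> 0) (at t0) \<and>
    (\<forall>t\<in>{0..1}. 0 \<le> eta t \<and> norm (V t - V t0) \<le> eta t \<and> norm (P t - P t0) \<le> eta t \<and>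
      norm (Q t - Q t0) \<le> eta t \<and> (\<forall>p\<in>max_dom A. norm (T t p - T t0 p) \<le> eta t * gn p))"

lemma coefficient_modulusD:
  assumes "coefficient_modulus eta"
  shows "(eta \<longlongrightarrow> 0) (at t0)"
    and "t \<in> {0..1} \<Longrightarrow> 0 \<le> eta t" and "t \<in> {0..1} \<Longrightarrow> norm (V t - V t0) \<le> eta t"
    and "t \<in> {0..1} \<Longrightarrow> norm (P t - P t0) \<le> eta t" and "t \<in> {0..1} \<Longrightarrow> norm (Q t - Q t0) \<le> eta t"
    and "t \<in> {0..1} \<Longrightarrow> p \<in> max_dom A \<Longrightarrow> norm (T t p - T t0 p) \<le> eta t * gn p"
  using assms by (simp_all add: coefficient_modulus_def)

lemma coefficients_close: "\<exists>eta. coefficient_modulus eta"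
proof -
  obtain c where c: "c \<ge> 0" "\<And>p. p \<in> max_dom A \<Longrightarrow> norm (T' p) \<le> c * gn p"
    using trace_derivative_bounded by blast
  define eta where "eta t = norm (V t - V t0) + norm (P t - P t0) + norm (Q t - Q t0)
      + \<bar>t - t0\<bar> * (\<bar>trace_error t\<bar> + c)" for t
  have cont: "((\<lambda>t. f t - f t0) \<longlongrightarrow> 0) (at t0)" if "(f has_vector_derivative f') (at t0)"
    for f :: "real \<Rightarrow> 'b::real_normed_vector" and f'
    using has_vector_derivative_continuous[OF that] by (simp add: continuous_at LIM_zero)
  have "(eta \<longlongrightarrow> norm (0 :: ('h \<times> 'h) \<Rightarrow>\<^sub>L ('h \<times> 'h)) + norm (0 :: ('k \<times> 'k) \<Rightarrow>\<^sub>L ('k \<times> 'k))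
      + norm (0 :: ('k \<times> 'k) \<Rightarrow>\<^sub>L ('k \<times> 'k)) + \<bar>t0 - t0\<bar> * (\<bar>0\<bar> + c)) (at t0)"
    unfolding eta_def by (intro tendsto_intros trace_error_lim cont[OF V'] cont[OF P'] cont[OF Q'])
  then have lim: "(eta \<longlongrightarrow> 0) (at t0)"
    by simp
  have nn: "0 \<le> \<bar>t - t0\<bar> * (\<bar>trace_error t\<bar> + c)" for t
    using c(1) by simp
  have "norm (T t p - T t0 p) \<le> eta t * gn p" if t: "t \<in> {0..1}" and p: "p \<in> max_dom A" for t p
  proof (cases "t = t0")
    case True
    then show ?thesis
      using c(1) by (simp add: eta_def graph_norm2_nonneg)
  next
    case False
    let ?d = "(T t p - T t0 p) /\<^sub>R (t - t0)"
    have "norm ?d \<le> norm (?d - T' p) + norm (T' p)"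
      using norm_triangle_ineq[of "?d - T' p" "T' p"] by simp
    also have "\<dots> \<le> trace_error t * gn p + c * gn p"
      by (intro add_mono trace_slope[OF t p] c(2)[OF p])
    also have "\<dots> \<le> (\<bar>trace_error t\<bar> + c) * gn p"
      using mult_right_mono[OF abs_ge_self graph_norm2_nonneg, of "trace_error t" A p] by (simp add: distrib_right)
    finally have d: "norm ?d \<le> (\<bar>trace_error t\<bar> + c) * gn p" .
    have "norm (T t p - T t0 p) = \<bar>t - t0\<bar> * norm ?d"
      using False by simp
    also have "\<dots> \<le> \<bar>t - t0\<bar> * ((\<bar>trace_error t\<bar> + c) * gn p)"
      by (intro mult_left_mono d) simp
    also have "\<dots> \<le> eta t * gn p"
      using mult_right_mono[OF _ graph_norm2_nonneg, of "\<bar>t - t0\<bar> * (\<bar>trace_error t\<bar> + c)" "eta t" A p]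
      by (simp add: eta_def mult.assoc)
    finally show ?thesis .
  qed
  moreover have "0 \<le> eta t \<and> norm (V t - V t0) \<le> eta t \<and> norm (P t - P t0) \<le> eta t \<and> norm (Q t - Q t0) \<le> eta t" for t
    using nn[of t] norm_ge_zero[of "V t - V t0"] norm_ge_zero[of "P t - P t0"] norm_ge_zero[of "Q t - Q t0"]
    unfolding eta_def by linarith
  ultimately show ?thesis
    using lim unfolding coefficient_modulus_def by blast
qed

text \<open>For small \<open>eta\<close> the factor \<open>norm (K t)\<close> in the stability estimate is replaced by
\<open>norm (K t0) + norm (K t - K t0)\<close>, and the last summand is moved to the left-hand side.\<close>

theorem resolvent_continuous:
  assumes K: "\<forall>\<^sub>F t in nhds t0. is_resolvent (L t) z (K t)"
  shows "(K \<longlongrightarrow> K t0) (at t0)"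
proof -
  obtain eta where "coefficient_modulus eta"
    using coefficients_close by (rule exE)
  note eta = coefficient_modulusD[OF this]
  obtain c where c: "c \<ge> 0" "\<And>p. p \<in> max_dom A \<Longrightarrow> norm (T t0 p) \<le> c * gn p"
    using block_boundary_problem.trace_bounded[OF problem[OF t0_mem]] by blast
  have K0: "is_resolvent (L t0) z (K t0)"
    by (rule eventually_nhds_x_imp_x[OF K])
  define C where "C = (1 + norm (K t0) * (1 + cmod z + norm (V t0))) * (1 + (1 + c)\<^sup>2 * (2 + cmod z + norm (V t0)))"
  have est: "norm (K t - K t0) \<le> C * eta t * (1 + norm (K t))"
    if "is_resolvent (L t) z (K t)" "t \<in> {0..1}" "eta t \<le> 1" for t
    unfolding C_def using that eta c
    by (intro resolvent_stability[OF problem[OF t0_mem] problem[OF that(2)] K0 that(1) eta(2)[OF that(2)] that(3) c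
        eta(6)[OF that(2)] eta(3-5)[OF that(2)]])
  have lim: "((\<lambda>t. C * eta t) \<longlongrightarrow> 0) (at t0)" "((\<lambda>t. 2 * (C * eta t) * (1 + norm (K t0))) \<longlongrightarrow> 0) (at t0)"
    by (intro tendsto_mult_left_zero tendsto_mult_right_zero eta(1))+
  have "\<forall>\<^sub>F t in at t0. eta t < 1" "\<forall>\<^sub>F t in at t0. C * eta t < 1 / 2"
    using order_tendstoD(2)[OF eta(1), of 1] order_tendstoD(2)[OF lim(1), of "1 / 2"] by simp_all
  then have "\<forall>\<^sub>F t in at t0. norm (K t - K t0) \<le> 2 * (C * eta t) * (1 + norm (K t0))"
    using near_t0_unit[unfolded eventually_nhds_conv_at, THEN conjunct1] K[unfolded eventually_nhds_conv_at, THEN conjunct1]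
  proof eventually_elim
    case (elim t)
    then have half: "C * eta t \<le> 1 / 2" by simp
    have "norm (K t - K t0) \<le> C * eta t * (1 + norm (K t))"
      using elim by (intro est) auto
    also have "\<dots> \<le> C * eta t * (1 + (norm (K t0) + norm (K t - K t0)))"
      using norm_triangle_ineq[of "K t0" "K t - K t0"] c(1) eta(2)[OF elim(3)]
      by (intro mult_left_mono mult_nonneg_nonneg) (auto simp: C_def intro!: mult_nonneg_nonneg add_nonneg_nonneg)
    also have "\<dots> = C * eta t * (1 + norm (K t0)) + C * eta t * norm (K t - K t0)"
      by (simp add: algebra_simps)
    also have "\<dots> \<le> C * eta t * (1 + norm (K t0)) + 1 / 2 * norm (K t - K t0)"
      by (intro add_left_mono mult_right_mono half) simp
    finally show ?case by simp
  qed
  then have "((\<lambda>t. K t - K t0) \<longlongrightarrow> 0) (at t0)"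
    by (rule Lim_null_comparison[OF _ lim(2)])
  then show ?thesis by (simp add: LIM_zero_iff)
qed

text \<open>The boundary term \<open>\<Omega> (T t (e t)) (T t u)\<close> is split at \<open>T t0 u\<close>. Since \<open>T t (e t)\<close> is fixed by
\<open>PQ t\<close> and \<open>T t0 u\<close> by \<open>PQ t0\<close>, isotropy at \<open>t0\<close> turns the first part into
\<open>\<Omega> ((PQ t - PQ t0) (T t (e t))) (T t0 u)\<close>. All parts are then difference quotients.\<close>

theorem eigenvalue_derivative:
  assumes pair: "\<forall>\<^sub>F t in at t0. (e t, ev t *\<^sub>C e t) \<in> L t"
    and e: "(e \<longlongrightarrow> u) (at t0)" and ev: "(ev \<longlongrightarrow> lambda) (at t0)"
    and ev0: "ev t0 = lambda" and u: "(u, lambda *\<^sub>C u) \<in> L t0" and real: "lambda \<in> \<real>"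
    and nd: "cinner u (\<tau> u) \<noteq> 0"
  shows "(ev has_vector_derivative
    (cinner (\<tau> (V' u)) u + \<Omega> (map_prod P' Q' (T t0 u)) (T t0 u) + \<Omega> (T t0 u) (T' u)) / cinner (\<tau> u) u) (at t0)"
proof -
  interpret b0: block_boundary_problem A "tr t0" "P t0" "Q t0" "\<A> t0" "\<B> t0" "F t0" "G t0"
    by (rule problem[OF t0_mem])
  note near_unit = near_t0_unit[unfolded eventually_nhds_conv_at, THEN conjunct1]
  have u_dom: "u \<in> max_dom A" and max_u: "max_op A u = lambda *\<^sub>C u - V t0 u"
    using b0.L_elem[OF u] by auto
  have e_dom: "\<forall>\<^sub>F t in at t0. e t \<in> max_dom A \<and> max_op A (e t) = ev t *\<^sub>C e t - V t (e t)"
    using near_unit pair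
  proof eventually_elim
    case (elim t)
    interpret b: block_boundary_problem A "tr t" "P t" "Q t" "\<A> t" "\<B> t" "F t" "G t"
      by (rule problem[OF elim(1)])
    show ?case
      using b.L_elem[OF elim(2)] by auto
  qed
  have V_lim: "(V \<longlongrightarrow> V t0) (at t0)"
    using has_vector_derivative_continuous[OF V'] by (simp add: continuous_at)
  have "((\<lambda>t. ev t *\<^sub>C e t - V t (e t)) \<longlongrightarrow> max_op A u) (at t0)"
    unfolding max_u by (intro tendsto_intros ev e V_lim)
  then have max_e: "((\<lambda>t. max_op A (e t)) \<longlongrightarrow> max_op A u) (at t0)"
    by (rule Lim_transform_eventually) (use e_dom in \<open>auto elim: eventually_mono\<close>)
  obtain eta where "coefficient_modulus eta"
    using coefficients_close by (rule exE)
  note eta = coefficient_modulusD[OF this]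
  obtain c where c: "c \<ge> 0" "\<And>p. p \<in> max_dom A \<Longrightarrow> norm (T t0 p) \<le> c * gn p"
    using b0.trace_bounded by blast
  \<comment> \<open>the eigenvectors converge in the graph norm, hence so do their traces\<close>
  have trace_e: "((\<lambda>t. T t (e t)) \<longlongrightarrow> T t0 u) (at t0)"
  proof -
    have "\<forall>\<^sub>F t in at t0. norm (T t (e t) - T t0 u) \<le>
        eta t * (norm (e t) + norm (max_op A (e t))) + c * (norm (e t - u) + norm (max_op A (e t) - max_op A u))"
      using near_unit e_dom
    proof eventually_elim
      case (elim t)
      have d: "e t - u \<in> max_dom A" "max_op A (e t - u) = max_op A (e t) - max_op A u"
        using max_op_diff[OF b0.dense _ u_dom] elim by auto
      have "norm (T t (e t) - T t0 u) \<le> norm (T t (e t) - T t0 (e t)) + norm (T t0 (e t) - T t0 u)"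
        using norm_triangle_ineq[of "T t (e t) - T t0 (e t)" "T t0 (e t) - T t0 u"] by simp
      also have "\<dots> \<le> eta t * gn (e t) + c * gn (e t - u)"
        using elim b0.trace_diff[of "e t" u] u_dom c(2)[OF d(1)] by (intro add_mono eta(6)[OF elim(1)]) auto
      also have "\<dots> \<le> eta t * (norm (e t) + norm (max_op A (e t))) + c * (norm (e t - u) + norm (max_op A (e t - u)))"
        by (intro add_mono mult_left_mono graph_norm2_le eta(2)[OF elim(1)] c(1))
      finally show ?case by (simp add: d(2))
    qed
    moreover have "((\<lambda>t. eta t * (norm (e t) + norm (max_op A (e t)))
        + c * (norm (e t - u) + norm (max_op A (e t) - max_op A u)))
        \<longlongrightarrow> 0 * (norm u + norm (max_op A u)) + c * (norm (u - u) + norm (max_op A u - max_op A u))) (at t0)"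
      by (intro tendsto_intros eta(1) e max_e)
    then have "((\<lambda>t. eta t * (norm (e t) + norm (max_op A (e t)))
        + c * (norm (e t - u) + norm (max_op A (e t) - max_op A u))) \<longlongrightarrow> 0) (at t0)"
      by simp
    ultimately have "((\<lambda>t. T t (e t) - T t0 u) \<longlongrightarrow> 0) (at t0)"
      by (rule Lim_null_comparison)
    then show ?thesis by (simp add: LIM_zero_iff)
  qed
  define N where "N t = cinner (slope V t (e t)) (\<tau> u)
      + \<Omega> (map_prod (blinfun_apply (slope P t)) (blinfun_apply (slope Q t)) (T t (e t))) (T t0 u)
      + \<Omega> (T t (e t)) ((T t u - T t0 u) /\<^sub>R (t - t0))" for t
  have ident: "\<forall>\<^sub>F t in at t0. (ev t - ev t0) /\<^sub>R (t - t0) * cinner (e t) (\<tau> u) = N t"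
    using near_unit e_dom pair
  proof eventually_elim
    case (elim t)
    interpret b: block_boundary_problem A "tr t" "P t" "Q t" "\<A> t" "\<B> t" "F t" "G t"
      by (rule problem[OF elim(1)])
    have "\<Omega> (b0.PQ (T t (e t))) (T t0 u) = 0"
      using b0.isotropic[of "T t (e t)" "T t0 u"] b0.L_elem(3)[OF u] by simp
    then have Om: "\<Omega> (T t (e t)) (T t u) = \<Omega> (b.PQ (T t (e t)) - b0.PQ (T t (e t))) (T t0 u)
        + \<Omega> (T t (e t)) (T t u - T t0 u)"
      using b.L_elem(3)[OF elim(3)] by (simp add: Omega_diff_left Omega_diff_right)
    have cl: "cnj lambda = lambda"
      using real by (simp add: Reals_cnj_iff)
    have "\<Omega> (T t (e t)) (T t u) = cinner (max_op A (e t)) (\<tau> u) - cinner (e t) (\<tau> (max_op A u))"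
      by (rule b.green[symmetric, OF conjunct1[OF elim(2)] u_dom])
    also have "\<dots> = (ev t - lambda) * cinner (e t) (\<tau> u) - cinner ((V t - V t0) (e t)) (\<tau> u)"
      using b0.V_symmetric[of "e t" u]
      by (simp add: conjunct2[OF elim(2)] max_u tau_simps cinner_simps cl blinfun.diff_left algebra_simps)
    finally have "(ev t - lambda) * cinner (e t) (\<tau> u) = cinner ((V t - V t0) (e t)) (\<tau> u)
        + \<Omega> (T t (e t)) (T t u)"
      by (simp only: eq_diff_eq add.commute)
    then have val: "(ev t - lambda) * cinner (e t) (\<tau> u) = cinner ((V t - V t0) (e t)) (\<tau> u)
        + \<Omega> (b.PQ (T t (e t)) - b0.PQ (T t (e t))) (T t0 u) + \<Omega> (T t (e t)) (T t u - T t0 u)"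
      by (simp only: Om add.assoc)
    have "map_prod (blinfun_apply (slope P t)) (blinfun_apply (slope Q t)) (T t (e t))
        = (b.PQ (T t (e t)) - b0.PQ (T t (e t))) /\<^sub>R (t - t0)"
      by (cases "T t (e t)") (simp add: blinfun.scaleR_left blinfun.diff_left)
    then have "N t = complex_of_real (inverse (t - t0)) * (cinner ((V t - V t0) (e t)) (\<tau> u)
        + \<Omega> (b.PQ (T t (e t)) - b0.PQ (T t (e t))) (T t0 u) + \<Omega> (T t (e t)) (T t u - T t0 u))"
      unfolding N_def by (simp only: blinfun.scaleR_left cinner_scaleR scaleR_conv_of_real distrib_left
          bounded_bilinear.scaleR_left[OF Omega_bounded_bilinear]
          bounded_bilinear.scaleR_right[OF Omega_bounded_bilinear])
    then show ?case
      unfolding val[symmetric] by (simp only: scaleR_conv_of_real ev0 mult.assoc)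
  qed
  have slopes: "(slope V \<longlongrightarrow> V') (at t0)" "(slope P \<longlongrightarrow> P') (at t0)" "(slope Q \<longlongrightarrow> Q') (at t0)"
    using V' P' Q' by (simp_all add: has_vector_derivative_iff_quotient)
  have "(N \<longlongrightarrow> cinner (V' u) (\<tau> u) + \<Omega> (map_prod P' Q' (T t0 u)) (T t0 u) + \<Omega> (T t0 u) (T' u)) (at t0)"
    unfolding N_def map_prod_def case_prod_beta
    by (intro tendsto_intros tendsto_Omega blinfun.tendsto slopes e trace_e[unfolded map_prod_def case_prod_beta]
        trace_has_derivative[OF u_dom, unfolded map_prod_def case_prod_beta])
  moreover have D: "((\<lambda>t. cinner (e t) (\<tau> u)) \<longlongrightarrow> cinner u (\<tau> u)) (at t0)"
    by (intro tendsto_intros e)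
  ultimately have "((\<lambda>t. N t / cinner (e t) (\<tau> u)) \<longlongrightarrow>
      (cinner (V' u) (\<tau> u) + \<Omega> (map_prod P' Q' (T t0 u)) (T t0 u) + \<Omega> (T t0 u) (T' u)) / cinner u (\<tau> u)) (at t0)"
    by (intro tendsto_divide nd)
  then have "((\<lambda>t. (ev t - ev t0) /\<^sub>R (t - t0)) \<longlongrightarrow>
      (cinner (V' u) (\<tau> u) + \<Omega> (map_prod P' Q' (T t0 u)) (T t0 u) + \<Omega> (T t0 u) (T' u)) / cinner u (\<tau> u)) (at t0)"
  proof (rule Lim_transform_eventually)
    show "\<forall>\<^sub>F t in at t0. N t / cinner (e t) (\<tau> u) = (ev t - ev t0) /\<^sub>R (t - t0)"
      using ident tendsto_imp_eventually_ne[OF D nd]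
    proof eventually_elim
      case (elim t)
      show ?case
        unfolding elim(1)[symmetric] by (rule nonzero_mult_div_cancel_right[OF elim(2)])
    qed
  qed
  then show ?thesis
    unfolding has_vector_derivative_iff_quotient cinner_tau .
qed

text \<open>Differentiate \<open>P t J + J P t = J\<close>.\<close>

lemma projection_derivative_J: "P' (J f) = - J (P' f)" "Q' (J f) = - J (Q' f)"
proof -
  have *: "R' (J f) = - J (R' f)" if R: "(R has_vector_derivative R') (at t0)"
    and lag: "\<And>t. t \<in> {0..1} \<Longrightarrow> orthogonal_projection (R t) \<and> Lagrangian (range (R t))"
    for R and R' :: "('k \<times> 'k) \<Rightarrow>\<^sub>L ('k \<times> 'k)"
  proof -
    have lim: "((\<lambda>t. slope R t x) \<longlongrightarrow> R' x) (at t0)" for x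
      using R by (intro tendsto_intros) (simp add: has_vector_derivative_iff_quotient)
    have "\<forall>\<^sub>F t in at t0. slope R t (J f) + J (slope R t f) = 0"
      using near_t0_unit[unfolded eventually_nhds_conv_at, THEN conjunct1]
    proof eventually_elim
      case (elim t)
      have "R t (J f) + J (R t f) = J f" "R t0 (J f) + J (R t0 f) = J f"
        using Lagrangian_projection_J lag[OF elim] lag[OF t0_mem] by blast+
      then have "(R t (J f) - R t0 (J f)) + J (R t f - R t0 f) = 0"
        by (simp add: J_linear algebra_simps)
      then show ?case
        by (simp add: blinfun.scaleR_left blinfun.diff_left J_linear flip: scaleR_add_right)
    qed
    moreover have "((\<lambda>t. slope R t (J f) + J (slope R t f)) \<longlongrightarrow> R' (J f) + J (R' f)) (at t0)"
      unfolding J_def case_prod_beta by (intro tendsto_intros lim[unfolded J_def case_prod_beta] lim)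
    ultimately have "R' (J f) + J (R' f) = 0"
      by (intro tendsto_unique[OF trivial_limit_at _ tendsto_eventually])
    then show ?thesis
      by (simp add: eq_neg_iff_add_eq_0)
  qed
  show "P' (J f) = - J (P' f)"
    by (rule *[OF P']) (use problem block_boundary_problem.P in blast)
  show "Q' (J f) = - J (Q' f)"
    by (rule *[OF Q']) (use problem block_boundary_problem.Q in blast)
qed

text \<open>By Green's identity \<open>\<Omega> (T t u) (T t u)\<close> does not depend on \<open>t\<close>; differentiate it.\<close>

lemma trace_derivative_Omega:
  assumes u: "u \<in> max_dom A"
  shows "\<Omega> (T' u) (T t0 u) = - \<Omega> (T t0 u) (T' u)"
proof -
  define s where "s t = (T t u - T t0 u) /\<^sub>R (t - t0)" for t
  have s: "(s \<longlongrightarrow> T' u) (at t0)"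
    unfolding s_def by (rule trace_has_derivative[OF u])
  have Tt: "((\<lambda>t. T t0 u + (t - t0) *\<^sub>R s t) \<longlongrightarrow> T t0 u + (t0 - t0) *\<^sub>R T' u) (at t0)"
    by (intro tendsto_intros s)
  have "\<forall>\<^sub>F t in at t0. t \<noteq> t0"
    by (simp add: eventually_at_filter)
  with near_t0_unit[unfolded eventually_nhds_conv_at, THEN conjunct1]
  have zero: "\<forall>\<^sub>F t in at t0. \<Omega> (s t) (T t0 u + (t - t0) *\<^sub>R s t) + \<Omega> (T t0 u) (s t) = 0"
  proof eventually_elim
    case (elim t)
    have "\<Omega> (T t u) (T t u) = \<Omega> (T t0 u) (T t0 u)"
      using block_boundary_problem.green[OF problem[OF elim(1)] u u]
        block_boundary_problem.green[OF problem[OF t0_mem] u u] by simp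
    then have "\<Omega> (T t u - T t0 u) (T t u) + \<Omega> (T t0 u) (T t u - T t0 u) = 0"
      by (simp add: Omega_diff_left Omega_diff_right)
    then have "\<Omega> (s t) (T t u) + \<Omega> (T t0 u) (s t) = 0"
      unfolding s_def by (simp add: bounded_bilinear.scaleR_left[OF Omega_bounded_bilinear]
          bounded_bilinear.scaleR_right[OF Omega_bounded_bilinear] flip: scaleR_add_right)
    then show ?case
      using elim(2) by (simp add: s_def)
  qed
  define f where "f t = \<Omega> (s t) (T t0 u + (t - t0) *\<^sub>R s t) + \<Omega> (T t0 u) (s t)" for t
  have "(f \<longlongrightarrow> \<Omega> (T' u) (T t0 u + (t0 - t0) *\<^sub>R T' u) + \<Omega> (T t0 u) (T' u)) (at t0)"
    unfolding f_def by (intro tendsto_intros tendsto_Omega s Tt)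
  moreover have "(f \<longlongrightarrow> 0) (at t0)"
    using zero unfolding f_def[symmetric] by (rule tendsto_eventually)
  ultimately have "\<Omega> (T' u) (T t0 u + (t0 - t0) *\<^sub>R T' u) + \<Omega> (T t0 u) (T' u) = 0"
    by (rule tendsto_unique[OF trivial_limit_at])
  then show ?thesis
    by (simp add: eq_neg_iff_add_eq_0)
qed

end

section \<open>The first-order formula\<close>

lemma hilbert_adjoint_eqI:
  assumes "\<And>x y. cinner (T x) y = cinner x (S y)"
  shows "hilbert_adjoint T = S"
  unfolding hilbert_adjoint_def
proof (rule the_equality)
  show "\<forall>x y. cinner (T x) y = cinner x (S y)"
    using assms by blast
  fix S' assume S': "\<forall>x y. cinner (T x) y = cinner x (S' y)"
  show "S' = S"
  proof
    fix y
    show "S' y = S y"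
    proof (rule cinner_ext)
      fix x
      have "cinner x (S' y) = cinner x (S y)"
        using S' assms by metis
      then show "cinner (S' y) x = cinner (S y) x"
        using cinner_commute[of "S' y" x] cinner_commute[of "S y" x] by simp
    qed
  qed
qed

lemma isolated_gap:
  fixes z :: complex
  assumes "z isolated_in S" and "w \<in> S - {z}"
  shows "0 < infdist z (S - {z})"
    and "\<And>y. y \<in> S \<Longrightarrow> dist z y < infdist z (S - {z}) \<Longrightarrow> y = z"
proof -
  obtain d where d: "0 < d" "\<And>y. y \<in> S \<Longrightarrow> dist z y < d \<Longrightarrow> y = z"
    using assms(1) isolated_inE_dist by metis
  have "d \<le> infdist z (S - {z})"
  proof -
    have ne: "S - {z} \<noteq> {}"
      using assms(2) by blast
    show ?thesis
      unfolding infdist_notempty[OF ne] using d(2) by (intro cINF_greatest[OF ne]) (force simp: not_less[symmetric])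
  qed
  then show "0 < infdist z (S - {z})"
    using d(1) by simp
  show "y = z" if "y \<in> S" "dist z y < infdist z (S - {z})" for y
    using that infdist_le[of y "S - {z}" z] by force
qed

lemma derivative_imp_first_order_expansion:
  fixes ev :: "real \<Rightarrow> complex"
  assumes "(ev has_vector_derivative D) (at t0)"
  shows "(\<lambda>t. ev t - (ev t0 + D * of_real (t - t0))) \<in> o[at t0](\<lambda>t. complex_of_real (t - t0))"
proof (rule smalloI_tendsto)
  have "((\<lambda>t. (ev t - ev t0) /\<^sub>R (t - t0) - D) \<longlongrightarrow> 0) (at t0)"
    using assms by (simp add: has_vector_derivative_iff_quotient LIM_zero)
  moreover have "\<forall>\<^sub>F t in at t0. (ev t - ev t0) /\<^sub>R (t - t0) - D
      = (ev t - (ev t0 + D * of_real (t - t0))) / of_real (t - t0)"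
    unfolding eventually_at_filter
    by (rule always_eventually) (auto simp: scaleR_conv_of_real field_simps)
  ultimately show "((\<lambda>t. (ev t - (ev t0 + D * of_real (t - t0))) / of_real (t - t0)) \<longlongrightarrow> 0) (at t0)"
    by (rule Lim_transform_eventually)
  show "\<forall>\<^sub>F t in at t0. complex_of_real (t - t0) \<noteq> 0"
    by (simp add: eventually_at_filter)
qed

context differentiable_family
begin

text \<open>The vector \<open>\<tau> v\<close> annihilates \<open>ker \<phi>\<close>, which lies in the range of \<open>L t0 - \<lambda>\<close>. Hence
\<open>\<langle>x, \<tau> v\<rangle>\<close> is a multiple of \<open>\<phi>(x)\<close>, and inserting \<open>v\<close> gives the factor.\<close>

lemma tau_orthogonal_projection:
  assumes real: "lambda \<in> \<real>" and phi: "cfunctional phi"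
    and surj: "\<And>y. phi y = 0 \<Longrightarrow> \<exists>x. (x, lambda *\<^sub>C x + y) \<in> L t0"
    and phi_e: "phi e = 1" and v: "v = c *\<^sub>C e" "(v, lambda *\<^sub>C v) \<in> L t0" "cinner v (\<tau> v) \<noteq> 0"
  shows "phi x *\<^sub>C e = (cinner x (\<tau> v) / cinner v (\<tau> v)) *\<^sub>C v"
proof -
  interpret b0: block_boundary_problem A "tr t0" "P t0" "Q t0" "\<A> t0" "\<B> t0" "F t0" "G t0"
    by (rule problem[OF t0_mem])
  define y where "y = x - phi x *\<^sub>C e"
  have "phi y = 0"
    by (simp add: y_def cfunctional_simps[OF phi] phi_e)
  then obtain w where w: "(w, lambda *\<^sub>C w + y) \<in> L t0"
    using surj by blast
  have "cnj lambda = lambda"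
    using real by (simp add: Reals_cnj_iff)
  then have "cinner y (\<tau> v) = 0"
    using b0.L_symmetric[OF w v(2)] by (simp add: tau_simps cinner_simps)
  then have x: "cinner x (\<tau> v) = phi x * cinner e (\<tau> v)"
    by (simp add: y_def cinner_simps)
  have k: "cinner v (\<tau> v) = c * cinner e (\<tau> v)"
    by (subst (1) v(1)) (simp add: cinner_scaleC_left)
  then have "phi x = cinner x (\<tau> v) / cinner v (\<tau> v) * c"
    using v(3) x by simp
  then show ?thesis
    by (simp add: v(1) scaleC_scaleC)
qed

text \<open>Since \<open>P0\<close> has rank one, the adjoint of \<open>y \<mapsto> T t0 (P0 y)\<close> is explicit; \<open>\<langle>v, \<tau> v\<rangle>\<close> is real.\<close>

lemma adjoint_trace_projection:
  fixes P0 :: "('h \<times> 'h) \<Rightarrow>\<^sub>L ('h \<times> 'h)"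
  assumes proj: "\<And>x. P0 x = (cinner x (\<tau> v) / cinner v (\<tau> v)) *\<^sub>C v" and v: "v \<in> max_dom A"
  shows "hilbert_adjoint (\<lambda>y. T t0 (P0 y)) = (\<lambda>z. (cinner z (T t0 v) / cinner v (\<tau> v)) *\<^sub>C \<tau> v)"
proof (rule hilbert_adjoint_eqI)
  interpret b0: block_boundary_problem A "tr t0" "P t0" "Q t0" "\<A> t0" "\<B> t0" "F t0" "G t0"
    by (rule problem[OF t0_mem])
  fix x z
  define k where "k = cinner v (\<tau> v)"
  have k: "cnj k = k"
    using cinner_commute[of v "\<tau> v"] by (simp add: k_def cinner_tau)
  have "cinner (T t0 (P0 x)) z = cinner x (\<tau> v) / k * cinner (T t0 v) z"
    unfolding proj b0.trace_scale[OF v] cinner_scaleC_left k_def ..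
  also have "\<dots> = cinner x ((cinner z (T t0 v) / k) *\<^sub>C \<tau> v)"
    using k cinner_commute[of "T t0 v" z] by (simp add: cinner_scaleC_right)
  finally show "cinner (T t0 (P0 x)) z = cinner x ((cinner z (T t0 v) / cinner v (\<tau> v)) *\<^sub>C \<tau> v)"
    by (simp only: k_def)
qed

lemma first_order_operator_zero:
  fixes P0 :: "('h \<times> 'h) \<Rightarrow>\<^sub>L ('h \<times> 'h)"
  assumes proj: "\<And>x. P0 x = (cinner x (\<tau> v) / cinner v (\<tau> v)) *\<^sub>C v" and v: "v \<in> max_dom A"
  shows "first_order_operator P0 V' P' Q' (T t0) T' 0 = 0"
proof -
  interpret b0: block_boundary_problem A "tr t0" "P t0" "Q t0" "\<A> t0" "\<B> t0" "F t0" "G t0"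
    by (rule problem[OF t0_mem])
  have "T t0 0 = 0"
    using b0.trace_scale[OF v, of 0] by (simp only: scaleC_zero_left)
  moreover have "T' (0 *\<^sub>C v) = 0 *\<^sub>C T' v"
    using T' v unfolding has_operator_derivative_on_def bounded_on_def by blast
  then have "T' 0 = 0"
    by (simp only: scaleC_zero_left)
  moreover have "JJ 0 = (0 :: ('k \<times> 'k) \<times> ('k \<times> 'k))" "J 0 = (0 :: 'k \<times> 'k)"
    by (simp_all add: JJ_def J_def zero_prod_def)
  ultimately show ?thesis
    unfolding first_order_operator_def adjoint_trace_projection[OF assms]
    by (simp add: map_prod_def case_prod_beta tau_simps flip: zero_prod_def)
qed

lemma first_order_operator_eigenvector:
  fixes P0 :: "('h \<times> 'h) \<Rightarrow>\<^sub>L ('h \<times> 'h)"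
  assumes proj: "\<And>x. P0 x = (cinner x (\<tau> v) / cinner v (\<tau> v)) *\<^sub>C v"
    and v: "v \<in> max_dom A" "cinner v (\<tau> v) \<noteq> 0"
  shows "first_order_operator P0 V' P' Q' (T t0) T' v =
    ((cinner (\<tau> (V' v)) v + \<Omega> (map_prod P' Q' (T t0 v)) (T t0 v) + \<Omega> (T t0 v) (T' v)) / cinner (\<tau> v) v) *\<^sub>C v"
proof -
  define k where "k = cinner v (\<tau> v)"
  have P0v: "P0 v = v"
    using v(2) by (simp add: proj)
  note adj = adjoint_trace_projection[OF proj v(1), folded k_def]
  have "map_prod (\<lambda>f. P' (J f)) (\<lambda>f. - Q' (J f)) (T t0 v) = - JJ (map_prod P' Q' (T t0 v))"
    by (cases v) (simp add: JJ_def projection_derivative_J)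
  then have X: "cinner (map_prod (\<lambda>f. P' (J f)) (\<lambda>f. - Q' (J f)) (T t0 v)) (T t0 v)
      = - \<Omega> (map_prod P' Q' (T t0 v)) (T t0 v)"
    by (simp add: \<Omega>_def cinner_minus_left)
  have Y: "cinner (JJ (T' v)) (T t0 v) = - \<Omega> (T t0 v) (T' v)"
    using trace_derivative_Omega[OF v(1)] by (simp add: \<Omega>_def)
  have "first_order_operator P0 V' P' Q' (T t0) T' v =
      (cinner (V' v) (\<tau> v) / k) *\<^sub>C v
      - (- \<Omega> (map_prod P' Q' (T t0 v)) (T t0 v) / k) *\<^sub>C v - (- \<Omega> (T t0 v) (T' v) / k) *\<^sub>C v"
    unfolding first_order_operator_def P0v adj tau_simps X Y by (simp only: proj k_def)
  also have "\<dots> = ((cinner (V' v) (\<tau> v) / k) - (- \<Omega> (map_prod P' Q' (T t0 v)) (T t0 v) / k)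
      - (- \<Omega> (T t0 v) (T' v) / k)) *\<^sub>C v"
    by (simp only: scaleC_diff_left)
  also have "(cinner (V' v) (\<tau> v) / k) - (- \<Omega> (map_prod P' Q' (T t0 v)) (T t0 v) / k) - (- \<Omega> (T t0 v) (T' v) / k)
      = (cinner (\<tau> (V' v)) v + \<Omega> (map_prod P' Q' (T t0 v)) (T t0 v) + \<Omega> (T t0 v) (T' v)) / cinner (\<tau> v) v"
    by (simp add: k_def cinner_tau add_divide_distrib)
  finally show ?thesis .
qed

text \<open>The derivative formula is applied to every eigenvector \<open>v = c u\<close> of the first-order operator, with the
approximating eigenvectors \<open>c (e t)\<close>. Its eigenvalue is identified with the
quotient by evaluating the operator at \<open>v\<close>.\<close>

theorem first_order_perturbation:
  assumes z: "\<exists>z. \<forall>\<^sub>F t in nhds t0. z \<notin> Spec (L t)"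
    and simple: "isolated_simple_eigenvalue (L t0) lambda" and real: "lambda \<in> \<real>"
  defines "r \<equiv> infdist lambda (Spec (L t0) - {lambda}) / 2"
  defines "P0 \<equiv> riesz_projection (L t0) lambda r"
  defines "T1 \<equiv> first_order_operator P0 V' P' Q' (T t0) T'"
  shows "range P0 = op_kernel (op_shift (L t0) lambda) \<and> cdim (range P0) = 1 \<and>
    T1 ` range P0 \<subseteq> range P0 \<and>
    (\<exists>ev. (\<forall>\<^sub>F t in nhds t0. Spec (L t) \<inter> ball lambda r = {ev t} \<and>
                           isolated_simple_eigenvalue (L t) (ev t)) \<and>
      (\<forall>lambda1 u. u \<in> range P0 \<and> u \<noteq> 0 \<and> T1 u = lambda1 *\<^sub>C u \<longrightarrow>
        (\<lambda>t. ev t - (lambda + lambda1 * of_real (t - t0))) \<in> o[at t0](\<lambda>t. of_real (t - t0)) \<and>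
        cinner (\<tau> u) u \<noteq> 0 \<and>
        (ev has_vector_derivative
          (cinner (\<tau> (V' u)) u + \<Omega> (map_prod P' Q' (T t0 u)) (T t0 u) + \<Omega> (T t0 u) (T' u))
            / cinner (\<tau> u) u) (at t0)))"
proof -
  interpret b0: block_boundary_problem A "tr t0" "P t0" "Q t0" "\<A> t0" "\<B> t0" "F t0" "G t0"
    by (rule problem[OF t0_mem])
  obtain z0 where z0: "\<forall>\<^sub>F t in nhds t0. z0 \<notin> Spec (L t)"
    using z by blast
  define K where "K t = resolvent (L t) z0" for t
  have K: "\<forall>\<^sub>F t in nhds t0. is_resolvent (L t) z0 (K t)"
    unfolding K_def by (rule eventually_mono[OF z0 is_resolvent_resolvent])
  have K0: "is_resolvent (L t0) z0 (K t0)"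
    by (rule eventually_nhds_x_imp_x[OF K])
  have iso: "lambda isolated_in Spec (L t0)"
    using simple by (simp add: isolated_simple_eigenvalue_def)
  note gap = isolated_gap[OF iso b0.opposite_eigenvalue[OF K0 simple real]]
  have r: "0 < r"
    using gap(1) by (simp add: r_def)
  have gap': "\<forall>z\<in>Spec (L t0). dist lambda z < 2 * r \<longrightarrow> z = lambda"
    using gap(2) by (simp add: r_def)
  note perturbation = simple_eigenvalue_perturbation[OF K resolvent_continuous[OF K] simple r gap', folded P0_def]
  obtain phi u ev e where P0': "\<forall>x. P0 x = phi x *\<^sub>C u"
    and phi: "cfunctional phi" "phi u = 1"
    and surj': "\<forall>y. phi y = 0 \<longrightarrow> (\<exists>x. (x, lambda *\<^sub>C x + y) \<in> L t0)"
    and rng: "range P0 = op_kernel (op_shift (L t0) lambda)" and dim: "cdim (range P0) = 1"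
    and ker: "op_kernel (op_shift (L t0) lambda) = cspan {u}" and u0: "u \<noteq> 0"
    and near_t0: "\<forall>\<^sub>F t in nhds t0. Spec (L t) \<inter> ball lambda r = {ev t} \<and> isolated_simple_eigenvalue (L t) (ev t)
       \<and> (e t, ev t *\<^sub>C e t) \<in> L t"
    and ev0: "ev t0 = lambda" and ev: "(ev \<longlongrightarrow> lambda) (at t0)" and e: "(e \<longlongrightarrow> u) (at t0)"
    by (rule perturbation) (rule that)
  note P0 = P0'[rule_format] and surj = surj'[rule_format]
  define D where "D v = (cinner (\<tau> (V' v)) v + \<Omega> (map_prod P' Q' (T t0 v)) (T t0 v) + \<Omega> (T t0 v) (T' v))
            / cinner (\<tau> v) v" for v
  have vec: "(v, lambda *\<^sub>C v) \<in> L t0" "\<exists>c. v = c *\<^sub>C u" if "v \<in> range P0" for v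
    using that unfolding rng by (auto simp: op_kernel_shift_iff) (auto simp: op_kernel_shift_iff[symmetric] ker cspan_singleton)
  have nd: "cinner v (\<tau> v) \<noteq> 0" if "v \<in> range P0" "v \<noteq> 0" for v
    by (rule b0.eigenvector_nondegenerate[OF K0 simple real vec(1)[OF that(1)] that(2)])
  have tau_proj: "P0 x = (cinner x (\<tau> v) / cinner v (\<tau> v)) *\<^sub>C v" if v: "v \<in> range P0" "v \<noteq> 0" for v x
  proof -
    obtain c where c: "v = c *\<^sub>C u"
      using vec(2)[OF v(1)] by blast
    show ?thesis
      unfolding P0 by (rule tau_orthogonal_projection[OF real phi(1) surj phi(2) c vec(1)[OF v(1)] nd[OF v]])
  qed
  have dom: "v \<in> max_dom A" if "v \<in> range P0" for v
    by (rule b0.L_elem(1)[OF vec(1)[OF that]])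
  have T1: "T1 v = D v *\<^sub>C v" if v: "v \<in> range P0" "v \<noteq> 0" for v
    unfolding T1_def D_def by (rule first_order_operator_eigenvector[OF tau_proj[OF v] dom[OF v(1)] nd[OF v]])
  have deriv: "(ev has_vector_derivative D v) (at t0)" if v: "v \<in> range P0" "v \<noteq> 0" for v
  proof -
    obtain c where c: "v = c *\<^sub>C u"
      using vec(2)[OF v(1)] by blast
    have "\<forall>\<^sub>F t in at t0. t \<in> {0..1} \<and> (e t, ev t *\<^sub>C e t) \<in> L t"
      using near_t0_unit near_t0 unfolding eventually_nhds_conv_at by (auto elim: eventually_elim2)
    then have "\<forall>\<^sub>F t in at t0. (c *\<^sub>C e t, ev t *\<^sub>C (c *\<^sub>C e t)) \<in> L t"
      using K[unfolded eventually_nhds_conv_at, THEN conjunct1]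
    proof eventually_elim
      case (elim t)
      have "(e t, ev t *\<^sub>C e t) \<in> L t"
        using elim(1) by blast
      then have 0: "pencil z0 (K t) (ev t) (e t) = 0"
        by (simp only: eigenvector_iff_pencil[OF elim(2)])
      have "pencil z0 (K t) (ev t) (c *\<^sub>C e t) = c *\<^sub>C pencil z0 (K t) (ev t) (e t)"
        using cbounded_pencil[OF is_resolventD(2)[OF elim(2)]] unfolding cbounded_iff by blast
      then show ?case
        by (simp only: eigenvector_iff_pencil[OF elim(2)] 0 scaleC_zero_right)
    qed
    moreover have "((\<lambda>t. c *\<^sub>C e t) \<longlongrightarrow> v) (at t0)"
      unfolding c by (intro tendsto_intros e)
    ultimately show ?thesis
      unfolding D_def by (rule eigenvalue_derivative[OF _ _ ev ev0 vec(1)[OF v(1)] real nd[OF v]])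
  qed
  have "T1 ` range P0 \<subseteq> range P0"
  proof
    fix y assume "y \<in> T1 ` range P0"
    then obtain v where v: "v \<in> range P0" "y = T1 v" by blast
    have "csubspace (range P0)"
      unfolding rng ker by (rule complex_vector.subspace_span)
    moreover have u: "u \<in> range P0"
      unfolding rng ker by (simp add: complex_vector.span_base)
    have "T1 0 = 0"
      unfolding T1_def by (rule first_order_operator_zero[OF tau_proj[OF u u0] dom[OF u]])
    ultimately show "y \<in> range P0"
      using v T1[OF v(1)] by (cases "v = 0") (auto intro: complex_vector.subspace_scale complex_vector.subspace_0)
  qed
  show ?thesis
  proof (intro conjI exI[of _ ev] allI impI rng dim)
    show "T1 ` range P0 \<subseteq> range P0" by fact
    show "\<forall>\<^sub>F t in nhds t0. Spec (L t) \<inter> ball lambda r = {ev t} \<and> isolated_simple_eigenvalue (L t) (ev t)"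
      using near_t0 by (rule eventually_mono) blast
    fix lambda1 v assume "v \<in> range P0 \<and> v \<noteq> 0 \<and> T1 v = lambda1 *\<^sub>C v"
    then have v: "v \<in> range P0" "v \<noteq> 0" and T1v: "T1 v = lambda1 *\<^sub>C v" by auto
    have "lambda1 = D v"
      using T1[OF v] T1v v(2) by (simp add: complex_vector.scale_right_imp_eq)
    then show "(\<lambda>t. ev t - (lambda + lambda1 * of_real (t - t0))) \<in> o[at t0](\<lambda>t. of_real (t - t0))"
      using derivative_imp_first_order_expansion[OF deriv[OF v]] by (simp add: ev0)
    show "cinner (\<tau> v) v \<noteq> 0"
      using nd[OF v] by (simp add: cinner_tau)
    show "(ev has_vector_derivative
          (cinner (\<tau> (V' v)) v + \<Omega> (map_prod P' Q' (T t0 v)) (T t0 v) + \<Omega> (T t0 v) (T' v))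
            / cinner (\<tau> v) v) (at t0)"
      using deriv[OF v] by (simp only: D_def)
  qed
qed

end

theorem theorem3p10:
  fixes A :: "('h::chilbert_space \<times> 'h) set"
    and tr :: "real \<Rightarrow> 'h \<Rightarrow> 'k::chilbert_space \<times> 'k"
    and P Q :: "real \<Rightarrow> ('k \<times> 'k) \<Rightarrow>\<^sub>L ('k \<times> 'k)"
    and \<A> \<B> :: "real \<Rightarrow> ('h \<times> 'h) set"
    and F G :: "real \<Rightarrow> 'h \<Rightarrow>\<^sub>L 'h"
    and T :: "real \<Rightarrow> 'h \<times> 'h \<Rightarrow> ('k \<times> 'k) \<times> ('k \<times> 'k)"
    and N L :: "real \<Rightarrow> (('h \<times> 'h) \<times> ('h \<times> 'h)) set"
    and V :: "real \<Rightarrow> ('h \<times> 'h) \<Rightarrow>\<^sub>L ('h \<times> 'h)"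
    and t\<^sub>0 :: real and lambda :: complex and r :: real
    and V' P\<^sub>0 :: "('h \<times> 'h) \<Rightarrow>\<^sub>L ('h \<times> 'h)"
    and T' :: "'h \<times> 'h \<Rightarrow> ('k \<times> 'k) \<times> ('k \<times> 'k)"
    and P' Q' :: "('k \<times> 'k) \<Rightarrow>\<^sub>L ('k \<times> 'k)"
    and T1 :: "'h \<times> 'h \<Rightarrow> 'h \<times> 'h"
  assumes "separable_space (euclidean :: 'h topology)"
    and "separable_space (euclidean :: 'k topology)"
    and "closed A" and "densely_defined A" and "symmetric_operator A"
    and "cfinite_dim (op_kernel (op_shift (op_adjoint A) (- \<i>)))"
    and "cfinite_dim (op_kernel (op_shift (op_adjoint A) \<i>))"
    and "cdim (op_kernel (op_shift (op_adjoint A) (- \<i>))) =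
         cdim (op_kernel (op_shift (op_adjoint A) \<i>))"
    and "\<And>t. t \<in> {0..1} \<Longrightarrow> abstract_trace (op_adjoint A) (tr t)"
    and T_eq: "\<And>t. T t = map_prod (tr t) (tr t)"
    and "\<And>t. t \<in> {0..1} \<Longrightarrow> orthogonal_projection (P t) \<and> Lagrangian (range (P t))"
    and "\<And>t. t \<in> {0..1} \<Longrightarrow> orthogonal_projection (Q t) \<and> Lagrangian (range (Q t))"
    and "\<And>t. t \<in> {0..1} \<Longrightarrow>
           self_adjoint_operator (\<A> t) \<and> A \<subseteq> \<A> t \<and> tr t ` Domain (\<A> t) = range (P t)"
    and "\<And>t. t \<in> {0..1} \<Longrightarrow>
           self_adjoint_operator (\<B> t) \<and> A \<subseteq> \<B> t \<and> tr t ` Domain (\<B> t) = range (Q t)"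
    and N_eq: "\<And>t. N t = antidiag_op (\<A> t) (\<B> t)"
    and "\<And>t. t \<in> {0..1} \<Longrightarrow> bounded_self_adjoint (F t) \<and> bounded_self_adjoint (G t)"
    and V_eq: "\<And>t. V t = antidiag_bounded (F t) (G t)"
    and L_eq: "\<And>t. L t = op_add_bounded (N t) (V t)"
    and "t\<^sub>0 \<in> {0<..<1}"
    and "\<exists>z. \<forall>\<^sub>F t in nhds t\<^sub>0. z \<notin> Spec (L t)"
    and "isolated_simple_eigenvalue (L t\<^sub>0) lambda"
    and "has_operator_derivative_on (Domain (op_adjoint A) \<times> Domain (op_adjoint A))
           (graph_norm2 (op_adjoint A)) T T' t\<^sub>0"
    and "(V has_vector_derivative V') (at t\<^sub>0)"
    and "(P has_vector_derivative P') (at t\<^sub>0)"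
    and "(Q has_vector_derivative Q') (at t\<^sub>0)"
    and r_eq: "r = infdist lambda (Spec (L t\<^sub>0) - {lambda}) / 2"
    and P\<^sub>0_eq: "P\<^sub>0 = riesz_projection (L t\<^sub>0) lambda r"
    and T1_eq: "T1 = first_order_operator P\<^sub>0 V' P' Q' (T t\<^sub>0) T'"
    and "lambda \<in> \<real>"
  shows "range P\<^sub>0 = op_kernel (op_shift (L t\<^sub>0) lambda) \<and> cdim (range P\<^sub>0) = 1 \<and>
    T1 ` range P\<^sub>0 \<subseteq> range P\<^sub>0 \<and>
    (\<exists>ev. (\<forall>\<^sub>F t in nhds t\<^sub>0. Spec (L t) \<inter> ball lambda r = {ev t} \<and>
                           isolated_simple_eigenvalue (L t) (ev t)) \<and>
      (\<forall>lambda1 u. u \<in> range P\<^sub>0 \<and> u \<noteq> 0 \<and> T1 u = lambda1 *\<^sub>C u \<longrightarrow>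
        (\<lambda>t. ev t - (lambda + lambda1 * of_real (t - t\<^sub>0))) \<in> o[at t\<^sub>0](\<lambda>t. of_real (t - t\<^sub>0)) \<and>
        cinner (\<tau> u) u \<noteq> 0 \<and>
        (ev has_vector_derivative
          (cinner (\<tau> (V' u)) u + \<Omega> (map_prod P' Q' (T t\<^sub>0 u)) (T t\<^sub>0 u) + \<Omega> (T t\<^sub>0 u) (T' u))
            / cinner (\<tau> u) u) (at t\<^sub>0)))"
proof -
  have V_fun: "V = (\<lambda>t. antidiag_bounded (F t) (G t))" and T_fun: "T = (\<lambda>t. map_prod (tr t) (tr t))"
    by (simp_all add: fun_eq_iff V_eq T_eq)
  have L_fun: "L t = op_add_bounded (antidiag_op (\<A> t) (\<B> t)) (antidiag_bounded (F t) (G t))" for t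
    by (simp only: L_eq N_eq V_eq)
  have fam: "differentiable_family A tr P Q \<A> \<B> F G t\<^sub>0 T' V' P' Q'"
  proof (rule differentiable_family.intro)
    show "block_boundary_problem A (tr t) (P t) (Q t) (\<A> t) (\<B> t) (F t) (G t)" if "t \<in> {0..1}" for t
      using assms(4) assms(9)[OF that] assms(11-14)[OF that] assms(16)[OF that]
      by (rule block_boundary_problem.intro)
    show "has_operator_derivative_on (max_dom A) (graph_norm2 (op_adjoint A))
        (\<lambda>t. map_prod (tr t) (tr t)) T' t\<^sub>0"
      using assms(22) by (simp only: max_dom_def T_fun)
    show "((\<lambda>t. antidiag_bounded (F t) (G t)) has_vector_derivative V') (at t\<^sub>0)"
      using assms(23) by (simp only: V_fun)
  qed (rule assms)+
  show ?thesis
    using differentiable_family.first_order_perturbation[OF fam _ _ assms(29)] assms(20,21)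
    unfolding r_eq P\<^sub>0_eq T1_eq L_fun T_eq by blast
qed

end
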